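(* Let $n\ge 1$ and let $P(z_1,\dots,z_n;\tau)$ be a product of $\ell$ factors, the $k$-th factor being $\wp^{(m_k)}(z_{i_k}-z_{j_k};\tau)$ with $m_k\ge 0$ and $i_k\neq j_k$ in $\{1,\dots,n\}$, where $\wp^{(m)}$ is the $m$-th $z$-derivative of the Weierstrass function $\wp(z;\tau)$ of the lattice $\mathbb{Z}+\tau\mathbb{Z}$. Let $\pi\in S_n$ be a permutation. Then the constant term of $P$ with respect to the variables $\zeta_j=e^{2\pi i z_j}$ on the domain associated with $\pi$, $$[\zeta_n^0,\dots,\zeta_1^0]\,P=\int_{iy_n}^{1+iy_n}\!\!\cdots\int_{iy_1}^{1+iy_1}P(z_1,\dots,z_n;\tau)\,dz_1\cdots dz_n ,$$ is, as a function of $\tau$, a quasimodular form (for $\mathrm{SL}(2,\mathbb{Z})$) of mixed weight less than or equal to $\sum_{k=1}^{\ell}(2+m_k)$.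
   Context: Here $\tau\in\mathbb{H}$ (upper half plane), $q=e^{2\pi i\tau}$. Integration paths: for $\pi\in S_n$, the heights $y_1,\dots,y_n$ are real numbers with $0\le y_{\pi(n)}<y_{\pi(n-1)}<\dots<y_{\pi(1)}<\operatorname{Im}\tau$ (so $|q\,\zeta_{\pi(j)}|<|\zeta_{\pi(i)}|<|\zeta_{\pi(j)}|$ for $i<j$); each integral is along the horizontal segment $t\mapsto iy_j+t$, $t\in[0,1]$. The value does not depend on the choice of heights with this ordering. Quasimodular forms: the ring of quasimodular forms for $\mathrm{SL}(2,\mathbb{Z})$ is $\mathbb{C}[G_2,G_4,G_6]$, where $G_{2k}(\tau)=-\frac{B_{2k}}{4k}+\sum_{n\ge1}\sigma_{2k-1}(n)q^n$, graded by giving $G_{2k}$ weight $2k$. A quasimodular form of mixed weight $\le K$ is a finite sum of quasimodular forms of (pure) weights $\le K$. *)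

theory Defs
  imports
    "HOL-Complex_Analysis.Complex_Analysis"
    "HOL-Combinatorics.Permutations"
    "HOL-Computational_Algebra.Formal_Power_Series"
begin

definition lattice :: "complex \<Rightarrow> complex set" where
  "lattice \<tau> = {of_int a + of_int b * \<tau> | a b. True}"

definition weierstrass_p :: "complex \<Rightarrow> complex \<Rightarrow> complex" where
  "weierstrass_p \<tau> z =
     1 / z ^ 2 + (\<Sum>\<^sub>\<infinity>\<omega>\<in>lattice \<tau> - {0}. 1 / (z - \<omega>) ^ 2 - 1 / \<omega> ^ 2)"

text \<open>
  \<open>iterated_int y n F z\<close> integrates out \<open>z\<^sub>1, \<dots>, z\<^sub>n\<close>, with \<open>z\<^sub>1\<close> innermost and
  \<open>z\<^sub>n\<close> outermost, \<open>z\<^sub>j\<close> running over the segment from \<open>\<i> y\<^sub>j\<close> to \<open>1 + \<i> y\<^sub>j\<close>; the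
  values of \<open>z\<close> at \<open>1, \<dots>, n\<close> are overwritten and hence irrelevant.
\<close>

primrec iterated_int ::
  "(nat \<Rightarrow> real) \<Rightarrow> nat \<Rightarrow> ((nat \<Rightarrow> complex) \<Rightarrow> complex) \<Rightarrow> (nat \<Rightarrow> complex) \<Rightarrow> complex" where
  "iterated_int y 0 F z = F z"
| "iterated_int y (Suc n) F z =
     contour_integral (linepath (\<i> * of_real (y (Suc n))) (1 + \<i> * of_real (y (Suc n))))
       (\<lambda>w. iterated_int y n F (z(Suc n := w)))"

text \<open>
  The heights of the integration paths belonging to the domain of the permutation \<open>\<pi>\<close>:
  \<open>0 \<le> y\<^bsub>\<pi>(n)\<^esub> < \<dots> < y\<^bsub>\<pi>(1)\<^esub> < Im \<tau>\<close>.
\<close>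

definition admissible_heights ::
  "nat \<Rightarrow> (nat \<Rightarrow> nat) \<Rightarrow> complex \<Rightarrow> (nat \<Rightarrow> real) \<Rightarrow> bool" where
  "admissible_heights n \<pi> \<tau> y \<longleftrightarrow>
     0 \<le> y (\<pi> n) \<and> (\<forall>k\<in>{1..<n}. y (\<pi> (Suc k)) < y (\<pi> k)) \<and> y (\<pi> 1) < Im \<tau>"

text \<open>
  The coefficient of \<open>\<zeta>\<^sub>1\<^sup>0 \<dots> \<zeta>\<^sub>n\<^sup>0\<close> of \<open>F\<close>, where \<open>\<zeta>\<^sub>j = exp (2 \<pi> \<i> z\<^sub>j)\<close>, on the domain
  containing the tori \<open>Im z\<^sub>j = y\<^sub>j\<close>.
\<close>

definition constant_term ::
  "(nat \<Rightarrow> real) \<Rightarrow> nat \<Rightarrow> ((nat \<Rightarrow> complex) \<Rightarrow> complex) \<Rightarrow> complex" where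
  "constant_term y n F = iterated_int y n F (\<lambda>_. 0)"

definition bernoulli_number :: "nat \<Rightarrow> complex" where
  "bernoulli_number n = fact n * fps_nth (fps_X / (fps_exp 1 - 1)) n"

definition divisor_sigma :: "nat \<Rightarrow> nat \<Rightarrow> nat" where
  "divisor_sigma r n = (\<Sum>d | d dvd n. d ^ r)"

text \<open>The Eisenstein series \<open>G\<^sub>w\<close>, indexed by its (even) weight \<open>w\<close>.\<close>

definition eisenstein_G :: "nat \<Rightarrow> complex \<Rightarrow> complex" where
  "eisenstein_G w \<tau> =
     - bernoulli_number w / (2 * of_nat w) +
     (\<Sum>n. of_nat (divisor_sigma (w - 1) (Suc n)) * exp (2 * of_real pi * \<i> * \<tau>) ^ Suc n)"

text \<open>
  The weight \<open>k\<close> part of the graded ring generated over the complex numbers by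
  \<open>G\<^sub>2, G\<^sub>4, G\<^sub>6\<close>: linear combinations of the monomials of weight \<open>k\<close>. Functions matter only
  on the upper half plane.
\<close>

definition quasimodular_form :: "nat \<Rightarrow> (complex \<Rightarrow> complex) \<Rightarrow> bool" where
  "quasimodular_form k f \<longleftrightarrow>
     (\<exists>c :: nat \<Rightarrow> nat \<Rightarrow> nat \<Rightarrow> complex. \<forall>\<tau>. Im \<tau> > 0 \<longrightarrow>
        f \<tau> = (\<Sum>(a, b, d) | 2 * a + 4 * b + 6 * d = k.
          c a b d * eisenstein_G 2 \<tau> ^ a * eisenstein_G 4 \<tau> ^ b * eisenstein_G 6 \<tau> ^ d))"

definition quasimodular_form_mixed :: "nat \<Rightarrow> (complex \<Rightarrow> complex) \<Rightarrow> bool" where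
  "quasimodular_form_mixed K f \<longleftrightarrow>
     (\<exists>g. (\<forall>k\<le>K. quasimodular_form k (g k)) \<and>
          (\<forall>\<tau>. Im \<tau> > 0 \<longrightarrow> f \<tau> = (\<Sum>k\<le>K. g k \<tau>)))"

end

theory Submission
  imports Defs
begin

text \<open>
The variables are integrated out one at a time, and the point is to find a class of functions
that is stable under this. Products of derivatives of \<open>\<wp>\<close> do not suffice: the result of one
integration is no longer elliptic in the other variables. The class \<open>qm_poly\<close> consists of the
polynomials in \<open>G\<^sub>2\<close>, \<open>G\<^sub>4\<close>, \<open>G\<^sub>6\<close> and the derivatives of \<open>A = \<theta>'/\<theta>\<close> at the differences
\<open>z\<^sub>i - z\<^sub>j\<close>, filtered by weight, where the \<open>m\<close>-th derivative of \<open>A\<close> counts \<open>m + 1\<close>. Here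
\<open>A(z + 1) = A(z)\<close> and \<open>A(z + \<tau>) = A(z) - 2 \<pi> \<i>\<close>. It contains the integrand with the right
weight because \<open>\<wp> = - A' + 8 \<pi>\<^sup>2 G\<^sub>2\<close> (\<open>weierstrass_p_eq_deriv_theta_logderiv\<close>).

Let \<open>F\<close> be of weight \<open>k\<close> in this class and let \<open>w\<close> be one of its variables. Since differences
\<open>A(w - z\<^sub>i) - A(w - z\<^sub>j)\<close> are elliptic in \<open>w\<close>, the function \<open>F\<close> is a polynomial in a single
\<open>X = A(w - z\<^sub>a)\<close> with coefficients that are elliptic in \<open>w\<close>. As \<open>w \<mapsto> w + \<tau>\<close> just subtracts
\<open>2 \<pi> \<i>\<close> from \<open>X\<close>, Bernoulli polynomials yield a function \<open>G\<close> of weight \<open>k + 1\<close> in the class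
with \<open>G(w) - G(w + \<tau>) = F(w)\<close> (\<open>telescoping_primitive\<close>). The constant term of \<open>F\<close> in \<open>w\<close> is
therefore the integral of \<open>G\<close> around a strip of height \<open>Im \<tau>\<close>, that is, \<open>2 \<pi> \<i>\<close> times a sum
of residues (\<open>strip_residues\<close>). Which translate of the pole \<open>z\<^sub>j\<close> lies in the strip is decided
by the order of the heights; this is how \<open>\<pi>\<close> enters.

The residues are in the class again, of weight \<open>k\<close> (\<open>qm_poly_laurent\<close>). Indeed Laurent expansion
at \<open>z\<^sub>j\<close> is homogeneous if the local parameter has weight \<open>-1\<close>: the Taylor coefficients of the
factors regular at \<open>z\<^sub>j\<close> are higher derivatives of \<open>A\<close>, and the Laurent coefficients of \<open>A\<close> at
its own pole are Eisenstein series (\<open>theta_logderiv_laurent\<close>). The latter are polynomials in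
\<open>G\<^sub>2\<close>, \<open>G\<^sub>4\<close>, \<open>G\<^sub>6\<close> by the differential equation of \<open>\<wp>\<close> (\<open>wp_coeff_recurrence\<close>).

Together this is \<open>constant_term_one_variable\<close>. When all variables are gone, a polynomial in
\<open>G\<^sub>2\<close>, \<open>G\<^sub>4\<close>, \<open>G\<^sub>6\<close> remains, whose weight is at most that of the integrand.
\<close>

section \<open>Lambert series\<close>

lemma holomorphic_on_uniform_limit:
  fixes f :: "nat \<Rightarrow> complex \<Rightarrow> complex"
  assumes A: "open A" and hol: "\<And>k. f k holomorphic_on A" and lim: "uniform_limit A f g sequentially"
  shows "g holomorphic_on A"
proof (rule holomorphic_uniform_sequence[OF A hol])
  fix w assume "w \<in> A"
  then obtain d where "d > 0" "cball w d \<subseteq> A"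
    using A by (meson open_contains_cball)
  then show "\<exists>d>0. cball w d \<subseteq> A \<and> uniform_limit (cball w d) f g sequentially"
    using uniform_limit_on_subset[OF lim] by blast
qed

text \<open>
With \<open>x = exp (2 \<pi> \<i> z)\<close> and \<open>q = exp (2 \<pi> \<i> \<tau>)\<close> this is, up to the factor \<open>- 2 \<pi> \<i>\<close>, the
contribution of the factors \<open>1 - x q\<^sup>n\<close> of the theta product to its logarithmic derivative in \<open>z\<close>.
Terms with \<open>x q\<^sup>n = 1\<close> have the value 0, so the sum makes sense for all \<open>x\<close>.
\<close>

definition lambert :: "complex \<Rightarrow> complex \<Rightarrow> complex" where
  "lambert q x = (\<Sum>n. x * q ^ Suc n / (1 - x * q ^ Suc n))"

text \<open>
Geometric decay, uniform on discs. It holds only for late terms, because finitely many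
early terms may have poles in the disc.
\<close>

lemma lambert_term_bound:
  fixes q :: complex
  assumes "norm q < 1" "R > 0"
  shows "\<forall>\<^sub>F n in sequentially. \<forall>x\<in>cball 0 R.
           norm (x * q ^ Suc n) \<le> 1 / 2 \<and> norm (x * q ^ Suc n / (1 - x * q ^ Suc n)) \<le> 2 * R * norm q ^ n"
proof -
  have "(\<lambda>n. R * norm q ^ n) \<longlonglongrightarrow> R * 0"
    by (intro tendsto_intros LIMSEQ_realpow_zero) (use assms in auto)
  then have "\<forall>\<^sub>F n in sequentially. R * norm q ^ n < 1 / 2"
    by (rule order_tendstoD) auto
  then show ?thesis
  proof eventually_elim
    case (elim n)
    show ?case
    proof
      fix x :: complex assume x: "x \<in> cball 0 R"
      have "norm (x * q ^ Suc n) = norm x * (norm q * norm q ^ n)"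
        by (simp add: norm_mult norm_power)
      also have "\<dots> \<le> R * (1 * norm q ^ n)"
        using x assms by (intro mult_mono) auto
      finally have 1: "norm (x * q ^ Suc n) \<le> R * norm q ^ n" by simp
      have 2: "norm (1 - x * q ^ Suc n) \<ge> 1 / 2"
        using norm_triangle_ineq2[of 1 "x * q ^ Suc n"] 1 elim by (simp del: power_Suc)
      have "norm (x * q ^ Suc n / (1 - x * q ^ Suc n)) \<le> (R * norm q ^ n) / (1 / 2)"
        unfolding norm_divide using 1 2 assms by (intro frac_le) auto
      then show "norm (x * q ^ Suc n) \<le> 1 / 2 \<and>
          norm (x * q ^ Suc n / (1 - x * q ^ Suc n)) \<le> 2 * R * norm q ^ n"
        using 1 elim by (auto simp del: power_Suc)
    qed
  qed
qed

lemma summable_lambert: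
  fixes q :: complex
  assumes "norm q < 1"
  shows "summable (\<lambda>n. x * q ^ Suc n / (1 - x * q ^ Suc n))"
proof (rule summable_comparison_test_ev)
  show "\<forall>\<^sub>F n in sequentially. norm (x * q ^ Suc n / (1 - x * q ^ Suc n)) \<le> 2 * (norm x + 1) * norm q ^ n"
    using lambert_term_bound[OF assms, of "norm x + 1"] by (auto elim!: eventually_mono simp: add_nonneg_pos)
  show "summable (\<lambda>n. 2 * (norm x + 1) * norm q ^ n)"
    using assms by (intro summable_mult summable_geometric) auto
qed

text \<open>
Near a point off the poles, the finitely many terms with poles in a surrounding disc are split
off; the tail converges uniformly there and may be differentiated term by term.
\<close>

lemma lambert_has_field_derivative:
  assumes q: "norm q < 1" and x: "\<And>n. x * q ^ Suc n \<noteq> 1"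
  shows "summable (\<lambda>n. q ^ Suc n / (1 - x * q ^ Suc n)\<^sup>2)"
    and "(lambert q has_field_derivative (\<Sum>n. q ^ Suc n / (1 - x * q ^ Suc n)\<^sup>2)) (at x)"
proof -
  define t where "t = (\<lambda>n x. x * q ^ Suc n / (1 - x * q ^ Suc n))"
  define t' where "t' = (\<lambda>n x. q ^ Suc n / (1 - x * q ^ Suc n)\<^sup>2)"
  have t': "(t n has_field_derivative t' n w) (at w)" if "w * q ^ Suc n \<noteq> 1" for n w
    using that unfolding t_def t'_def
    by (auto intro!: derivative_eq_intros simp: field_simps power2_eq_square)
  define R where "R = norm x + 1"
  have R: "R > 0" by (simp add: R_def add_nonneg_pos)
  obtain N where N: "\<And>n w. n \<ge> N \<Longrightarrow> w \<in> cball 0 R \<Longrightarrow>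
      norm (w * q ^ Suc n) \<le> 1 / 2 \<and> norm (t n w) \<le> 2 * R * norm q ^ n"
    using lambert_term_bound[OF q R] unfolding eventually_sequentially t_def by blast
  define T where "T = (\<lambda>w. \<Sum>n. t (n + N) w)"
  have ne: "w * q ^ Suc (n + N) \<noteq> 1" if "w \<in> cball 0 R" for w n
    using N[of "n + N" w] that by auto
  have ul: "uniform_limit (ball 0 R) (\<lambda>k w. \<Sum>n<k. t (n + N) w) T sequentially"
    unfolding T_def
  proof (rule Weierstrass_m_test)
    fix n and w :: complex assume "w \<in> ball 0 R"
    then show "norm (t (n + N) w) \<le> 2 * R * norm q ^ (n + N)" using N[of "n + N" w] by auto
  next
    show "summable (\<lambda>n. 2 * R * norm q ^ (n + N))"
      using q by (subst summable_iff_shift) (intro summable_mult summable_geometric, auto)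
  qed
  have hol: "(\<lambda>w. \<Sum>n<k. t (n + N) w) holomorphic_on ball 0 R" for k
    unfolding t_def using ne by (intro holomorphic_intros) auto
  have hT: "T holomorphic_on ball 0 R"
    by (rule holomorphic_on_uniform_limit[OF open_ball hol ul])
  have xR: "x \<in> ball 0 R" by (simp add: R_def)
  have "(\<lambda>k. deriv (\<lambda>w. \<Sum>n<k. t (n + N) w) x) \<longlonglongrightarrow> deriv T x"
    using deriv_complex_uniform_limit[OF ul _ _ _ xR] hol by simp
  also have "(\<lambda>k. deriv (\<lambda>w. \<Sum>n<k. t (n + N) w) x) = (\<lambda>k. \<Sum>n<k. t' (n + N) x)"
    by (intro ext DERIV_imp_deriv DERIV_sum t') (use ne xR in auto)
  finally have s: "(\<lambda>n. t' (n + N) x) sums deriv T x" by (simp add: sums_def)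
  then have "summable (\<lambda>n. t' (n + N) x)" by (auto simp: sums_iff)
  then have sm: "summable (\<lambda>n. t' n x)" by (subst (asm) summable_iff_shift)
  then show "summable (\<lambda>n. q ^ Suc n / (1 - x * q ^ Suc n)\<^sup>2)" by (simp add: t'_def)
  have eq: "lambert q = (\<lambda>w. T w + (\<Sum>n<N. t n w))"
  proof
    fix w
    have "summable (\<lambda>n. t n w)" unfolding t_def by (rule summable_lambert[OF q])
    then show "lambert q w = T w + (\<Sum>n<N. t n w)"
      unfolding lambert_def T_def t_def by (rule suminf_split_initial_segment)
  qed
  have "(T has_field_derivative deriv T x) (at x)"
    using hT xR by (simp add: holomorphic_derivI)
  moreover have "((\<lambda>w. \<Sum>n<N. t n w) has_field_derivative (\<Sum>n<N. t' n x)) (at x)"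
    by (intro DERIV_sum t') (use x in auto)
  ultimately have "(lambert q has_field_derivative deriv T x + (\<Sum>n<N. t' n x)) (at x)"
    unfolding eq by (rule DERIV_add)
  also have "deriv T x + (\<Sum>n<N. t' n x) = (\<Sum>n. t' n x)"
    using s sm suminf_split_initial_segment[OF sm, of N] by (simp add: sums_iff)
  finally show "(lambert q has_field_derivative (\<Sum>n. q ^ Suc n / (1 - x * q ^ Suc n)\<^sup>2)) (at x)"
    by (simp add: t'_def)
qed

text \<open>
Multiplying \<open>x\<close> by \<open>q\<close> shifts the index of summation by one. This is the source of the
quasi-periodicity under \<open>z \<mapsto> z + \<tau>\<close>.
\<close>

lemma lambert_shift:
  assumes "norm q < 1"
  shows "lambert q (q * x) = lambert q x - x * q / (1 - x * q)"
  using suminf_split_head[OF summable_lambert[OF assms, of x]]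
  by (simp add: lambert_def algebra_simps)

lemma abs_summable_on_prod:
  fixes f :: "'a \<Rightarrow> real" and g :: "'b \<Rightarrow> real"
  assumes f: "f summable_on A" "\<And>x. x \<in> A \<Longrightarrow> f x \<ge> 0" and g: "g summable_on B" "\<And>x. x \<in> B \<Longrightarrow> g x \<ge> 0"
  shows "(\<lambda>p. norm (case p of (x, y) \<Rightarrow> f x * g y)) summable_on (A \<times> B)"
proof -
  have "(\<lambda>y. norm (f x * g y)) summable_on B" if "x \<in> A" for x
    using summable_on_cmult_right[OF g(1), of "f x"] f(2)[OF that] g(2)
    by (subst summable_on_cong[where g = "\<lambda>y. f x * g y"]) auto
  moreover have "(\<lambda>x. norm (infsum (\<lambda>y. norm (f x * g y)) B)) summable_on A"
  proof -
    have "infsum (\<lambda>y. norm (f x * g y)) B = f x * infsum g B" if "x \<in> A" for x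
      using infsum_cmult_right'[of "f x" g B] f(2)[OF that] g(2)
      by (subst infsum_cong[where g = "\<lambda>y. f x * g y"]) auto
    moreover have "(\<lambda>x. norm (f x * infsum g B)) summable_on A"
      using summable_on_cmult_left[OF f(1), of "infsum g B"] f(2) infsum_nonneg[of B g] g(2)
      by (subst summable_on_cong[where g = "\<lambda>x. f x * infsum g B"]) auto
    ultimately show ?thesis by (simp cong: summable_on_cong)
  qed
  ultimately show ?thesis by (subst Infinite_Sum.abs_summable_on_Sigma_iff) auto
qed

text \<open>
The double series of \<open>f d * q ^ (d * n)\<close> over positive \<open>d\<close> and \<open>n\<close> converges absolutely.
Summing it over \<open>n\<close> first, over \<open>d\<close> first, or along the hyperbolas \<open>d * n = N\<close> gives three
expressions for the same number; the last one contains the divisor sums of the Eisenstein series.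
\<close>

lemma lambert_rearrangement:
  fixes f :: "nat \<Rightarrow> complex"
  assumes q: "norm q < 1" and f: "summable (\<lambda>d. norm (f (Suc d)) * norm q ^ Suc d)"
  defines "S \<equiv> (\<Sum>d. f (Suc d) * (q ^ Suc d / (1 - q ^ Suc d)))"
  shows "summable (\<lambda>d. norm (f (Suc d) * (q ^ Suc d / (1 - q ^ Suc d))))"
    and "(\<lambda>n. \<Sum>d. f (Suc d) * (q ^ Suc n) ^ Suc d) sums S"
    and "(\<lambda>n. (\<Sum>d | d dvd Suc n. f d) * q ^ Suc n) sums S"
proof -
  define F where "F = (\<lambda>(d::nat, n::nat). f (Suc d) * q ^ (Suc d * Suc n))"
  have qpow: "norm q ^ Suc d < 1" for d
    using power_strict_mono[of "norm q" 1 "Suc d"] q by simp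
  have "(\<lambda>d. norm (f (Suc d)) * norm q ^ Suc d) summable_on UNIV"
    using f by (intro norm_summable_imp_summable_on) (simp add: norm_mult norm_power)
  moreover have "(\<lambda>n. norm q ^ n) summable_on UNIV"
    using q by (intro norm_summable_imp_summable_on) (simp add: norm_power summable_geometric)
  ultimately have "(\<lambda>p. norm (case p of (d, n) \<Rightarrow> (norm (f (Suc d)) * norm q ^ Suc d) * norm q ^ n)) summable_on (UNIV \<times> UNIV)"
    by (intro abs_summable_on_prod) (auto simp: norm_mult norm_power)
  then have abs: "(\<lambda>p. norm (F p)) summable_on (UNIV \<times> UNIV)"
  proof (rule Infinite_Sum.abs_summable_on_comparison_test)
    fix p :: "nat \<times> nat" assume "p \<in> UNIV \<times> UNIV"
    obtain d n where p: "p = (d, n)" by force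
    have "norm q ^ (Suc d * Suc n) \<le> norm q ^ (Suc d + n)"
      using q by (intro power_decreasing) auto
    then have "norm (F p) \<le> norm (f (Suc d)) * norm q ^ (Suc d + n)"
      by (simp add: F_def p norm_mult norm_power mult_left_mono del: power_Suc)
    then show "norm (F p) \<le> norm (case p of (d, n) \<Rightarrow> norm (f (Suc d)) * norm q ^ Suc d * norm q ^ n)"
      by (simp add: p norm_mult norm_power power_add mult_ac)
  qed
  then obtain T where T: "(F has_sum T) (UNIV \<times> UNIV)"
    using abs_summable_summable summable_on_def by blast
  have in1: "((\<lambda>n. F (d, n)) has_sum f (Suc d) * (q ^ Suc d / (1 - q ^ Suc d))) UNIV" for d
  proof (rule norm_summable_imp_has_sum)
    have "(\<lambda>n. (q ^ Suc d) ^ n) sums (1 / (1 - q ^ Suc d))"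
      by (rule geometric_sums) (use qpow[of d] in \<open>simp add: norm_power del: power_Suc\<close>)
    from sums_mult[OF this, of "f (Suc d) * q ^ Suc d"]
    show "(\<lambda>n. F (d, n)) sums (f (Suc d) * (q ^ Suc d / (1 - q ^ Suc d)))"
      by (simp add: F_def power_mult algebra_simps power_add flip: power_mult)
    have "summable (\<lambda>n. norm (f (Suc d) * q ^ Suc d) * (norm q ^ Suc d) ^ n)"
      by (intro summable_mult summable_geometric) (use qpow[of d] in \<open>simp del: power_Suc\<close>)
    moreover have "norm (F (d, n)) = norm (f (Suc d) * q ^ Suc d) * (norm q ^ Suc d) ^ n" for n
      by (simp only: F_def prod.case norm_mult norm_power power_mult power_Suc[of _ n] mult.assoc)
    ultimately show "summable (\<lambda>n. norm (F (d, n)))" by simp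
  qed
  have 1: "((\<lambda>d. f (Suc d) * (q ^ Suc d / (1 - q ^ Suc d))) has_sum T) UNIV"
    using has_sum_SigmaD[OF T] in1 by simp
  have "(\<lambda>d. norm (f (Suc d) * (q ^ Suc d / (1 - q ^ Suc d)))) summable_on UNIV"
    using has_sum_imp_summable[OF 1] by (rule summable_on_iff_abs_summable_on_complex[THEN iffD1])
  then have "(\<lambda>d. norm (f (Suc d) * (q ^ Suc d / (1 - q ^ Suc d)))) sums
      infsum (\<lambda>d. norm (f (Suc d) * (q ^ Suc d / (1 - q ^ Suc d)))) UNIV"
    by (intro has_sum_imp_sums has_sum_infsum)
  then show "summable (\<lambda>d. norm (f (Suc d) * (q ^ Suc d / (1 - q ^ Suc d))))"
    by (rule sums_summable)
  have TS: "T = S"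
    using has_sum_imp_sums[OF 1] by (simp add: S_def sums_iff)
  have F2: "F (d, n) = f (Suc d) * (q ^ Suc n) ^ Suc d" for d n
    by (simp only: F_def prod.case power_mult[symmetric] mult.commute[of "Suc n"])
  have in2: "((\<lambda>d. F (d, n)) has_sum (\<Sum>d. f (Suc d) * (q ^ Suc n) ^ Suc d)) UNIV" for n
  proof (rule norm_summable_imp_has_sum)
    have "norm (F (d, n)) \<le> norm (f (Suc d)) * norm q ^ Suc d" for d
    proof -
      have "norm q ^ (Suc d * Suc n) \<le> norm q ^ (Suc d)"
        using q by (intro power_decreasing) auto
      then show ?thesis
        by (simp add: F_def norm_mult norm_power mult_left_mono del: power_Suc)
    qed
    then show s: "summable (\<lambda>d. norm (F (d, n)))"
      by (intro summable_comparison_test[OF _ f]) auto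
    have "(\<lambda>d. F (d, n)) sums (\<Sum>d. F (d, n))"
      using summable_norm_cancel[OF s] by (rule summable_sums)
    then show "(\<lambda>d. F (d, n)) sums (\<Sum>d. f (Suc d) * (q ^ Suc n) ^ Suc d)"
      by (simp only: F2)
  qed
  have "((\<lambda>(n, d). F (d, n)) has_sum T) (UNIV \<times> UNIV)"
    using T by (subst has_sum_swap) (simp add: case_prod_unfold)
  from has_sum_SigmaD[OF this, of "\<lambda>n. \<Sum>d. f (Suc d) * (q ^ Suc n) ^ Suc d"] in2
  have "((\<lambda>n. \<Sum>d. f (Suc d) * (q ^ Suc n) ^ Suc d) has_sum T) UNIV" by simp
  then show "(\<lambda>n. \<Sum>d. f (Suc d) * (q ^ Suc n) ^ Suc d) sums S"
    unfolding TS by (rule has_sum_imp_sums)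
  define g where "g = (\<lambda>(d, n). (Suc d * Suc n - 1, Suc d))"
  have bij: "bij_betw g (UNIV \<times> UNIV) (SIGMA n:UNIV. {d. d dvd Suc n})"
    unfolding bij_betw_def
  proof
    show "inj_on g (UNIV \<times> UNIV)"
    proof (rule inj_onI)
      fix p p' assume "g p = g p'"
      moreover obtain d n d' n' where p: "p = (d, n)" "p' = (d', n')" by (metis surj_pair)
      ultimately have "Suc d = Suc d'" "Suc d * Suc n = Suc d' * Suc n'" by (auto simp: g_def)
      then show "p = p'" unfolding p by (metis Suc_mult_cancel1 nat.inject)
    qed
    show "g ` (UNIV \<times> UNIV) = (SIGMA n:UNIV. {d. d dvd Suc n})"
    proof (intro equalityI subsetI)
      fix p assume "p \<in> (SIGMA n:UNIV. {d. d dvd Suc n})"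
      then obtain N e k where p: "p = (N, e)" "Suc N = e * k" by (auto elim!: dvdE)
      then have "e \<noteq> 0" "k \<noteq> 0" by (metis mult_eq_0_iff nat.distinct(1))+
      then have "Suc (e - 1) = e" "Suc (k - 1) = k" by simp_all
      moreover have "N = e * k - 1" using p(2) by simp
      ultimately have "p = g (e - 1, k - 1)" by (simp only: g_def prod.case p(1))
      then show "p \<in> g ` (UNIV \<times> UNIV)" by blast
    next
      fix p assume "p \<in> g ` (UNIV \<times> UNIV)"
      then obtain d n where "p = g (d, n)" by auto
      moreover have "Suc (Suc d * Suc n - 1) = Suc d * Suc n" by simp
      ultimately show "p \<in> (SIGMA n:UNIV. {d. d dvd Suc n})"
        unfolding g_def by (metis (mono_tags, lifting) UNIV_I dvd_triv_left mem_Collect_eq mem_Sigma_iff old.prod.case)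
    qed
  qed
  have "F = (\<lambda>p. (\<lambda>(n, d). f d * q ^ Suc n) (g p))"
    by (auto simp: F_def g_def fun_eq_iff)
  then have "((\<lambda>(n, d). f d * q ^ Suc n) has_sum T) (SIGMA n:UNIV. {d. d dvd Suc n})"
    using T has_sum_reindex_bij_betw[OF bij, of "\<lambda>(n, d). f d * q ^ Suc n" T] by simp
  from has_sum_SigmaD[OF this, of "\<lambda>n. (\<Sum>d | d dvd Suc n. f d) * q ^ Suc n"]
  have "((\<lambda>n. (\<Sum>d | d dvd Suc n. f d) * q ^ Suc n) has_sum T) UNIV"
    by (simp add: sum_distrib_right has_sum_finite)
  then show "(\<lambda>n. (\<Sum>d | d dvd Suc n. f d) * q ^ Suc n) sums S"
    unfolding TS by (rule has_sum_imp_sums)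
qed

lemma lambert_eq_sum_powers:
  assumes q: "norm q < 1" and x: "norm (x * q) < 1"
  shows "summable (\<lambda>d. norm (x ^ Suc d * (q ^ Suc d / (1 - q ^ Suc d))))"
    and "lambert q x = (\<Sum>d. x ^ Suc d * (q ^ Suc d / (1 - q ^ Suc d)))"
proof -
  have sm: "summable (\<lambda>d. norm (x ^ Suc d) * norm q ^ Suc d)"
    using summable_ignore_initial_segment[OF summable_geometric[of "norm (x * q)"], of 1] x
    by (simp add: norm_mult norm_power power_mult_distrib mult_ac)
  note * = lambert_rearrangement[of q "\<lambda>d. x ^ d", OF q sm]
  show "summable (\<lambda>d. norm (x ^ Suc d * (q ^ Suc d / (1 - q ^ Suc d))))" by (rule *(1))
  have lt: "norm (x * q ^ Suc n) < 1" for n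
  proof -
    have "norm (x * q ^ Suc n) = norm (x * q) * norm q ^ n" by (simp add: norm_mult norm_power)
    also have "\<dots> \<le> norm (x * q)" using q by (intro mult_left_le) (auto simp: power_le_one)
    finally show ?thesis using x by linarith
  qed
  have "(\<Sum>d. x ^ Suc d * (q ^ Suc n) ^ Suc d) = x * q ^ Suc n / (1 - x * q ^ Suc n)" for n
  proof -
    have "(\<lambda>d. (x * q ^ Suc n) * (x * q ^ Suc n) ^ d) sums ((x * q ^ Suc n) * (1 / (1 - x * q ^ Suc n)))"
      by (intro sums_mult geometric_sums lt)
    also have "(\<lambda>d. (x * q ^ Suc n) * (x * q ^ Suc n) ^ d) = (\<lambda>d. x ^ Suc d * (q ^ Suc n) ^ Suc d)"
      by (simp only: power_mult_distrib[symmetric] power_Suc[symmetric, of "x * q ^ Suc n"])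
    finally show ?thesis by (simp add: sums_iff)
  qed
  with *(2) show "lambert q x = (\<Sum>d. x ^ Suc d * (q ^ Suc d / (1 - q ^ Suc d)))"
    by (simp add: lambert_def sums_iff)
qed

section \<open>The exponential function and the period lattice\<close>

definition qexp :: "complex \<Rightarrow> complex" where
  "qexp z = exp (2 * of_real pi * \<i> * z)"

lemma qexp_nonzero [simp]: "qexp z \<noteq> 0"
  by (simp add: qexp_def)

lemma qexp_add: "qexp (w + z) = qexp w * qexp z"
  by (simp add: qexp_def ring_distribs exp_add)

lemma qexp_minus: "qexp (- z) = inverse (qexp z)"
  by (simp add: qexp_def exp_minus)

lemma qexp_diff: "qexp (w - z) = qexp w * inverse (qexp z)"
  by (simp add: qexp_def ring_distribs exp_diff divide_inverse exp_minus)

lemma qexp_eq_1_iff: "qexp z = 1 \<longleftrightarrow> z \<in> \<int>"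
proof
  assume "qexp z = 1"
  then obtain n :: int where "Im z = 0" "Re z * (2 * pi) = of_int n * (2 * pi)"
    by (auto simp: qexp_def exp_eq_1 algebra_simps)
  then have "z = of_int n" by (auto simp: complex_eq_iff)
  then show "z \<in> \<int>" by simp
qed (auto simp: qexp_def exp_eq_1 elim!: Ints_cases)

lemma qexp_of_int [simp]: "qexp (of_int n) = 1"
  by (simp add: qexp_eq_1_iff)

lemma qexp_plus_of_int [simp]: "qexp (z + of_int n) = qexp z"
  by (simp add: qexp_add)

lemma qexp_plus_1 [simp]: "qexp (z + 1) = qexp z"
  using qexp_plus_of_int[of z 1] by simp

lemma norm_qexp: "norm (qexp z) = exp (- 2 * pi * Im z)"
  by (simp add: qexp_def)

lemma norm_qexp_less_1: "Im z > 0 \<Longrightarrow> norm (qexp z) < 1"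
  by (simp add: norm_qexp)

lemma qexp_power: "qexp z ^ n = qexp (of_nat n * z)"
  by (simp add: qexp_def mult_ac flip: exp_of_nat_mult)

lemma qexp_has_field_derivative [derivative_intros]:
  assumes "(f has_field_derivative f') (at z within A)"
  shows "((\<lambda>z. qexp (f z)) has_field_derivative (2 * of_real pi * \<i> * f' * qexp (f z))) (at z within A)"
  unfolding qexp_def using assms by (auto intro!: derivative_eq_intros)

lemma of_int_plus_in_lattice: "of_int a + of_int b * \<tau> \<in> lattice \<tau>"
  by (auto simp: lattice_def)

lemma zero_in_lattice [simp]: "0 \<in> lattice \<tau>"
  using of_int_plus_in_lattice[of 0 0] by simp

lemma lattice_add:
  assumes "w \<in> lattice \<tau>" "z \<in> lattice \<tau>"
  shows "w + z \<in> lattice \<tau>"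
proof -
  obtain a b c d where "w = of_int a + of_int b * \<tau>" "z = of_int c + of_int d * \<tau>"
    using assms by (auto simp: lattice_def)
  then have "w + z = of_int (a + c) + of_int (b + d) * \<tau>" by (simp add: algebra_simps)
  then show ?thesis using of_int_plus_in_lattice by metis
qed

lemma lattice_minus:
  assumes "z \<in> lattice \<tau>"
  shows "- z \<in> lattice \<tau>"
proof -
  obtain a b where "z = of_int a + of_int b * \<tau>" using assms by (auto simp: lattice_def)
  then have "- z = of_int (- a) + of_int (- b) * \<tau>" by simp
  then show ?thesis using of_int_plus_in_lattice by metis
qed

lemma lattice_minus_iff [simp]: "- z \<in> lattice \<tau> \<longleftrightarrow> z \<in> lattice \<tau>"
  using lattice_minus[of z \<tau>] lattice_minus[of "- z" \<tau>] by auto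

lemma lattice_diff: "w \<in> lattice \<tau> \<Longrightarrow> z \<in> lattice \<tau> \<Longrightarrow> w - z \<in> lattice \<tau>"
  using lattice_add[of w \<tau> "- z"] lattice_minus[of z \<tau>] by simp

lemma lattice_add_iff: "z \<in> lattice \<tau> \<Longrightarrow> w + z \<in> lattice \<tau> \<longleftrightarrow> w \<in> lattice \<tau>"
  using lattice_add[of w \<tau> z] lattice_diff[of "w + z" \<tau> z] by auto

lemma of_int_in_lattice [simp]: "of_int n \<in> lattice \<tau>"
  using of_int_plus_in_lattice[of n 0] by simp

lemma of_int_mult_in_lattice [simp]: "of_int n * \<tau> \<in> lattice \<tau>"
  using of_int_plus_in_lattice[of 0 n] by simp

lemma of_nat_mult_in_lattice [simp]: "of_nat n * \<tau> \<in> lattice \<tau>"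
  using of_int_mult_in_lattice[of "int n"] by simp

lemma one_in_lattice [simp]: "1 \<in> lattice \<tau>"
  using of_int_in_lattice[of 1] by simp

lemma tau_in_lattice [simp]: "\<tau> \<in> lattice \<tau>"
  using of_int_mult_in_lattice[of 1] by simp

lemma finite_lattice_cball:
  assumes "Im \<tau> > 0"
  shows "finite (lattice \<tau> \<inter> cball 0 R)"
proof -
  define B where "B = \<lceil>R / Im \<tau>\<rceil>"
  define A where "A = \<lceil>R + of_int B * norm \<tau>\<rceil>"
  have "lattice \<tau> \<inter> cball 0 R \<subseteq> (\<lambda>(a, b). of_int a + of_int b * \<tau>) ` ({- A..A} \<times> {- B..B})"
  proof
    fix z assume z: "z \<in> lattice \<tau> \<inter> cball 0 R"
    then obtain a b where ab: "z = of_int a + of_int b * \<tau>" by (auto simp: lattice_def)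
    have "\<bar>of_int b * Im \<tau>\<bar> \<le> R" using abs_Im_le_cmod[of z] z by (simp add: ab)
    then have "\<bar>of_int b\<bar> \<le> R / Im \<tau>" using assms by (simp add: abs_mult field_simps)
    then have b: "\<bar>b\<bar> \<le> B" unfolding B_def by linarith
    have "norm (of_int a :: complex) \<le> norm z + norm (of_int b * \<tau>)"
      using norm_triangle_ineq4[of z "of_int b * \<tau>"] by (simp add: ab)
    also have "\<dots> \<le> R + of_int B * norm \<tau>"
      using z b by (intro add_mono) (auto simp: norm_mult intro!: mult_right_mono)
    finally have "\<bar>of_int a\<bar> \<le> R + of_int B * norm \<tau>" by simp
    then have "\<bar>a\<bar> \<le> A" unfolding A_def by linarith
    with b show "z \<in> (\<lambda>(a, b). of_int a + of_int b * \<tau>) ` ({- A..A} \<times> {- B..B})"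
      unfolding ab by (intro image_eqI[of _ _ "(a, b)"]) auto
  qed
  then show ?thesis by (rule finite_subset) auto
qed

lemma not_islimpt_lattice:
  assumes "Im \<tau> > 0"
  shows "\<not> z islimpt lattice \<tau>"
proof
  assume "z islimpt lattice \<tau>"
  then have "infinite (lattice \<tau> \<inter> ball z 1)" by (simp add: islimpt_eq_infinite_ball)
  moreover have "lattice \<tau> \<inter> ball z 1 \<subseteq> lattice \<tau> \<inter> cball 0 (norm z + 1)"
  proof
    fix y assume y: "y \<in> lattice \<tau> \<inter> ball z 1"
    then have "norm (y - z) < 1" by (simp add: dist_norm norm_minus_commute)
    then have "norm y \<le> norm z + 1" using norm_triangle_ineq2[of y z] by linarith
    with y show "y \<in> lattice \<tau> \<inter> cball 0 (norm z + 1)" by simp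
  qed
  ultimately show False using finite_lattice_cball[OF assms] finite_subset by blast
qed

lemma eventually_at_not_in_lattice:
  "Im \<tau> > 0 \<Longrightarrow> \<forall>\<^sub>F z in at w. z \<notin> lattice \<tau>"
  using not_islimpt_lattice[of \<tau> w] by (simp add: islimpt_iff_eventually)

lemma closed_lattice: "Im \<tau> > 0 \<Longrightarrow> closed (lattice \<tau>)"
  using not_islimpt_lattice by (auto simp: closed_limpt)

lemma countable_lattice: "countable (lattice \<tau>)"
proof -
  have "lattice \<tau> = range (\<lambda>(a, b). of_int a + of_int b * \<tau>)" by (auto simp: lattice_def)
  then show ?thesis by simp
qed

text \<open>
The poles of the terms of \<open>theta_logderiv\<close> lie at lattice points only.
\<close>

lemma qexp_mult_power_neq_1:
  assumes "z \<notin> lattice \<tau>"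
  shows "qexp z * qexp \<tau> ^ n \<noteq> 1"
proof
  assume "qexp z * qexp \<tau> ^ n = 1"
  then have "z + of_nat n * \<tau> \<in> \<int>" by (simp add: qexp_power flip: qexp_add qexp_eq_1_iff)
  then obtain k where "z + of_nat n * \<tau> = of_int k" by (auto elim: Ints_cases)
  then have "z = of_int k - of_nat n * \<tau>" by (simp add: algebra_simps)
  then have "z \<in> lattice \<tau>" by (simp add: lattice_diff)
  with assms show False by simp
qed

section \<open>The logarithmic derivative of the theta function\<close>

text \<open>
The logarithmic derivative \<open>\<theta>'/\<theta>\<close> of the odd Jacobi theta function, which is also
\<open>\<zeta>(z) - \<eta> z\<close> for the Weierstrass zeta function and its quasi-period \<open>\<eta>\<close> along 1. Its first summand is \<open>\<pi> cot (\<pi> z)\<close>.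
\<close>

definition theta_logderiv :: "complex \<Rightarrow> complex \<Rightarrow> complex" where
  "theta_logderiv \<tau> z = of_real pi * \<i> * ((qexp z + 1) / (qexp z - 1)) +
     2 * of_real pi * \<i> * (lambert (qexp \<tau>) (qexp (- z)) - lambert (qexp \<tau>) (qexp z))"

lemma theta_logderiv_plus_1: "theta_logderiv \<tau> (z + 1) = theta_logderiv \<tau> z"
  by (simp add: theta_logderiv_def qexp_diff[of _ 1] qexp_of_int[of 1, simplified])

lemma theta_logderiv_minus: "theta_logderiv \<tau> (- z) = - theta_logderiv \<tau> z"
proof -
  have "(inverse (qexp z) + 1) / (inverse (qexp z) - 1) = (1 + qexp z) / (1 - qexp z)"
    by (simp add: divide_simps)
  also have "\<dots> = - ((qexp z + 1) / (qexp z - 1))"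
    by (metis add.commute minus_diff_eq minus_divide_right)
  finally show ?thesis
    by (simp add: theta_logderiv_def qexp_minus algebra_simps)
qed

text \<open>
The translation adds one term to the first Lambert series and removes one from the second;
these terms cancel against the change of the cotangent up to the constant \<open>- 2 \<pi> \<i>\<close>. It is this
additive constant that makes residues compute integrals over a period.
\<close>

lemma theta_logderiv_plus_tau:
  assumes "Im \<tau> > 0" "z \<notin> lattice \<tau>"
  shows "theta_logderiv \<tau> (z + \<tau>) = theta_logderiv \<tau> z - 2 * of_real pi * \<i>"
proof -
  define q x where "q = qexp \<tau>" and "x = qexp z"
  have q: "norm q < 1" "q \<noteq> 0" using assms by (auto simp: q_def norm_qexp)
  have x: "x \<noteq> 0" "x \<noteq> 1" "x * q \<noteq> 1"
    using qexp_mult_power_neq_1[OF assms(2), of 0] qexp_mult_power_neq_1[OF assms(2), of 1]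
    by (auto simp: x_def q_def)
  have 1: "lambert q (x * q) = lambert q x - x * q / (1 - x * q)"
    using lambert_shift[OF q(1), of x] by (simp add: mult.commute)
  have 2: "lambert q (inverse (x * q)) = lambert q (inverse x) + inverse x / (1 - inverse x)"
    using lambert_shift[OF q(1), of "inverse (x * q)"] q(2) by (simp add: field_simps)
  have e: "qexp (z + \<tau>) = x * q" "qexp (- (z + \<tau>)) = inverse (x * q)" "qexp (- z) = inverse x"
    by (simp_all add: x_def q_def qexp_add qexp_minus qexp_diff)
  have *: "(x * q + 1) / (x * q - 1) + 2 * (inverse x / (1 - inverse x) + x * q / (1 - x * q))
      = (x + 1) / (x - 1) - 2"
  proof -
    have a: "(x * q + 1) / (x * q - 1) = - ((x * q + 1) / (1 - x * q))"
      by (metis minus_diff_eq minus_divide_right)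
    have b: "inverse x / (1 - inverse x) = 1 / (x - 1)"
      using x by (simp add: field_simps)
    have "1 - x * q \<noteq> 0" "x - 1 \<noteq> 0" using x by auto
    then show ?thesis unfolding a b by (simp add: divide_simps) (simp add: algebra_simps)
  qed
  have "theta_logderiv \<tau> (z + \<tau>) = of_real pi * \<i> * ((x * q + 1) / (x * q - 1)
      + 2 * (inverse x / (1 - inverse x) + x * q / (1 - x * q)))
      + 2 * of_real pi * \<i> * (lambert q (inverse x) - lambert q x)"
    unfolding theta_logderiv_def e q_def[symmetric] 1 2 by (simp add: algebra_simps)
  also have "\<dots> = theta_logderiv \<tau> z - 2 * of_real pi * \<i>"
    unfolding * theta_logderiv_def e q_def[symmetric] x_def[symmetric] by (simp add: algebra_simps)
  finally show ?thesis .
qed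

text \<open>
This is \<open>- 1 / (4 sin\<^sup>2 (\<pi> z))\<close>.
\<close>

definition csq :: "complex \<Rightarrow> complex" where
  "csq z = qexp z / (1 - qexp z)\<^sup>2"

lemma csq_minus: "csq (- z) = csq z"
proof (cases "qexp z = 1")
  case False
  define x where "x = qexp z"
  have "x \<noteq> 0" by (simp add: x_def)
  then have "inverse x / (1 - inverse x)\<^sup>2 = inverse x / ((x - 1) / x)\<^sup>2"
    by (simp add: diff_divide_distrib inverse_eq_divide)
  also have "\<dots> = x / (1 - x)\<^sup>2"
    using \<open>x \<noteq> 0\<close> by (simp add: power_divide power2_commute[of x 1] power2_eq_square[of x])
  finally show ?thesis by (simp add: csq_def qexp_minus x_def)
qed (auto simp: csq_def qexp_minus)

lemma cot_qexp_has_field_derivative: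
  assumes "qexp z \<noteq> 1"
  shows "((\<lambda>u. of_real pi * \<i> * ((qexp u + 1) / (qexp u - 1))) has_field_derivative 4 * of_real pi ^ 2 * csq z) (at z)"
proof -
  define c x where "c = 2 * of_real pi * \<i>" and "x = qexp z"
  have "((\<lambda>u. (qexp u + 1) / (qexp u - 1)) has_field_derivative
      ((c * 1 * x + 0) * (x - 1) - (x + 1) * (c * 1 * x - 0)) / ((x - 1) * (x - 1))) (at z)"
    unfolding c_def x_def using assms
    by (intro DERIV_divide DERIV_add DERIV_diff qexp_has_field_derivative DERIV_ident DERIV_const) simp
  from DERIV_cmult[OF this, of "of_real pi * \<i>"]
  show ?thesis
  proof (rule DERIV_cong)
    have "((c * 1 * x + 0) * (x - 1) - (x + 1) * (c * 1 * x - 0)) = - 2 * c * x"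
      by (simp add: algebra_simps)
    moreover have "(x - 1) * (x - 1) = (1 - x)\<^sup>2" by (simp add: power2_eq_square algebra_simps)
    moreover have "of_real pi * \<i> * (- 2 * c) = 4 * of_real pi ^ 2"
      by (simp add: c_def power2_eq_square)
    then have "of_real pi * \<i> * (- 2 * c * x / (1 - x)\<^sup>2) = 4 * of_real pi ^ 2 * (x / (1 - x)\<^sup>2)"
      by (metis mult.assoc times_divide_eq_right)
    ultimately show "of_real pi * \<i> * (((c * 1 * x + 0) * (x - 1) - (x + 1) * (c * 1 * x - 0)) / ((x - 1) * (x - 1)))
        = 4 * of_real pi ^ 2 * csq z"
      by (simp only: csq_def x_def)
  qed
qed

lemma theta_logderiv_has_field_derivative:
  assumes "Im \<tau> > 0" "z \<notin> lattice \<tau>"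
  shows "summable (\<lambda>n. csq (z + of_nat (Suc n) * \<tau>))"
    and "(theta_logderiv \<tau> has_field_derivative 4 * of_real pi ^ 2 *
           (csq z + (\<Sum>n. csq (- z + of_nat (Suc n) * \<tau>)) + (\<Sum>n. csq (z + of_nat (Suc n) * \<tau>)))) (at z)"
proof -
  define q x where "q = qexp \<tau>" and "x = qexp z"
  have q: "norm q < 1" "q \<noteq> 0" using assms by (auto simp: q_def norm_qexp)
  have x: "x \<noteq> 0" "x \<noteq> 1"
    using qexp_mult_power_neq_1[OF assms(2), of 0] by (auto simp: x_def q_def)
  have sums: "summable (\<lambda>n. csq (w + of_nat (Suc n) * \<tau>))"
     "((\<lambda>u. lambert q (qexp u)) has_field_derivative 2 * of_real pi * \<i> * (\<Sum>n. csq (w + of_nat (Suc n) * \<tau>))) (at w)"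
    if w: "w \<notin> lattice \<tau>" for w
  proof -
    have csq: "csq (w + of_nat (Suc n) * \<tau>) = qexp w * (q ^ Suc n / (1 - qexp w * q ^ Suc n)\<^sup>2)" for n
      by (simp add: csq_def qexp_add q_def qexp_power del: power_Suc of_nat_Suc)
    have ne: "qexp w * q ^ Suc n \<noteq> 1" for n
      unfolding q_def by (rule qexp_mult_power_neq_1[OF w])
    have s: "summable (\<lambda>n. q ^ Suc n / (1 - qexp w * q ^ Suc n)\<^sup>2)"
      by (rule lambert_has_field_derivative(1)[OF q(1) ne])
    show "summable (\<lambda>n. csq (w + of_nat (Suc n) * \<tau>))"
      unfolding csq by (intro summable_mult s)
    have "((\<lambda>u. lambert q (qexp u)) has_field_derivative
        (\<Sum>n. q ^ Suc n / (1 - qexp w * q ^ Suc n)\<^sup>2) * (2 * of_real pi * \<i> * 1 * qexp w)) (at w)"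
      by (rule DERIV_chain2[where f = "lambert q" and g = qexp, OF lambert_has_field_derivative(2)[OF q(1) ne]])
         (intro derivative_intros)
    also have "(\<Sum>n. q ^ Suc n / (1 - qexp w * q ^ Suc n)\<^sup>2) * (2 * of_real pi * \<i> * 1 * qexp w) =
        2 * of_real pi * \<i> * (\<Sum>n. csq (w + of_nat (Suc n) * \<tau>))"
      unfolding csq suminf_mult[OF s] by simp
    finally show "((\<lambda>u. lambert q (qexp u)) has_field_derivative 2 * of_real pi * \<i> * (\<Sum>n. csq (w + of_nat (Suc n) * \<tau>))) (at w)" .
  qed
  show "summable (\<lambda>n. csq (z + of_nat (Suc n) * \<tau>))" by (rule sums(1)[OF assms(2)])
  have d1: "((\<lambda>u. lambert q (qexp (- u))) has_field_derivative
      2 * of_real pi * \<i> * (\<Sum>n. csq (- z + of_nat (Suc n) * \<tau>)) * (- 1)) (at z)"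
    by (rule DERIV_chain2[where f = "\<lambda>u. lambert q (qexp u)" and g = uminus, OF sums(2)])
       (use assms in \<open>auto intro!: derivative_eq_intros\<close>)
  have d2: "((\<lambda>u. of_real pi * \<i> * ((qexp u + 1) / (qexp u - 1))) has_field_derivative 4 * of_real pi ^ 2 * csq z) (at z)"
    using x by (intro cot_qexp_has_field_derivative) (simp add: x_def)
  have "((\<lambda>z. of_real pi * \<i> * ((qexp z + 1) / (qexp z - 1)) +
     2 * of_real pi * \<i> * (lambert q (qexp (- z)) - lambert q (qexp z))) has_field_derivative
     4 * of_real pi ^ 2 * csq z + 2 * of_real pi * \<i> * (
      2 * of_real pi * \<i> * (\<Sum>n. csq (- z + of_nat (Suc n) * \<tau>)) * (- 1)
      - 2 * of_real pi * \<i> * (\<Sum>n. csq (z + of_nat (Suc n) * \<tau>)))) (at z)"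
    by (intro DERIV_add DERIV_cmult DERIV_diff d1 d2 sums(2) assms(2))
  moreover have "theta_logderiv \<tau> = (\<lambda>z. of_real pi * \<i> * ((qexp z + 1) / (qexp z - 1)) +
     2 * of_real pi * \<i> * (lambert q (qexp (- z)) - lambert q (qexp z)))"
    by (simp add: theta_logderiv_def fun_eq_iff q_def)
  ultimately have "(theta_logderiv \<tau> has_field_derivative 4 * of_real pi ^ 2 * csq z + 2 * of_real pi * \<i> * (
      2 * of_real pi * \<i> * (\<Sum>n. csq (- z + of_nat (Suc n) * \<tau>)) * (- 1)
      - 2 * of_real pi * \<i> * (\<Sum>n. csq (z + of_nat (Suc n) * \<tau>)))) (at z)" by (simp only:)
  then show "(theta_logderiv \<tau> has_field_derivative 4 * of_real pi ^ 2 *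
           (csq z + (\<Sum>n. csq (- z + of_nat (Suc n) * \<tau>)) + (\<Sum>n. csq (z + of_nat (Suc n) * \<tau>)))) (at z)"
    by (rule DERIV_cong) (simp add: algebra_simps power2_eq_square)
qed

lemma theta_logderiv_holomorphic:
  assumes "Im \<tau> > 0"
  shows "theta_logderiv \<tau> holomorphic_on - lattice \<tau>"
  using theta_logderiv_has_field_derivative(2)[OF assms]
  by (auto simp: holomorphic_on_def field_differentiable_def intro: has_field_derivative_at_within)

section \<open>Laurent coefficients and Eisenstein series\<close>

definition bernoulli_fps :: "complex fps" where
  "bernoulli_fps = fps_X / (fps_exp 1 - 1)"

lemma bernoulli_fps_mult: "bernoulli_fps * (fps_exp 1 - 1) = fps_X"
proof -
  have "(fps_exp 1 - 1 :: complex fps) $ 1 = 1" by simp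
  then have "fps_exp 1 - 1 \<noteq> (0 :: complex fps)" "subdegree (fps_exp 1 - 1 :: complex fps) = 1"
    by (auto intro!: subdegreeI)
  then have "(fps_exp 1 - 1 :: complex fps) dvd fps_X"
    by (subst fps_dvd_iff) auto
  then show ?thesis unfolding bernoulli_fps_def by (rule dvd_div_mult_self)
qed

lemma bernoulli_fps_nth_0: "bernoulli_fps $ 0 = 1"
proof -
  have "(bernoulli_fps * (fps_exp 1 - 1)) $ 1 = 1" by (simp add: bernoulli_fps_mult)
  then show ?thesis by (simp add: fps_mult_nth numeral_2_eq_2)
qed

text \<open>
Substituting \<open>-X\<close> in \<open>B (exp X - 1) = X\<close> shows \<open>B(-X) = X + B(X)\<close>.
\<close>

lemma bernoulli_fps_nth_odd:
  shows "bernoulli_fps $ 1 = - 1 / 2" and "odd n \<Longrightarrow> n \<noteq> 1 \<Longrightarrow> bernoulli_fps $ n = 0"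
proof -
  define F where "F = bernoulli_fps"
  define E where "E = (fps_exp 1 :: complex fps)"
  have E: "E * fps_exp (-1) = 1" by (simp add: E_def flip: fps_exp_add_mult)
  have F: "F * (E - 1) = fps_X" using bernoulli_fps_mult by (simp add: F_def E_def)
  have "E - 1 \<noteq> 0" using F by auto
  have "(F oo - fps_X) * (fps_exp (-1) - 1) = - fps_X"
    using arg_cong[OF F, of "\<lambda>f. f oo - fps_X"]
    by (simp add: fps_compose_mult_distrib fps_compose_sub_distrib E_def fps_X_fps_compose_startby0)
  then have "(F oo - fps_X) * (fps_exp (-1) - 1) * E = - fps_X * E" by simp
  moreover have "(F oo - fps_X) * (fps_exp (-1) - 1) * E = - (F oo - fps_X) * (E - 1)"
    using E by (simp add: algebra_simps)
  ultimately have "(F oo - fps_X) * (E - 1) = fps_X * E" by simp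
  also have "\<dots> = (fps_X + F) * (E - 1)" using F by (simp add: algebra_simps)
  finally have "F oo - fps_X = fps_X + F" using \<open>E - 1 \<noteq> 0\<close> by simp
  then have *: "(-1) ^ n * F $ n = (fps_X + F) $ n" for n
    by (metis fps_nth_Abs_fps fps_compose_uminus')
  show "bernoulli_fps $ 1 = - 1 / 2" using *[of 1] by (simp add: F_def field_simps add_eq_0_iff)
  show "odd n \<Longrightarrow> n \<noteq> 1 \<Longrightarrow> bernoulli_fps $ n = 0" using *[of n] by (simp add: F_def)
qed

lemma bernoulli_number_conv: "bernoulli_number n = fact n * bernoulli_fps $ n"
  by (simp add: bernoulli_number_def bernoulli_fps_def)

lemma has_laurent_expansion_inverse_exp_minus_1:
  assumes c: "c \<noteq> 0"
  shows "(\<lambda>z. c / (exp (c * z) - 1)) has_laurent_expansion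
     fls_shift 1 (fps_to_fls (Abs_fps (\<lambda>n. c ^ n * bernoulli_fps $ n)))"
proof -
  define E where "E = fps_to_fls (fps_exp c - 1)"
  define F where "F = Abs_fps (\<lambda>n. c ^ n * bernoulli_fps $ n)"
  have "F = bernoulli_fps oo (fps_const c * fps_X)" unfolding F_def by (rule fps_compose_linear[symmetric])
  then have "F * (fps_exp c - 1) = (bernoulli_fps * (fps_exp 1 - 1)) oo (fps_const c * fps_X)"
    by (simp add: fps_compose_mult_distrib fps_compose_sub_distrib)
  also have "\<dots> = fps_const c * fps_X"
    by (simp add: bernoulli_fps_mult fps_X_fps_compose_startby0)
  finally have "fps_to_fls F * E = fps_to_fls (fps_const c * fps_X)"
    by (simp only: E_def fls_times_fps_to_fls[symmetric])
  then have "fls_shift 1 (fps_to_fls F) * E = fls_shift 1 (fps_to_fls (fps_const c * fps_X))"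
    by (simp add: fls_shifted_times_simps)
  also have "\<dots> = fls_const c"
    by (rule fls_eqI) (auto simp: )
  finally have FE: "fls_shift 1 (fps_to_fls F) * E = fls_const c" .
  then have "E \<noteq> 0" using c by auto
  then have eq: "fls_const c / E = fls_shift 1 (fps_to_fls F)"
    using FE by (metis nonzero_mult_div_cancel_right)
  have "(\<lambda>z. exp (c * z) - 1) has_laurent_expansion E"
    unfolding E_def by (intro has_laurent_expansion_fps has_fps_expansion_diff has_fps_expansion_exp has_fps_expansion_1)
  then have "(\<lambda>z. c / (exp (c * z) - 1)) has_laurent_expansion (fls_const c / E)"
    by (intro has_laurent_expansion_divide has_laurent_expansion_const)
  then show ?thesis by (simp add: eq F_def)
qed

lemma summable_power_times_geometric:
  fixes r :: real
  assumes "0 \<le> r" "r < 1"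
  shows "summable (\<lambda>n. real (Suc n) ^ m * r ^ Suc n)"
proof -
  have "summable (\<lambda>n. real n ^ m * x ^ n)" if "norm x < 1" for x
    using that
  proof (induction m arbitrary: x)
    case 0
    then show ?case by (simp add: summable_geometric)
  next
    case (Suc m)
    have "summable (\<lambda>n. diffs (\<lambda>n. real n ^ m) n * x ^ n)"
      by (rule termdiff_converges[of x 1]) (use Suc in auto)
    then have "summable (\<lambda>n. x * (diffs (\<lambda>n. real n ^ m) n * x ^ n))" by (rule summable_mult)
    then have "summable (\<lambda>n. real (Suc n) ^ Suc m * x ^ Suc n)"
      by (simp add: diffs_def mult_ac)
    then show ?case using summable_Suc_iff[of "\<lambda>n. real n ^ Suc m * x ^ n"] by simp
  qed
  from summable_ignore_initial_segment[OF this[of r], of 1] assms show ?thesis by simp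
qed

text \<open>
The coefficient of \<open>z ^ (w - 1)\<close> in the Laurent expansion of \<open>\<theta>'/\<theta>\<close> at 0. The index is
the weight: the coefficient is a multiple of the Eisenstein series of weight \<open>w\<close>.
\<close>

definition theta_coeff :: "complex \<Rightarrow> nat \<Rightarrow> complex" where
  "theta_coeff \<tau> w = (if w = 0 then 1 else if odd w then 0
     else - 2 * (2 * of_real pi * \<i>) ^ w / fact (w - 1) * eisenstein_G w \<tau>)"

lemma eisenstein_G_series:
  assumes "Im \<tau> > 0" "w > 0"
  shows "eisenstein_G w \<tau> = - bernoulli_number w / (2 * of_nat w) +
     (\<Sum>d. of_nat (Suc d) ^ (w - 1) * (qexp \<tau> ^ Suc d / (1 - qexp \<tau> ^ Suc d)))"
proof -
  have q: "norm (qexp \<tau>) < 1" by (rule norm_qexp_less_1) fact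
  have "summable (\<lambda>d. norm (of_nat (Suc d) ^ (w - 1) :: complex) * norm (qexp \<tau>) ^ Suc d)"
    using summable_power_times_geometric[of "norm (qexp \<tau>)" "w - 1"] q
    by (simp add: norm_power del: of_nat_Suc power_Suc)
  from lambert_rearrangement(3)[OF q, of "\<lambda>d. of_nat d ^ (w - 1)", OF this]
  have "(\<lambda>n. of_nat (divisor_sigma (w - 1) (Suc n)) * qexp \<tau> ^ Suc n) sums
     (\<Sum>d. of_nat (Suc d) ^ (w - 1) * (qexp \<tau> ^ Suc d / (1 - qexp \<tau> ^ Suc d)))"
    by (simp add: divisor_sigma_def del: of_nat_Suc power_Suc)
  then show ?thesis by (simp add: eisenstein_G_def sums_iff qexp_def)
qed

text \<open>
For \<open>x = exp (2 \<pi> \<i> z)\<close> in a small annulus around the unit circle the two Lambert series are power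
series in \<open>x\<close> and in \<open>1 / x\<close>. Differentiating them \<open>m\<close> times at \<open>z = 0\<close> produces the factor \<open>d ^ m\<close>; by
\<open>lambert_rearrangement\<close> the result is a divisor sum series, hence the nonconstant part of an
Eisenstein series.
\<close>

lemma lambert_difference_expansion:
  assumes \<tau>: "Im \<tau> > 0"
  defines "B \<equiv> (\<lambda>z. 2 * of_real pi * \<i> * (lambert (qexp \<tau>) (qexp (- z)) - lambert (qexp \<tau>) (qexp z)))"
  shows "B has_fps_expansion Abs_fps (\<lambda>m. if even m then 0 else - 2 * (2 * of_real pi * \<i>) ^ Suc m / fact m *
      (\<Sum>d. of_nat (Suc d) ^ m * (qexp \<tau> ^ Suc d / (1 - qexp \<tau> ^ Suc d))))"
proof -
  define q where "q = qexp \<tau>"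
  define c where "c = 2 * of_real pi * \<i>"
  \<comment> \<open>For \<open>\<bar>Im z\<bar> < r\<close> both \<open>exp (2 \<pi> \<i> z)\<close> and its inverse are below \<open>\<bar>q\<bar> ^ (- 1 / 2)\<close>.\<close>
  define r where "r = Im \<tau> / 2"
  define \<rho> where "\<rho> = exp (- 2 * pi * r)"
  have q: "norm q < 1" unfolding q_def by (rule norm_qexp_less_1) fact
  have r: "r > 0" using \<tau> by (simp add: r_def)
  have \<rho>: "\<rho> < 1" "\<rho> > 0" using r by (auto simp: \<rho>_def)
  have \<rho>q: "\<rho> * \<rho> = norm q" by (simp add: q_def norm_qexp \<rho>_def r_def flip: exp_add)
  have \<rho>': "1 / \<rho> = exp (2 * pi * r)" by (simp add: \<rho>_def exp_minus inverse_eq_divide)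
  define C where "C = (\<lambda>d. q ^ Suc d / (1 - q ^ Suc d))"
  define t where "t = (\<lambda>d z. c * C d * (exp (- c * of_nat (Suc d) * z) - exp (c * of_nat (Suc d) * z)))"
  have qx: "norm (qexp z) \<le> 1 / \<rho>" "norm (qexp (- z)) \<le> 1 / \<rho>" if "z \<in> ball 0 r" for z
  proof -
    have "\<bar>Im z\<bar> \<le> r" using that abs_Im_le_cmod[of z] by auto
    then have "- Im z \<le> r" "Im z \<le> r" by auto
    then have "2 * pi * (- Im z) \<le> 2 * pi * r" "2 * pi * Im z \<le> 2 * pi * r"
      by (intro mult_left_mono; simp)+
    then show "norm (qexp z) \<le> 1 / \<rho>" "norm (qexp (- z)) \<le> 1 / \<rho>"
      unfolding norm_qexp \<rho>' by (simp_all only: exp_le_cancel_iff) auto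
  qed
  have qe: "qexp z ^ Suc d = exp (c * of_nat (Suc d) * z)" "qexp (- z) ^ Suc d = exp (- c * of_nat (Suc d) * z)" for z d
    by (simp_all add: qexp_def c_def mult_ac del: of_nat_Suc power_Suc flip: exp_of_nat_mult)
  have xq: "norm (x * q) < 1" if "norm x \<le> 1 / \<rho>" for x
  proof -
    have "norm (x * q) \<le> (1 / \<rho>) * (\<rho> * \<rho>)" unfolding norm_mult \<rho>q using that by (intro mult_right_mono) auto
    then show ?thesis using \<rho> by simp
  qed
  have Bt: "B z = (\<Sum>d. t d z)" if z: "z \<in> ball 0 r" for z
  proof -
    note 1 = lambert_eq_sum_powers[OF q xq[OF qx(1)[OF z]]]
    note 2 = lambert_eq_sum_powers[OF q xq[OF qx(2)[OF z]]]
    have "B z = c * ((\<Sum>d. qexp (- z) ^ Suc d * C d) - (\<Sum>d. qexp z ^ Suc d * C d))"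
      unfolding B_def q_def[symmetric] 1(2) 2(2) c_def C_def ..
    also have "\<dots> = (\<Sum>d. c * (qexp (- z) ^ Suc d * C d - qexp z ^ Suc d * C d))"
      using summable_norm_cancel[OF 1(1)] summable_norm_cancel[OF 2(1)]
      by (simp only: C_def suminf_diff suminf_mult summable_diff)
    also have "\<dots> = (\<Sum>d. t d z)" unfolding qe t_def by (simp add: algebra_simps)
    finally show ?thesis .
  qed
  have ul: "uniform_limit (ball 0 r) (\<lambda>k z. \<Sum>d<k. t d z) (\<lambda>z. \<Sum>d. t d z) sequentially"
  proof (rule Weierstrass_m_test)
    show "summable (\<lambda>d. norm c * (2 / (1 - norm q)) * \<rho> ^ Suc d)"
      using \<rho> summable_ignore_initial_segment[OF summable_geometric[of \<rho>], of 1] by (intro summable_mult) auto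
    fix d and z :: complex assume z: "z \<in> ball 0 r"
    have "norm q ^ Suc d \<le> norm q" using q by (simp add: mult_left_le power_le_one)
    then have 1: "1 - norm q \<le> norm (1 - q ^ Suc d)"
      using norm_triangle_ineq2[of 1 "q ^ Suc d"] by (simp add: norm_power norm_mult)
    have "norm (C d) \<le> norm q ^ Suc d / (1 - norm q)"
      unfolding C_def norm_divide norm_power using 1 q by (intro divide_left_mono mult_pos_pos) (auto intro: less_le_trans)
    moreover have "norm (exp (- c * of_nat (Suc d) * z) - exp (c * of_nat (Suc d) * z)) \<le> 2 * (1 / \<rho>) ^ Suc d"
    proof -
      have "norm (exp (- c * of_nat (Suc d) * z)) \<le> (1 / \<rho>) ^ Suc d" "norm (exp (c * of_nat (Suc d) * z)) \<le> (1 / \<rho>) ^ Suc d"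
        unfolding qe[symmetric] norm_power using qx[OF z] by (intro power_mono; simp)+
      then show ?thesis by (intro order.trans[OF norm_triangle_ineq4]) simp
    qed
    ultimately have "norm (t d z) \<le> norm c * (norm q ^ Suc d / (1 - norm q)) * (2 * (1 / \<rho>) ^ Suc d)"
      unfolding t_def norm_mult using q by (intro mult_mono mult_nonneg_nonneg divide_nonneg_nonneg) auto
    also have "\<dots> = norm c * (2 / (1 - norm q)) * (norm q * (1 / \<rho>)) ^ Suc d"
      unfolding power_mult_distrib by simp
    also have "norm q * (1 / \<rho>) = \<rho>" using \<rho> by (simp flip: \<rho>q)
    finally show "norm (t d z) \<le> norm c * (2 / (1 - norm q)) * \<rho> ^ Suc d" .
  qed
  have hol: "(\<lambda>z. \<Sum>d<k. t d z) holomorphic_on ball 0 r" for k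
    unfolding t_def by (intro holomorphic_intros)
  have hT: "(\<lambda>z. \<Sum>d. t d z) holomorphic_on ball 0 r"
    by (rule holomorphic_on_uniform_limit[OF open_ball hol ul])
  have hB: "B holomorphic_on ball 0 r"
    by (rule holomorphic_transform[OF hT]) (simp add: Bt)
  have dexp: "(deriv ^^ m) (\<lambda>z. exp (a * z)) = (\<lambda>z. a ^ m * exp (a * z))" for m and a :: complex
  proof (induction m)
    case (Suc m)
    have "deriv (\<lambda>z. a ^ m * exp (a * z)) z = a ^ Suc m * exp (a * z)" for z
      by (rule DERIV_imp_deriv) (auto intro!: derivative_eq_intros)
    then show ?case by (simp add: Suc fun_eq_iff)
  qed auto
  have dt: "(deriv ^^ m) (\<lambda>z. \<Sum>d<k. t d z) 0 = (\<Sum>d<k. c * C d * ((- c * of_nat (Suc d)) ^ m - (c * of_nat (Suc d)) ^ m))" for k m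
  proof (induction k)
    case (Suc k)
    have "(deriv ^^ m) (\<lambda>z. \<Sum>d<Suc k. t d z) 0 = (deriv ^^ m) (\<lambda>z. \<Sum>d<k. t d z) 0 + (deriv ^^ m) (t k) 0"
      unfolding sum.lessThan_Suc using r
      by (intro higher_deriv_add[OF hol _ open_ball]) (auto simp: t_def intro!: holomorphic_intros)
    also have "(deriv ^^ m) (t k) 0 = c * C k * (deriv ^^ m) (\<lambda>z. exp (- c * of_nat (Suc k) * z) - exp (c * of_nat (Suc k) * z)) 0"
      unfolding t_def by (rule higher_deriv_cmult[of _ UNIV]) (auto intro!: holomorphic_intros)
    also have "(deriv ^^ m) (\<lambda>z. exp (- c * of_nat (Suc k) * z) - exp (c * of_nat (Suc k) * z)) 0 =
        (- c * of_nat (Suc k)) ^ m - (c * of_nat (Suc k)) ^ m"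
    proof -
      have "(deriv ^^ m) (\<lambda>z. exp (- c * of_nat (Suc k) * z) - exp (c * of_nat (Suc k) * z)) 0 =
          (deriv ^^ m) (\<lambda>z. exp (- c * of_nat (Suc k) * z)) 0 - (deriv ^^ m) (\<lambda>z. exp (c * of_nat (Suc k) * z)) 0"
        by (rule higher_deriv_diff[of _ UNIV]) (intro holomorphic_intros open_UNIV UNIV_I)+
      then show ?thesis by (simp only: dexp mult_zero_right exp_zero mult_1_right)
    qed
    finally show ?case by (simp add: Suc.IH)
  qed auto
  have coeff: "(deriv ^^ m) B 0 = (if even m then 0 else - 2 * c ^ Suc m * (\<Sum>d. of_nat (Suc d) ^ m * C d))" for m
  proof -
    have "(deriv ^^ m) B 0 = (deriv ^^ m) (\<lambda>z. \<Sum>d. t d z) 0"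
      by (rule higher_deriv_transform_within_open[OF hB hT open_ball]) (use Bt r in auto)
    moreover have "(\<lambda>k. (deriv ^^ m) (\<lambda>z. \<Sum>d<k. t d z) 0) \<longlonglongrightarrow> (deriv ^^ m) (\<lambda>z. \<Sum>d. t d z) 0"
      by (rule higher_deriv_complex_uniform_limit[OF ul]) (use hol r in auto)
    ultimately have "(\<lambda>d. c * C d * ((- c * of_nat (Suc d)) ^ m - (c * of_nat (Suc d)) ^ m)) sums (deriv ^^ m) B 0"
      unfolding dt sums_def by simp
    also have "(\<lambda>d. c * C d * ((- c * of_nat (Suc d)) ^ m - (c * of_nat (Suc d)) ^ m)) =
        (\<lambda>d. (if even m then 0 else - 2 * c ^ Suc m) * (of_nat (Suc d) ^ m * C d))"
      by (auto simp: fun_eq_iff power_mult_distrib power_minus' simp del: of_nat_Suc)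
    finally have *: "(\<lambda>d. (if even m then 0 else - 2 * c ^ Suc m) * (of_nat (Suc d) ^ m * C d)) sums (deriv ^^ m) B 0" .
    have "summable (\<lambda>d. norm (of_nat (Suc d) ^ m :: complex) * norm q ^ Suc d)"
      using summable_power_times_geometric[of "norm q" m] q
      by (simp add: norm_power del: of_nat_Suc power_Suc)
    from summable_norm_cancel[OF lambert_rearrangement(1)[OF q, of "\<lambda>d. of_nat d ^ m", OF this]]
    have "summable (\<lambda>d. of_nat (Suc d) ^ m * C d)"
      by (simp add: C_def del: of_nat_Suc power_Suc)
    from suminf_mult[OF this, of "if even m then 0 else - 2 * c ^ Suc m"] *
    show ?thesis by (auto simp: sums_iff)
  qed
  have "B analytic_on {0}" using hB r by (auto simp: analytic_at intro!: exI[of _ "ball 0 r"])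
  then have "B has_fps_expansion fps_expansion B 0" by (rule analytic_at_imp_has_fps_expansion_0)
  also have "fps_expansion B 0 = Abs_fps (\<lambda>m. if even m then 0 else - 2 * c ^ Suc m / fact m *
      (\<Sum>d. of_nat (Suc d) ^ m * C d))"
    unfolding fps_expansion_def coeff by (auto simp: fps_eq_iff)
  finally show ?thesis unfolding c_def C_def q_def .
qed

text \<open>
The Bernoulli numbers come from the cotangent part and the divisor sums from the Lambert part;
together they are exactly the Eisenstein series with their constant terms.
\<close>

lemma theta_logderiv_laurent:
  assumes \<tau>: "Im \<tau> > 0"
  shows "theta_logderiv \<tau> has_laurent_expansion fls_shift 1 (fps_to_fls (Abs_fps (theta_coeff \<tau>)))"
proof -
  define c where "c = 2 * of_real pi * \<i>"
  have c: "c \<noteq> 0" by (simp add: c_def)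
  define S where "S = (\<lambda>m. \<Sum>d. of_nat (Suc d) ^ m * (qexp \<tau> ^ Suc d / (1 - qexp \<tau> ^ Suc d)))"
  define F1 where "F1 = Abs_fps (\<lambda>n. c ^ n * bernoulli_fps $ n)"
  define F2 where "F2 = Abs_fps (\<lambda>m. if even m then 0 else - 2 * c ^ Suc m / fact m * S m)"
  have 1: "(\<lambda>z. c / 2 + c / (exp (c * z) - 1) +
      2 * of_real pi * \<i> * (lambert (qexp \<tau>) (qexp (- z)) - lambert (qexp \<tau>) (qexp z))) has_laurent_expansion
      fls_const (c / 2) + fls_shift 1 (fps_to_fls F1) + fps_to_fls F2"
    unfolding F1_def F2_def S_def c_def
    by (intro has_laurent_expansion_add has_laurent_expansion_const has_laurent_expansion_inverse_exp_minus_1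
        has_laurent_expansion_fps[OF lambert_difference_expansion] \<tau>) simp
  have "\<forall>\<^sub>F z in at 0. z \<notin> lattice \<tau>" by (rule eventually_at_not_in_lattice[OF \<tau>])
  then have "\<forall>\<^sub>F z in at 0. c / 2 + c / (exp (c * z) - 1) +
      2 * of_real pi * \<i> * (lambert (qexp \<tau>) (qexp (- z)) - lambert (qexp \<tau>) (qexp z)) = theta_logderiv \<tau> z"
  proof eventually_elim
    case (elim z)
    have "qexp z - 1 \<noteq> 0" using qexp_mult_power_neq_1[OF elim, of 0] by simp
    then have "c / 2 + c / (qexp z - 1) = of_real pi * \<i> * ((qexp z + 1) / (qexp z - 1))"
      unfolding c_def by (simp add: divide_simps) (simp add: algebra_simps)
    then show ?case by (simp add: theta_logderiv_def qexp_def c_def)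
  qed
  with 1 have "theta_logderiv \<tau> has_laurent_expansion fls_const (c / 2) + fls_shift 1 (fps_to_fls F1) + fps_to_fls F2"
    by (simp cong: has_laurent_expansion_cong)
  also have "fls_const (c / 2) + fls_shift 1 (fps_to_fls F1) + fps_to_fls F2 = fls_shift 1 (fps_to_fls (Abs_fps (theta_coeff \<tau>)))"
  proof (rule fls_eqI)
    fix n :: int
    consider "n < -1" | "n = -1" | "n = 0" | "n \<ge> 1" by linarith
    then show "fls_nth (fls_const (c / 2) + fls_shift 1 (fps_to_fls F1) + fps_to_fls F2) n =
        fls_nth (fls_shift 1 (fps_to_fls (Abs_fps (theta_coeff \<tau>)))) n"
    proof cases
      case 4
      define m where "m = nat n"
      have n: "n = int m" "m \<ge> 1" using 4 by (auto simp: m_def)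
      have nat: "nat (int m + 1) = Suc m" by simp
      have m: "fls_nth (fls_const (c / 2) + fls_shift 1 (fps_to_fls F1) + fps_to_fls F2) n = F1 $ Suc m + F2 $ m"
        using n by (simp add: nat)
      show ?thesis
      proof (cases "even m")
        case True
        then show ?thesis unfolding m using n
          by (simp add: F1_def F2_def theta_coeff_def nat bernoulli_fps_nth_odd(2))
      next
        case False
        have "theta_coeff \<tau> (Suc m) = - 2 * c ^ Suc m / fact m * (- (fact (Suc m) * bernoulli_fps $ Suc m) / (2 * of_nat (Suc m)) + S m)"
          using False eisenstein_G_series[OF \<tau>, of "Suc m"]
          by (simp add: theta_coeff_def c_def S_def bernoulli_number_conv)
        also have "\<dots> = c ^ Suc m * bernoulli_fps $ Suc m + (- 2 * c ^ Suc m / fact m * S m)"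
          by (simp add: field_simps del: of_nat_Suc)
        finally show ?thesis unfolding m using n False by (simp add: F1_def F2_def nat)
      qed
    qed (auto simp: F1_def F2_def theta_coeff_def bernoulli_fps_nth_0 bernoulli_fps_nth_odd(1)[unfolded One_nat_def])
  qed
  finally show ?thesis .
qed

section \<open>The Weierstrass function in terms of the theta function\<close>

lemma has_sum_int_imp_sums:
  fixes f :: "int \<Rightarrow> complex"
  assumes "(f has_sum S) UNIV"
  shows "(\<lambda>n. f (int (Suc n)) + f (- int (Suc n))) sums (S - f 0)"
proof -
  define P N where "P = range (\<lambda>n. int (Suc n))" and "N = range (\<lambda>n. - int (Suc n))"
  have inj: "inj (\<lambda>n. int (Suc n))" "inj (\<lambda>n. - int (Suc n))" by (auto simp: inj_def)
  have UN: "UNIV = insert 0 (P \<union> N)"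
  proof (intro equalityI subsetI)
    fix k :: int
    consider "k = 0" | "k > 0" | "k < 0" by linarith
    then show "k \<in> insert 0 (P \<union> N)"
    proof cases
      case 2
      then have "k = int (Suc (nat k - 1))" by simp
      then show ?thesis unfolding P_def by blast
    next
      case 3
      then have "k = - int (Suc (nat (- k) - 1))" by simp
      then show ?thesis unfolding N_def by blast
    qed auto
  qed auto
  have disj: "P \<inter> N = {}" "0 \<notin> P \<union> N" by (auto simp: P_def N_def)
  have "f summable_on A" for A
    using has_sum_imp_summable[OF assms] summable_on_subset_banach by blast
  then have P: "(f has_sum infsum f P) P" and N: "(f has_sum infsum f N) N" by auto
  have "(f has_sum (f 0 + (infsum f P + infsum f N))) UNIV"
    unfolding UN by (intro has_sum_insert has_sum_Un_disjoint P N disj)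
  then have S: "S = f 0 + (infsum f P + infsum f N)" using assms by (metis has_sum_unique)
  have "(\<lambda>n. f (int (Suc n))) sums infsum f P"
    using P unfolding P_def by (subst (asm) has_sum_reindex[OF inj(1)]) (auto simp: o_def dest: has_sum_imp_sums)
  moreover have "(\<lambda>n. f (- int (Suc n))) sums infsum f N"
    using N unfolding N_def by (subst (asm) has_sum_reindex[OF inj(2)]) (auto simp: o_def dest: has_sum_imp_sums)
  ultimately show ?thesis by (auto simp: S dest: sums_add)
qed

lemma has_sum_intI:
  fixes f :: "int \<Rightarrow> 'a :: banach"
  assumes "summable (\<lambda>n. norm (f (int n)))" "summable (\<lambda>n. norm (f (- int (Suc n))))"
    "(\<lambda>n. f (int n)) sums A" "(\<lambda>n. f (- int (Suc n))) sums B"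
  shows "(f has_sum (A + B)) UNIV"
proof -
  define P N where "P = range int" and "N = range (\<lambda>n. - int (Suc n))"
  have inj: "inj int" "inj (\<lambda>n. - int (Suc n))" by (auto simp: inj_def)
  have UN: "UNIV = P \<union> N"
  proof (intro equalityI subsetI)
    fix k :: int
    consider "k \<ge> 0" | "k < 0" by linarith
    then show "k \<in> P \<union> N"
    proof cases
      case 1
      then have "k = int (nat k)" by simp
      then show ?thesis unfolding P_def by blast
    next
      case 2
      then have "k = - int (Suc (nat (- k) - 1))" by simp
      then show ?thesis unfolding N_def by blast
    qed
  qed auto
  have "(f has_sum A) P" "(f has_sum B) N"
    unfolding P_def N_def has_sum_reindex[OF inj(1)] has_sum_reindex[OF inj(2)] o_def
    using assms by (auto intro: norm_summable_imp_has_sum)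
  moreover have "P \<inter> N = {}" by (auto simp: P_def N_def)
  ultimately show ?thesis unfolding UN by (intro has_sum_Un_disjoint)
qed

lemma summable_inverse_square_shift:
  fixes z :: complex
  shows "summable (\<lambda>n. norm (1 / (z + of_nat n)\<^sup>2))"
proof (rule summable_comparison_test_ev)
  show "summable (\<lambda>n. 4 * inverse (real n ^ 2))"
    by (intro summable_mult inverse_power_summable) auto
  have "norm (norm (1 / (z + of_nat n)\<^sup>2)) \<le> 4 * inverse (real n ^ 2)" if "n \<ge> nat \<lceil>2 * norm z\<rceil> + 1" for n
  proof -
    have "real n \<ge> 2 * norm z" "n > 0" using that by linarith+
    moreover have "real n - norm z \<le> norm (z + of_nat n)"
      using norm_triangle_ineq2[of "of_nat n" "- z"] by (simp add: add.commute)
    ultimately have "real n / 2 \<le> norm (z + of_nat n)" by linarith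
    then have "(real n / 2) ^ 2 \<le> norm (z + of_nat n) ^ 2" by (intro power_mono) auto
    then have "1 / norm (z + of_nat n) ^ 2 \<le> 1 / (real n / 2) ^ 2"
      using \<open>n > 0\<close> by (intro divide_left_mono mult_pos_pos) (auto intro: less_le_trans[rotated])
    then show ?thesis by (simp add: norm_divide norm_power field_simps)
  qed
  then show "\<forall>\<^sub>F n in sequentially. norm (norm (1 / (z + of_nat n)\<^sup>2)) \<le> 4 * inverse (real n ^ 2)"
    unfolding eventually_sequentially by blast
qed

lemma qexp_quotient_eq_cot:
  assumes "z \<notin> \<int>"
  shows "of_real pi * \<i> * ((qexp z + 1) / (qexp z - 1)) = of_real pi * cos (of_real pi * z) / sin (of_real pi * z)"
proof -
  define e where "e = exp (\<i> * (of_real pi * z))"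
  have e0: "e \<noteq> 0" by (simp add: e_def)
  have x: "qexp z = e * e" by (simp add: qexp_def e_def mult_ac flip: exp_add)
  have em: "exp (- (\<i> * (of_real pi * z))) = inverse e" by (simp add: e_def exp_minus)
  have "e * e \<noteq> 1" using assms qexp_eq_1_iff[of z] by (simp add: x)
  then have "e * e - 1 \<noteq> 0" by simp
  then have ne: "e - inverse e \<noteq> 0" using e0 by (simp add: field_simps)
  have "cos (of_real pi * z) / sin (of_real pi * z) = \<i> * ((e + inverse e) / (e - inverse e))"
    unfolding sin_exp_eq cos_exp_eq em e_def[symmetric] using ne by (simp add: divide_simps)
  also have "(e + inverse e) / (e - inverse e) = (e * (e + inverse e)) / (e * (e - inverse e))"
    using e0 by simp
  also have "\<dots> = (qexp z + 1) / (qexp z - 1)" using e0 by (simp add: x ring_distribs)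
  finally have E: "cos (of_real pi * z) / sin (of_real pi * z) = \<i> * ((qexp z + 1) / (qexp z - 1))" .
  have "of_real pi * \<i> * ((qexp z + 1) / (qexp z - 1)) = of_real pi * (cos (of_real pi * z) / sin (of_real pi * z))"
    by (simp only: E mult.assoc)
  then show ?thesis by (simp only: times_divide_eq_right)
qed

text \<open>
The logarithmic derivative of Euler's reflection formula for the gamma function.
\<close>

lemma Digamma_reflection:
  fixes z :: complex
  assumes "z \<notin> \<int>"
  shows "Digamma (1 - z) - Digamma z = of_real pi * cos (of_real pi * z) / sin (of_real pi * z)"
proof -
  have nz: "z \<notin> \<int>\<^sub>\<le>\<^sub>0" "1 - z \<notin> \<int>\<^sub>\<le>\<^sub>0"
    using assms nonpos_Ints_Int[of z] nonpos_Ints_Int[of "1 - z"] Ints_diff[of 1 "1 - z"] by auto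
  have refl: "rGamma w * rGamma (1 - w) = sin (of_real pi * w) / of_real pi" for w :: complex
    by (rule rGamma_reflection_complex)
  have "((\<lambda>w. rGamma w * rGamma (1 - w)) has_field_derivative
     rGamma z * rGamma (1 - z) * (Digamma (1 - z) - Digamma z)) (at z)"
    using nz by (auto intro!: derivative_eq_intros simp: algebra_simps)
  moreover have "((\<lambda>w. sin (of_real pi * w) / of_real pi) has_field_derivative cos (of_real pi * z)) (at z)"
    by (auto intro!: derivative_eq_intros)
  ultimately have "rGamma z * rGamma (1 - z) * (Digamma (1 - z) - Digamma z) = cos (of_real pi * z)"
    unfolding refl by (rule DERIV_unique)
  moreover have "sin (of_real pi * z) \<noteq> 0"
    using assms refl[of z] nz by (metis divide_eq_0_iff mult_eq_0_iff rGamma_eq_zero_iff)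
  ultimately show ?thesis unfolding refl by (simp add: field_simps)
qed

text \<open>
The classical expansion of \<open>\<pi>\<^sup>2 / sin\<^sup>2 (\<pi> z)\<close>, obtained by differentiating the
reflection formula of the digamma function.
\<close>

lemma csq_partial_fractions:
  assumes z: "z \<notin> \<int>"
  shows "((\<lambda>m::int. 1 / (z + of_int m)\<^sup>2) has_sum (- 4 * of_real pi ^ 2 * csq z)) UNIV"
proof -
  have op: "open (- \<int> :: complex set)" using closed_Ints by (simp add: open_Compl)
  have nz: "z \<notin> \<int>\<^sub>\<le>\<^sub>0" "1 - z \<notin> \<int>\<^sub>\<le>\<^sub>0"
    using z nonpos_Ints_Int[of z] nonpos_Ints_Int[of "1 - z"] Ints_diff[of 1 "1 - z"] by auto
  have "((\<lambda>w. Digamma (1 - w) - Digamma w) has_field_derivative 4 * of_real pi ^ 2 * csq z) (at z)"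
  proof (rule has_field_derivative_transform_within_open[OF cot_qexp_has_field_derivative op])
    show "qexp z \<noteq> 1" using z by (simp add: qexp_eq_1_iff)
    show "z \<in> - \<int>" using z by simp
    show "\<And>w. w \<in> - \<int> \<Longrightarrow> of_real pi * \<i> * ((qexp w + 1) / (qexp w - 1)) = Digamma (1 - w) - Digamma w"
      by (metis Compl_iff qexp_quotient_eq_cot Digamma_reflection)
  qed
  moreover have "((\<lambda>w. Digamma (1 - w) - Digamma w) has_field_derivative - Polygamma 1 (1 - z) - Polygamma 1 z) (at z)"
    using nz by (auto intro!: derivative_eq_intros)
  ultimately have eq: "Polygamma 1 z + Polygamma 1 (1 - z) = - 4 * of_real pi ^ 2 * csq z"
    by (metis (no_types, lifting) DERIV_unique add.commute minus_add_distrib minus_equation_iff mult_minus_left uminus_add_conv_diff)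
  have "z \<noteq> 0" "1 - z \<noteq> 0" using z by auto
  note L = Polygamma_LIMSEQ[OF \<open>z \<noteq> 0\<close>, of 1] Polygamma_LIMSEQ[OF \<open>1 - z \<noteq> 0\<close>, of 1]
  show ?thesis unfolding eq[symmetric]
  proof (rule has_sum_intI)
    show "summable (\<lambda>n. norm (1 / (z + of_int (int n))\<^sup>2))"
      using summable_inverse_square_shift[of z] by simp
    have e: "1 / (z + of_int (- int (Suc n)))\<^sup>2 = 1 / (1 - z + of_nat n)\<^sup>2" for n
      by (simp add: power2_commute[of z] algebra_simps)
    show "summable (\<lambda>n. norm (1 / (z + of_int (- int (Suc n)))\<^sup>2))"
      unfolding e by (rule summable_inverse_square_shift)
    show "(\<lambda>n. 1 / (z + of_int (int n))\<^sup>2) sums Polygamma 1 z"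
      using L(1) by (simp add: inverse_eq_divide power2_eq_square)
    show "(\<lambda>n. 1 / (z + of_int (- int (Suc n)))\<^sup>2) sums Polygamma 1 (1 - z)"
      unfolding e using L(2) by (simp add: inverse_eq_divide power2_eq_square)
  qed
qed

text \<open>
The term at \<open>m = 0\<close> is \<open>1 / 0 = 0\<close>, so this is twice the Basel sum.
\<close>

lemma inverse_squares_has_sum_int:
  "((\<lambda>m::int. 1 / (of_int m)\<^sup>2) has_sum (of_real pi ^ 2 / 3 :: complex)) UNIV"
proof -
  have "(\<lambda>n. of_real (1 / (real n + 1)\<^sup>2)) sums (of_real (pi\<^sup>2 / 6) :: complex)"
    by (rule sums_of_real) (use inverse_squares_sums in \<open>simp add: add.commute\<close>)
  then have 1: "(\<lambda>n. 1 / (of_nat (Suc n))\<^sup>2) sums (of_real pi ^ 2 / 6 :: complex)"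
    by (simp add: add.commute)
  have "((\<lambda>m::int. 1 / (of_int m)\<^sup>2) has_sum (of_real pi ^ 2 / 6 + of_real pi ^ 2 / 6 :: complex)) UNIV"
  proof (rule has_sum_intI)
    show "summable (\<lambda>n. norm (1 / (of_int (int n))\<^sup>2 :: complex))"
      using summable_inverse_square_shift[of 0] by simp
    show "summable (\<lambda>n. norm (1 / (of_int (- int (Suc n)))\<^sup>2 :: complex))"
    proof -
      have "(of_int (- int (Suc n)) :: complex) = - (1 + of_nat n)" for n by simp
      then show ?thesis using summable_inverse_square_shift[of 1] by (simp only: power2_minus)
    qed
    show "(\<lambda>n. 1 / (of_int (int n))\<^sup>2) sums (of_real pi ^ 2 / 6 :: complex)"
      using 1 by (subst (asm) sums_Suc_iff) simp
    show "(\<lambda>n. 1 / (of_int (- int (Suc n)))\<^sup>2) sums (of_real pi ^ 2 / 6 :: complex)"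
      using 1 by (simp only: of_int_minus power2_minus of_int_of_nat_eq)
  qed
  then show ?thesis by simp
qed

lemma has_sum_minus:
  fixes f g :: "'a \<Rightarrow> complex"
  assumes "(f has_sum a) A" "(g has_sum b) A"
  shows "((\<lambda>x. f x - g x) has_sum (a - b)) A"
  using has_sum_add[OF assms(1), of "\<lambda>x. - g x" "- b"] assms(2) by (simp add: has_sum_uminus)

text \<open>
The terms of the \<open>\<wp>\<close> series at \<open>\<omega> = a + b \<tau>\<close> are of size \<open>\<bar>\<omega>\<bar> ^ (-3)\<close>, and
\<open>\<bar>\<omega>\<bar>\<^sup>2\<close> dominates a multiple of \<open>(1 + \<bar>a\<bar>) (1 + \<bar>b\<bar>)\<close>. So they are dominated by a product of two
one-dimensional weights of exponent \<open>3 / 2 > 1\<close>, which is summable over the grid.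
\<close>

lemma summable_on_int_weight: "(\<lambda>a::int. inverse (sqrt (1 + \<bar>of_int a\<bar>)) ^ 3) summable_on UNIV"
proof -
  define f where "f = (\<lambda>a::int. inverse (sqrt (1 + \<bar>of_int a\<bar>)) ^ 3)"
  have e: "inverse (sqrt (real (Suc n))) ^ 3 = real (Suc n) powr (- 3 / 2)" for n
    by (simp add: powr_half_sqrt[symmetric] powr_powr powr_minus[symmetric] flip: powr_realpow)
  have s: "summable (\<lambda>n. inverse (sqrt (real (Suc n))) ^ 3)"
    unfolding e by (subst summable_Suc_iff) (simp add: summable_real_powr_iff)
  have f1: "f (int n) = inverse (sqrt (real (Suc n))) ^ 3" for n
    by (simp add: f_def)
  have f2: "f (- int (Suc n)) = inverse (sqrt (real (Suc (Suc n)))) ^ 3" for n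
    by (simp add: f_def add.commute)
  have s2: "summable (\<lambda>n. inverse (sqrt (real (Suc (Suc n)))) ^ 3)"
    using s summable_Suc_iff[of "\<lambda>n. inverse (sqrt (real (Suc n))) ^ 3"] by simp
  have "(f has_sum ((\<Sum>n. f (int n)) + (\<Sum>n. f (- int (Suc n))))) UNIV"
    by (rule has_sum_intI) (unfold f1 f2, use s s2 in \<open>auto simp del: of_nat_Suc\<close>)
  then show ?thesis unfolding f_def by (rule has_sum_imp_summable)
qed

lemma lattice_point_norm_bound:
  assumes "Im \<tau> > 0"
  obtains M where "M > 0"
    "\<And>a b. a \<noteq> 0 \<or> b \<noteq> 0 \<Longrightarrow> (1 + \<bar>of_int a\<bar>) \<le> M * norm (of_int a + of_int b * \<tau>) \<and>
       (1 + \<bar>of_int b\<bar>) \<le> M * norm (of_int a + of_int b * \<tau>)"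
proof -
  define M where "M = 1 + (1 + norm \<tau>) / Im \<tau>"
  have M: "M > 0" using assms by (auto simp: M_def intro!: add_pos_nonneg)
  have bd: "(1 + \<bar>of_int a\<bar>) \<le> 2 * M * norm (of_int a + of_int b * \<tau>) \<and>
       (1 + \<bar>of_int b\<bar>) \<le> 2 * M * norm (of_int a + of_int b * \<tau>)" if ab: "a \<noteq> 0 \<or> b \<noteq> 0" for a b :: int
  proof -
    define w where "w = of_int a + of_int b * \<tau>"
    have "\<bar>of_int b * Im \<tau>\<bar> \<le> norm w" using abs_Im_le_cmod[of w] by (simp add: w_def)
    then have b: "\<bar>of_int b\<bar> \<le> norm w / Im \<tau>" using assms by (simp add: abs_mult field_simps)
    have "norm (of_int a :: complex) \<le> norm w + norm (of_int b * \<tau>)"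
      using norm_triangle_ineq4[of w "of_int b * \<tau>"] by (simp add: w_def)
    also have "norm (of_int b * \<tau>) \<le> norm w / Im \<tau> * norm \<tau>"
      using mult_right_mono[OF b, of "norm \<tau>"] by (simp add: norm_mult)
    finally have a: "\<bar>of_int a\<bar> \<le> norm w + norm w / Im \<tau> * norm \<tau>" by simp
    have Mw: "M * norm w = norm w + norm w / Im \<tau> + norm w / Im \<tau> * norm \<tau>"
      by (simp add: M_def algebra_simps add_divide_distrib)
    have nn: "norm w / Im \<tau> \<ge> 0" "norm w / Im \<tau> * norm \<tau> \<ge> 0" using assms by auto
    have a': "\<bar>of_int a\<bar> \<le> M * norm w" and b': "\<bar>of_int b\<bar> \<le> M * norm w"
      unfolding Mw using a b nn norm_ge_zero[of w] by auto
    have "1 \<le> \<bar>a\<bar> \<or> 1 \<le> \<bar>b\<bar>" using ab by linarith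
    then have "1 \<le> \<bar>real_of_int a\<bar> \<or> 1 \<le> \<bar>real_of_int b\<bar>" by linarith
    then have "1 \<le> M * norm w" using a' b' by linarith
    with a' b' show ?thesis unfolding w_def[symmetric] by linarith
  qed
  show ?thesis by (rule that[of "2 * M"]) (use M bd in auto)
qed

lemma inj_lattice_point:
  assumes "Im \<tau> > 0"
  shows "inj (\<lambda>(b::int, a::int). of_int a + of_int b * \<tau>)"
proof (rule injI)
  fix p p' :: "int \<times> int"
  assume eq: "(case p of (b, a) \<Rightarrow> of_int a + of_int b * \<tau>) = (case p' of (b, a) \<Rightarrow> of_int a + of_int b * \<tau>)"
  obtain b a b' a' where p: "p = (b, a)" "p' = (b', a')" by (metis surj_pair)
  from eq have "Im (of_int a + of_int b * \<tau>) = Im (of_int a' + of_int b' * \<tau>)"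
    "Re (of_int a + of_int b * \<tau>) = Re (of_int a' + of_int b' * \<tau>)" by (simp_all add: p)
  then show "p = p'" using assms by (simp add: p)
qed

text \<open>
The summand of \<open>\<wp>\<close> at \<open>\<omega> = 0\<close>, with \<open>1 / 0 = 0\<close>, is the separate term \<open>1 / z\<^sup>2\<close>;
hence the sum is taken over the whole grid.
\<close>

lemma weierstrass_terms_summable:
  assumes \<tau>: "Im \<tau> > 0"
  shows "(\<lambda>(b, a). 1 / (z - (of_int a + of_int b * \<tau>))\<^sup>2 - 1 / (of_int a + of_int b * \<tau>)\<^sup>2) summable_on (UNIV \<times> UNIV)"
    (is "?t summable_on _")
proof -
  define \<omega> where "\<omega> = (\<lambda>(b::int, a::int). of_int a + of_int b * \<tau>)"
  define s where "s = (\<lambda>a::int. inverse (sqrt (1 + \<bar>of_int a\<bar>)) ^ 3)"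
  obtain M where M: "M > 0"
    "\<And>a b. a \<noteq> 0 \<or> b \<noteq> 0 \<Longrightarrow> (1 + \<bar>of_int a\<bar>) \<le> M * norm (of_int a + of_int b * \<tau>) \<and>
       (1 + \<bar>of_int b\<bar>) \<le> M * norm (of_int a + of_int b * \<tau>)"
    by (rule lattice_point_norm_bound[OF \<tau>]) blast
  have inj: "inj \<omega>" unfolding \<omega>_def by (rule inj_lattice_point[OF \<tau>])
  \<comment> \<open>The lattice points too close to \<open>z\<close> for the estimate; there are finitely many.\<close>
  define F where "F = \<omega> -` (lattice \<tau> \<inter> cball 0 (2 * norm z))"
  have "finite F" unfolding F_def by (intro finite_vimageI finite_lattice_cball \<tau> inj)
  have "(\<lambda>p. norm (case p of (b, a) \<Rightarrow> s b * s a)) summable_on (UNIV \<times> UNIV)"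
    by (rule abs_summable_on_prod) (use summable_on_int_weight in \<open>auto simp: s_def\<close>)
  then have "(\<lambda>p. norm ((10 * norm z * M ^ 3) * (case p of (b, a) \<Rightarrow> s b * s a))) summable_on (UNIV \<times> UNIV)"
    unfolding norm_mult by (intro summable_on_cmult_right)
  then have "(\<lambda>p. norm ((10 * norm z * M ^ 3) * (case p of (b, a) \<Rightarrow> s b * s a))) summable_on (UNIV \<times> UNIV - F)"
    by (rule summable_on_subset) auto
  then have "(\<lambda>p. norm (?t p)) summable_on (UNIV \<times> UNIV - F)"
  proof (rule Infinite_Sum.abs_summable_on_comparison_test)
    fix p assume p: "p \<in> UNIV \<times> UNIV - F"
    obtain b a where ba: "p = (b, a)" by (metis surj_pair)
    define w where "w = of_int a + of_int b * \<tau>"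
    have w: "norm w > 2 * norm z"
      using p of_int_plus_in_lattice[of a b \<tau>] by (auto simp: F_def \<omega>_def ba w_def)
    then have "w \<noteq> 0" by auto
    have zw: "norm (z - w) \<ge> norm w / 2" using norm_triangle_ineq2[of w z] w by (simp add: norm_minus_commute)
    then have zw': "z - w \<noteq> 0" using \<open>w \<noteq> 0\<close> by auto
    have "?t p = (2 * z * w - z ^ 2) / (w ^ 2 * (z - w) ^ 2)"
      using \<open>w \<noteq> 0\<close> zw' by (simp add: ba w_def[symmetric] divide_simps) (simp add: power2_eq_square algebra_simps)
    then have "norm (?t p) = norm (2 * z * w - z ^ 2) / (norm w ^ 2 * norm (z - w) ^ 2)"
      by (simp add: norm_divide norm_mult norm_power)
    also have "\<dots> \<le> (5 / 2 * norm z * norm w) / (norm w ^ 2 * (norm w / 2) ^ 2)"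
    proof (rule frac_le)
      have "norm (2 * z * w - z ^ 2) \<le> 2 * norm z * norm w + norm z * norm z"
        using norm_triangle_ineq4[of "2 * z * w" "z ^ 2"] by (simp add: norm_mult power2_eq_square)
      also have "norm z * norm z \<le> norm z * (norm w / 2)" using w by (intro mult_left_mono) auto
      finally show "norm (2 * z * w - z ^ 2) \<le> 5 / 2 * norm z * norm w" by (simp add: algebra_simps)
      show "norm w ^ 2 * (norm w / 2) ^ 2 \<le> norm w ^ 2 * norm (z - w) ^ 2"
        using zw by (intro mult_left_mono power_mono) auto
    qed (use \<open>w \<noteq> 0\<close> in auto)
    also have "\<dots> = 10 * norm z * inverse (norm w) ^ 3"
      using \<open>w \<noteq> 0\<close> by (simp add: field_simps power2_eq_square power3_eq_cube)
    also have "\<dots> \<le> 10 * norm z * (M ^ 3 * (s b * s a))"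
    proof (intro mult_left_mono)
      have "a \<noteq> 0 \<or> b \<noteq> 0" using \<open>w \<noteq> 0\<close> by (auto simp: w_def)
      from M(2)[OF this] have "(1 + \<bar>of_int b\<bar>) * (1 + \<bar>of_int a\<bar>) \<le> (M * norm w) * (M * norm w)"
        unfolding w_def by (intro mult_mono) auto
      then have "sqrt ((1 + \<bar>of_int b\<bar>) * (1 + \<bar>of_int a\<bar>)) \<le> M * norm w"
        using M(1) by (intro real_le_lsqrt) (auto simp: power2_eq_square)
      then have "inverse (M * norm w) \<le> inverse (sqrt ((1 + \<bar>of_int b\<bar>) * (1 + \<bar>of_int a\<bar>)))"
        by (intro le_imp_inverse_le) auto
      then have "M * inverse (M * norm w) \<le> M * inverse (sqrt ((1 + \<bar>of_int b\<bar>) * (1 + \<bar>of_int a\<bar>)))"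
        using M(1) by (intro mult_left_mono) auto
      moreover have "M * inverse (M * norm w) = inverse (norm w)" using M(1) by simp
      ultimately have "inverse (norm w) \<le> M * inverse (sqrt ((1 + \<bar>of_int b\<bar>) * (1 + \<bar>of_int a\<bar>)))"
        by (simp only:)
      then have "inverse (norm w) ^ 3 \<le> (M * inverse (sqrt ((1 + \<bar>of_int b\<bar>) * (1 + \<bar>of_int a\<bar>)))) ^ 3"
        by (intro power_mono) auto
      then show "inverse (norm w) ^ 3 \<le> M ^ 3 * (s b * s a)"
        by (simp add: s_def real_sqrt_mult power_mult_distrib)
    qed auto
    also have "\<dots> \<le> norm ((10 * norm z * M ^ 3) * (case p of (b, a) \<Rightarrow> s b * s a))"
      using M(1) by (simp add: ba s_def abs_mult mult_ac)
    finally show "norm (?t p) \<le> norm ((10 * norm z * M ^ 3) * (case p of (b, a) \<Rightarrow> s b * s a))" .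
  qed
  then have "?t summable_on (UNIV \<times> UNIV - F)" by (rule abs_summable_summable)
  then have "?t summable_on ((UNIV \<times> UNIV - F) \<union> F)"
    by (rule summable_on_Un_disjoint) (use \<open>finite F\<close> in auto)
  then show ?thesis by simp
qed

text \<open>
The constant \<open>1 / 24\<close> cancels the constant term \<open>- B\<^sub>2 / 4\<close> of \<open>G\<^sub>2\<close>.
\<close>

lemma eisenstein_G_2_csq:
  assumes \<tau>: "Im \<tau> > 0"
  shows "(\<lambda>n. csq (of_nat (Suc n) * \<tau>)) sums (eisenstein_G 2 \<tau> + 1 / 24)"
proof -
  have q: "norm (qexp \<tau>) < 1" by (rule norm_qexp_less_1) fact
  have "summable (\<lambda>d. norm (of_nat (Suc d) :: complex) * norm (qexp \<tau>) ^ Suc d)"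
    using summable_power_times_geometric[of "norm (qexp \<tau>)" 1] q
    by (simp add: norm_power del: of_nat_Suc power_Suc)
  from lambert_rearrangement(2)[OF q, of of_nat, OF this]
  have "(\<lambda>n. \<Sum>d. of_nat (Suc d) * (qexp \<tau> ^ Suc n) ^ Suc d) sums
     (\<Sum>d. of_nat (Suc d) * (qexp \<tau> ^ Suc d / (1 - qexp \<tau> ^ Suc d)))" .
  moreover have "(\<Sum>d. of_nat (Suc d) * (qexp \<tau> ^ Suc n) ^ Suc d) = csq (of_nat (Suc n) * \<tau>)" for n
  proof -
    define x where "x = qexp \<tau> ^ Suc n"
    have "norm x < 1"
      using power_strict_mono[of "norm (qexp \<tau>)" 1 "Suc n"] q unfolding x_def norm_power by simp
    from sums_mult[OF geometric_deriv_sums[OF this], of x]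
    have "(\<lambda>d. of_nat (Suc d) * x ^ Suc d) sums (x / (1 - x)\<^sup>2)" by (simp add: mult_ac)
    then show ?thesis by (simp add: sums_iff csq_def x_def qexp_power del: of_nat_Suc power_Suc)
  qed
  ultimately have "(\<lambda>n. csq (of_nat (Suc n) * \<tau>)) sums (\<Sum>d. of_nat (Suc d) * (qexp \<tau> ^ Suc d / (1 - qexp \<tau> ^ Suc d)))"
    by (simp only:)
  moreover have "eisenstein_G 2 \<tau> + 1 / 24 = (\<Sum>d. of_nat (Suc d) * (qexp \<tau> ^ Suc d / (1 - qexp \<tau> ^ Suc d)))"
  proof -
    have "(bernoulli_fps * (fps_exp 1 - 1)) $ 3 = 0" by (simp add: bernoulli_fps_mult)
    then have "1 + (3 * bernoulli_fps $ 1 + 6 * bernoulli_fps $ 2) = 0"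
      using bernoulli_fps_nth_0
      by (simp add: fps_mult_nth numeral_3_eq_3 numeral_2_eq_2 field_simps)
    moreover have "2 * bernoulli_fps $ 1 = - 1" by (simp only: bernoulli_fps_nth_odd(1)) simp
    ultimately have "bernoulli_fps $ 2 * 12 = 1" by algebra
    then have "bernoulli_fps $ 2 = 1 / 12" by (rule eq_divide_imp[rotated]) simp
    then have "bernoulli_number 2 = 1 / 6" by (simp only: bernoulli_number_conv) simp
    then show ?thesis using eisenstein_G_series[OF \<tau>, of 2] by simp
  qed
  ultimately show ?thesis by simp
qed

text \<open>
The absolutely convergent lattice sum may be evaluated row by row. Each row is the partial
fraction expansion of an inverse squared sine, and the rows add up to \<open>-(\<theta>'/\<theta>)'\<close> plus the
series of \<open>G\<^sub>2\<close> that comes from the correction terms \<open>1 / \<omega>\<^sup>2\<close>.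
\<close>

theorem weierstrass_p_eq_deriv_theta_logderiv:
  assumes \<tau>: "Im \<tau> > 0" and z: "z \<notin> lattice \<tau>"
  shows "weierstrass_p \<tau> z = - deriv (theta_logderiv \<tau>) z + 8 * of_real pi ^ 2 * eisenstein_G 2 \<tau>"
proof -
  define t where "t = (\<lambda>(b::int, a::int). 1 / (z - (of_int a + of_int b * \<tau>))\<^sup>2 - 1 / (of_int a + of_int b * \<tau>)\<^sup>2)"
  define \<omega> where "\<omega> = (\<lambda>(b::int, a::int). of_int a + of_int b * \<tau>)"
  have inj: "inj \<omega>" unfolding \<omega>_def by (rule inj_lattice_point[OF \<tau>])
  have \<omega>0: "\<omega> (0, 0) = 0" by (simp add: \<omega>_def)
  have t: "(t has_sum infsum t UNIV) UNIV"
    using weierstrass_terms_summable[OF \<tau>, of z] unfolding t_def by simp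
  have "bij_betw \<omega> (- {(0, 0)}) (lattice \<tau> - {0})"
  proof -
    have "range \<omega> = lattice \<tau>" by (auto simp: lattice_def \<omega>_def)
    then have "\<omega> ` (- {(0, 0)}) = lattice \<tau> - {0}"
      using inj \<omega>0 by (simp add: Compl_eq_Diff_UNIV image_set_diff)
    then show ?thesis using inj by (auto simp: bij_betw_def intro: inj_on_subset)
  qed
  then have "infsum (\<lambda>\<omega>. 1 / (z - \<omega>) ^ 2 - 1 / \<omega> ^ 2) (lattice \<tau> - {0}) = infsum (\<lambda>p. 1 / (z - \<omega> p) ^ 2 - 1 / \<omega> p ^ 2) (- {(0, 0)})"
    by (rule infsum_reindex_bij_betw[symmetric])
  also have "\<dots> = infsum t (- {(0, 0)})" by (simp add: t_def \<omega>_def case_prod_unfold)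
  also have "\<dots> = infsum t UNIV - t (0, 0)"
  proof -
    have "t summable_on (- {(0, 0)})"
      using summable_on_subset_banach[OF has_sum_imp_summable[OF t]] by blast
    then have "(t has_sum (t (0, 0) + infsum t (- {(0, 0)}))) (insert (0, 0) (- {(0, 0)}))"
      by (intro has_sum_insert) auto
    moreover have "insert (0, 0) (- {(0, 0)}) = (UNIV :: (int \<times> int) set)" by auto
    ultimately have "(t has_sum (t (0, 0) + infsum t (- {(0, 0)}))) UNIV" by simp
    from has_sum_unique[OF this t] show ?thesis by (simp add: algebra_simps)
  qed
  finally have "(t has_sum weierstrass_p \<tau> z) UNIV"
    using t by (simp add: weierstrass_p_def t_def)
  then have t': "(t has_sum weierstrass_p \<tau> z) (UNIV \<times> UNIV)" by simp
  \<comment> \<open>The sum over the row of index \<open>b\<close>.\<close>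
  define h where "h = (\<lambda>b::int. if b = 0 then - 4 * of_real pi ^ 2 * csq (- z) - of_real pi ^ 2 / 3
     else - 4 * of_real pi ^ 2 * (csq (- z + of_int b * \<tau>) - csq (of_int b * \<tau>)))"
  have nz: "- z + of_int b * \<tau> \<notin> \<int>" for b
  proof
    assume "- z + of_int b * \<tau> \<in> \<int>"
    then obtain k where "- z + of_int b * \<tau> = of_int k" by (auto elim: Ints_cases)
    then have "z = of_int b * \<tau> - of_int k" by (simp add: algebra_simps)
    then have "z \<in> lattice \<tau>" by (simp add: lattice_diff)
    with z show False by simp
  qed
  have "((\<lambda>a. t (b, a)) has_sum h b) UNIV" for b
  proof -
    have e: "t (b, a) = 1 / ((- z + of_int b * \<tau>) + of_int a)\<^sup>2 - 1 / (of_int b * \<tau> + of_int a)\<^sup>2" for a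
    proof -
      have "(z - (of_int a + of_int b * \<tau>))\<^sup>2 = ((- z + of_int b * \<tau>) + of_int a)\<^sup>2"
        by (simp add: power2_eq_square algebra_simps)
      then show ?thesis by (simp add: t_def add.commute)
    qed
    show ?thesis
    proof (cases "b = 0")
      case True
      show ?thesis unfolding e
        using has_sum_minus[OF csq_partial_fractions[OF nz[of b]] inverse_squares_has_sum_int] by (simp add: True h_def)
    next
      case False
      have "of_int b * \<tau> \<notin> \<int>" using \<tau> False by (auto elim!: Ints_cases simp: complex_eq_iff)
      from has_sum_minus[OF csq_partial_fractions[OF nz[of b]] csq_partial_fractions[OF this]]
      show ?thesis unfolding e using False by (simp add: h_def algebra_simps)
    qed
  qed
  then have "(h has_sum weierstrass_p \<tau> z) UNIV"
    by (intro has_sum_SigmaD[OF t']) auto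
  from has_sum_int_imp_sums[OF this]
  have "(\<lambda>n. h (int (Suc n)) + h (- int (Suc n))) sums (weierstrass_p \<tau> z - h 0)" .
  moreover have "h (int (Suc n)) + h (- int (Suc n)) = - 4 * of_real pi ^ 2 *
     (csq (- z + of_nat (Suc n) * \<tau>) + csq (z + of_nat (Suc n) * \<tau>) - 2 * csq (of_nat (Suc n) * \<tau>))" for n
  proof -
    have "csq (- z - of_nat (Suc n) * \<tau>) = csq (z + of_nat (Suc n) * \<tau>)"
      using csq_minus[of "z + of_nat (Suc n) * \<tau>"] by (simp only: minus_add_distrib diff_conv_add_uminus)
    then show ?thesis using csq_minus[of "of_nat (Suc n) * \<tau>"]
      by (simp add: h_def algebra_simps del: of_nat_Suc)
  qed
  moreover have "(\<lambda>n. - 4 * of_real pi ^ 2 *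
     (csq (- z + of_nat (Suc n) * \<tau>) + csq (z + of_nat (Suc n) * \<tau>) - 2 * csq (of_nat (Suc n) * \<tau>))) sums
     (- 4 * of_real pi ^ 2 * ((\<Sum>n. csq (- z + of_nat (Suc n) * \<tau>)) + (\<Sum>n. csq (z + of_nat (Suc n) * \<tau>)) - 2 * (eisenstein_G 2 \<tau> + 1 / 24)))"
    using theta_logderiv_has_field_derivative(1)[OF \<tau> z] theta_logderiv_has_field_derivative(1)[OF \<tau>, of "- z"] z
    by (intro sums_mult sums_add sums_diff summable_sums eisenstein_G_2_csq \<tau>) auto
  ultimately have "weierstrass_p \<tau> z - h 0 =
     - 4 * of_real pi ^ 2 * ((\<Sum>n. csq (- z + of_nat (Suc n) * \<tau>)) + (\<Sum>n. csq (z + of_nat (Suc n) * \<tau>)) - 2 * (eisenstein_G 2 \<tau> + 1 / 24))"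
    by (simp only: sums_unique2)
  moreover have "deriv (theta_logderiv \<tau>) z = 4 * of_real pi ^ 2 *
           (csq z + (\<Sum>n. csq (- z + of_nat (Suc n) * \<tau>)) + (\<Sum>n. csq (z + of_nat (Suc n) * \<tau>)))"
    by (rule DERIV_imp_deriv) (rule theta_logderiv_has_field_derivative(2)[OF \<tau> z])
  ultimately show ?thesis by (simp add: h_def csq_minus algebra_simps del: of_nat_Suc)
qed

section \<open>Laurent series indexed by weight\<close>

text \<open>
The series of \<open>c r * u ^ (r - k)\<close>. A function of weight \<open>k\<close> will have a coefficient \<open>c r\<close> of
weight \<open>r\<close>: the local parameter has weight \<open>-1\<close>, and indexing the coefficients by their
weight makes products and derivatives respect it.
\<close>

definition laurent_series :: "nat \<Rightarrow> (nat \<Rightarrow> complex) \<Rightarrow> complex fls" where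
  "laurent_series k c = fls_shift (int k) (fps_to_fls (Abs_fps c))"

lemma fls_nth_laurent_series:
  "fls_nth (laurent_series k c) n = (if n + int k < 0 then 0 else c (nat (n + int k)))"
  by (simp add: laurent_series_def)

lemma laurent_series_add: "laurent_series k c + laurent_series k d = laurent_series k (\<lambda>r. c r + d r)"
  by (rule fls_eqI) (simp add: fls_nth_laurent_series)

lemma laurent_series_mult:
  "laurent_series k c * laurent_series l d = laurent_series (k + l) (\<lambda>r. \<Sum>i\<le>r. c i * d (r - i))"
proof -
  have "laurent_series k c * laurent_series l d = fls_shift (int (k + l)) (fps_to_fls (Abs_fps c * Abs_fps d))"
    by (simp add: laurent_series_def fls_shifted_times_simps fls_times_fps_to_fls add.commute)
  also have "Abs_fps c * Abs_fps d = Abs_fps (\<lambda>r. \<Sum>i\<le>r. c i * d (r - i))"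
    by (simp add: fps_eq_iff fps_mult_nth atLeast0AtMost)
  finally show ?thesis by (simp add: laurent_series_def)
qed

lemma laurent_series_deriv:
  "fls_deriv (laurent_series k c) = laurent_series (Suc k) (\<lambda>r. of_int (int r - int k) * c r)"
proof (rule fls_eqI)
  fix n
  show "fls_nth (fls_deriv (laurent_series k c)) n = fls_nth (laurent_series (Suc k) (\<lambda>r. of_int (int r - int k) * c r)) n"
    by (cases "n + int k + 1 \<ge> 0") (simp_all add: fls_nth_laurent_series add_ac)
qed

lemma laurent_series_raise:
  "laurent_series k c = laurent_series (k + l) (\<lambda>r. if r < l then 0 else c (r - l))"
proof (rule fls_eqI)
  fix n
  show "fls_nth (laurent_series k c) n = fls_nth (laurent_series (k + l) (\<lambda>r. if r < l then 0 else c (r - l))) n"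
    by (simp add: fls_nth_laurent_series nat_diff_distrib nat_less_iff)
       (auto simp: nat_diff_distrib' algebra_simps intro!: arg_cong[where f = c])
qed

section \<open>Higher derivatives and the differential equation of the Weierstrass function\<close>

abbreviation theta_deriv :: "nat \<Rightarrow> complex \<Rightarrow> complex \<Rightarrow> complex" where
  "theta_deriv m \<tau> \<equiv> (deriv ^^ m) (theta_logderiv \<tau>)"

lemma open_Compl_lattice: "Im \<tau> > 0 \<Longrightarrow> open (- lattice \<tau>)"
  using closed_lattice by (simp add: open_Compl)

lemma theta_deriv_holomorphic:
  assumes "Im \<tau> > 0"
  shows "theta_deriv m \<tau> holomorphic_on - lattice \<tau>"
  by (intro holomorphic_higher_deriv theta_logderiv_holomorphic open_Compl_lattice assms)

text \<open>
Periodicity and quasi-periodicity at once: the additive constant \<open>d\<close> disappears under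
differentiation.
\<close>

lemma theta_deriv_translate:
  assumes "Im \<tau> > 0" "z \<notin> lattice \<tau>" "c \<in> lattice \<tau>"
    and eq: "\<And>w. w \<notin> lattice \<tau> \<Longrightarrow> theta_logderiv \<tau> (w + c) = theta_logderiv \<tau> w - d"
  shows "theta_deriv m \<tau> (z + c) = theta_deriv m \<tau> z - (if m = 0 then d else 0)"
proof -
  have "(deriv ^^ m) (\<lambda>w. theta_logderiv \<tau> (1 * w + c)) z = 1 ^ m * (deriv ^^ m) (theta_logderiv \<tau>) (1 * z + c)"
    by (rule higher_deriv_compose_linear'[where S = "- lattice \<tau>" and T = "- lattice \<tau>"])
       (use assms in \<open>auto simp: lattice_add_iff intro!: theta_logderiv_holomorphic open_Compl_lattice\<close>)
  moreover have "(deriv ^^ m) (\<lambda>w. theta_logderiv \<tau> (1 * w + c)) z = (deriv ^^ m) (\<lambda>w. theta_logderiv \<tau> w - d) z"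
  proof (rule higher_deriv_transform_within_open[where S = "- lattice \<tau>"])
    have hol: "(\<lambda>w. theta_logderiv \<tau> w - d) holomorphic_on - lattice \<tau>"
      by (intro holomorphic_intros theta_logderiv_holomorphic assms)
    then show "(\<lambda>w. theta_logderiv \<tau> (1 * w + c)) holomorphic_on - lattice \<tau>"
      by (rule holomorphic_transform) (simp add: eq)
    show "(\<lambda>w. theta_logderiv \<tau> w - d) holomorphic_on - lattice \<tau>" by (rule hol)
  qed (use assms in \<open>auto simp: open_Compl_lattice\<close>)
  moreover have "(deriv ^^ m) (\<lambda>w. theta_logderiv \<tau> w - d) z = theta_deriv m \<tau> z - (deriv ^^ m) (\<lambda>w. d) z"
    by (rule higher_deriv_diff[OF theta_logderiv_holomorphic])
       (use assms in \<open>auto simp: open_Compl_lattice\<close>)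
  ultimately show ?thesis by simp
qed

lemma theta_deriv_plus_1:
  assumes "Im \<tau> > 0" "z \<notin> lattice \<tau>"
  shows "theta_deriv m \<tau> (z + 1) = theta_deriv m \<tau> z"
  using theta_deriv_translate[OF assms, of 1 0 m] by (simp add: theta_logderiv_plus_1)

lemma theta_deriv_plus_tau:
  assumes "Im \<tau> > 0" "z \<notin> lattice \<tau>"
  shows "theta_deriv m \<tau> (z + \<tau>) = theta_deriv m \<tau> z - (if m = 0 then 2 * of_real pi * \<i> else 0)"
  using theta_deriv_translate[OF assms, of \<tau> "2 * of_real pi * \<i>" m] theta_logderiv_plus_tau[OF assms(1)] by simp

lemma theta_deriv_minus:
  assumes "Im \<tau> > 0" "z \<notin> lattice \<tau>"
  shows "theta_deriv m \<tau> (- z) = (- 1) ^ Suc m * theta_deriv m \<tau> z"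
proof -
  have "(deriv ^^ m) (\<lambda>w. theta_logderiv \<tau> ((- 1) * w)) z = (- 1) ^ m * (deriv ^^ m) (theta_logderiv \<tau>) ((- 1) * z)"
    by (rule higher_deriv_compose_linear[where S = "- lattice \<tau>" and T = "- lattice \<tau>"])
       (use assms in \<open>auto intro!: theta_logderiv_holomorphic open_Compl_lattice\<close>)
  moreover have "(deriv ^^ m) (\<lambda>w. theta_logderiv \<tau> ((- 1) * w)) z = - theta_deriv m \<tau> z"
    using higher_deriv_uminus[OF theta_logderiv_holomorphic open_Compl_lattice, of \<tau> z m] assms
    by (simp add: theta_logderiv_minus)
  ultimately have "(- 1) ^ m * theta_deriv m \<tau> (- z) = - theta_deriv m \<tau> z" by simp
  then have "(- 1) ^ m * ((- 1) ^ m * theta_deriv m \<tau> (- z)) = (- 1) ^ m * (- theta_deriv m \<tau> z)" by (rule arg_cong)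
  then show ?thesis by (simp flip: mult.assoc power_mult_distrib)
qed

lemma theta_deriv_laurent:
  assumes \<tau>: "Im \<tau> > 0"
  shows "theta_deriv m \<tau> has_laurent_expansion
    laurent_series (Suc m) (\<lambda>r. (\<Prod>i\<in>{1..m}. of_int (int r - int i)) * theta_coeff \<tau> r)"
proof (induction m)
  case 0
  show ?case using theta_logderiv_laurent[OF \<tau>] by (simp add: laurent_series_def)
next
  case (Suc m)
  from has_laurent_expansion_deriv[OF Suc] show ?case
    by (simp add: laurent_series_deriv mult_ac)
qed

text \<open>
The coefficient of \<open>z ^ (r - 2)\<close> in the Laurent expansion of \<open>\<wp>\<close> at 0, again indexed by weight.
The case \<open>r = 2\<close> is the vanishing constant term, where the \<open>G\<^sub>2\<close> of the theta function cancels.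
\<close>

definition wp_coeff :: "complex \<Rightarrow> nat \<Rightarrow> complex" where
  "wp_coeff \<tau> r = (if r = 2 then 0 else - of_int (int r - 1) * theta_coeff \<tau> r)"

lemma wp_coeff_small:
  "wp_coeff \<tau> 0 = 1" "wp_coeff \<tau> (Suc 0) = 0" "wp_coeff \<tau> 2 = 0" "odd r \<Longrightarrow> wp_coeff \<tau> r = 0"
  by (auto simp: wp_coeff_def theta_coeff_def odd_pos)

lemma normalized_wp_laurent:
  assumes \<tau>: "Im \<tau> > 0"
  shows "(\<lambda>z. theta_coeff \<tau> 2 - theta_deriv 1 \<tau> z) has_laurent_expansion laurent_series 2 (wp_coeff \<tau>)"
proof -
  have "(\<lambda>z. theta_coeff \<tau> 2 - theta_deriv 1 \<tau> z) has_laurent_expansion fls_const (theta_coeff \<tau> 2) -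
      laurent_series (Suc 1) (\<lambda>r. (\<Prod>i\<in>{1..1}. of_int (int r - int i)) * theta_coeff \<tau> r)"
    by (intro has_laurent_expansion_diff has_laurent_expansion_const theta_deriv_laurent \<tau>)
  also have "fls_const (theta_coeff \<tau> 2) -
      laurent_series (Suc 1) (\<lambda>r. (\<Prod>i\<in>{1..1}. of_int (int r - int i)) * theta_coeff \<tau> r) = laurent_series 2 (wp_coeff \<tau>)"
  proof (rule fls_eqI)
    fix n :: int
    have "nat (n + 2) = 2 \<longleftrightarrow> n = 0" by auto
    then show "fls_nth (fls_const (theta_coeff \<tau> 2) -
      laurent_series (Suc 1) (\<lambda>r. (\<Prod>i\<in>{1..1}. of_int (int r - int i)) * theta_coeff \<tau> r)) n =
      fls_nth (laurent_series 2 (wp_coeff \<tau>)) n"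
      by (auto simp: fls_nth_laurent_series wp_coeff_def algebra_simps)
  qed
  finally show ?thesis .
qed

text \<open>
Liouville's theorem: filling in the value \<open>L\<close> at the lattice points gives an entire function
that takes all its values on a compact disc.
\<close>

lemma elliptic_no_poles_constant:
  assumes \<tau>: "Im \<tau> > 0"
    and hol: "h holomorphic_on - lattice \<tau>"
    and per: "\<And>z. z \<notin> lattice \<tau> \<Longrightarrow> h (z + 1) = h z" "\<And>z. z \<notin> lattice \<tau> \<Longrightarrow> h (z + \<tau>) = h z"
    and lim: "h \<midarrow>0\<rightarrow> L"
  shows "z \<notin> lattice \<tau> \<Longrightarrow> h z = L"
proof -
  define H where "H = (\<lambda>z. if z \<in> lattice \<tau> then L else h z)"
  have H1: "H (z + 1) = H z" "H (z + \<tau>) = H z" for z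
    by (simp_all add: H_def per lattice_add_iff)
  have Hn: "H (z + of_nat n * c) = H z" if "\<And>z. H (z + c) = H z" for z c n
  proof (induction n)
    case (Suc n)
    have "H (z + of_nat (Suc n) * c) = H ((z + of_nat n * c) + c)" by (simp add: algebra_simps)
    then show ?case using that Suc by simp
  qed auto
  have Hi: "H (z + of_int k * c) = H z" if c: "\<And>z. H (z + c) = H z" for z c k
  proof (cases "k \<ge> 0")
    case True
    then show ?thesis using Hn[OF c, of z "nat k"] by simp
  next
    case False
    then show ?thesis using Hn[OF c, of "z + of_int k * c" "nat (- k)"] by simp
  qed
  have HL: "H (z + w) = H z" if w: "w \<in> lattice \<tau>" for z w
  proof -
    obtain a b where "w = of_int a + of_int b * \<tau>" using w by (auto simp: lattice_def)
    then show ?thesis using Hi[OF H1(1), of "z + of_int b * \<tau>" a] Hi[OF H1(2), of z b] by (simp add: add_ac)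
  qed
  have Hhol: "H holomorphic_on - lattice \<tau>"
    by (rule holomorphic_transform[OF hol]) (simp add: H_def)
  have H0: "H \<midarrow>0\<rightarrow> L"
  proof -
    have "\<forall>\<^sub>F z in at 0. z \<notin> lattice \<tau>" by (rule eventually_at_not_in_lattice[OF \<tau>])
    then have "\<forall>\<^sub>F z in at 0. h z = H z" by eventually_elim (simp add: H_def)
    with lim show ?thesis by (rule Lim_transform_eventually)
  qed
  have Hw: "H \<midarrow>w\<rightarrow> H w" if w: "w \<in> lattice \<tau>" for w
  proof -
    have "(\<lambda>z. H (z + w)) \<midarrow>0\<rightarrow> L" using H0 by (simp add: HL w)
    then have "H \<midarrow>w\<rightarrow> L" by (simp add: LIM_offset_zero_iff add.commute)
    then show ?thesis using w by (simp add: H_def)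
  qed
  have "H field_differentiable (at w)" for w
  proof (cases "w \<in> lattice \<tau>")
    case False
    then show ?thesis
      using Hhol open_Compl_lattice[OF \<tau>] by (auto simp: holomorphic_on_open field_differentiable_def)
  next
    case True
    have "\<forall>\<^sub>F z in at w. z \<notin> lattice \<tau>" by (rule eventually_at_not_in_lattice[OF \<tau>])
    then obtain e where e: "e > 0" "\<And>z. z \<noteq> w \<Longrightarrow> dist z w < e \<Longrightarrow> z \<notin> lattice \<tau>"
      by (auto simp: eventually_at)
    have "H holomorphic_on ball w e"
    proof (rule no_isolated_singularity'[where K = "{w}"])
      show "\<And>z. z \<in> {w} \<Longrightarrow> (H \<longlongrightarrow> H z) (at z within ball w e)"
        using Hw[OF True] by (auto intro: tendsto_within_subset)
      show "H holomorphic_on ball w e - {w}"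
        by (rule holomorphic_on_subset[OF Hhol]) (use e in \<open>auto simp: dist_commute\<close>)
    qed auto
    then show ?thesis using e by (auto simp: holomorphic_on_open field_differentiable_def)
  qed
  then have ent: "H holomorphic_on UNIV" by (simp add: holomorphic_on_def)
  have "bounded (range H)"
  proof -
    have "compact (H ` cball 0 (1 + norm \<tau>))"
      by (intro compact_continuous_image holomorphic_on_imp_continuous_on holomorphic_on_subset[OF ent]) auto
    moreover have "range H \<subseteq> H ` cball 0 (1 + norm \<tau>)"
    proof
      fix y assume "y \<in> range H"
      then obtain z where y: "y = H z" by auto
      define b where "b = \<lfloor>Im z / Im \<tau>\<rfloor>"
      define \<beta> where "\<beta> = frac (Im z / Im \<tau>)"
      define a where "a = \<lfloor>Re (z - of_int b * \<tau>) - \<beta> * Re \<tau>\<rfloor>"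
      define \<alpha> where "\<alpha> = frac (Re (z - of_int b * \<tau>) - \<beta> * Re \<tau>)"
      have "z = (of_real \<alpha> + of_real \<beta> * \<tau>) + (of_int a + of_int b * \<tau>)"
        using \<tau> by (simp add: complex_eq_iff \<alpha>_def a_def \<beta>_def b_def frac_def algebra_simps)
      then have "y = H (of_real \<alpha> + of_real \<beta> * \<tau>)"
        using HL[OF of_int_plus_in_lattice] y by metis
      moreover have "norm (of_real \<alpha> + of_real \<beta> * \<tau>) \<le> 1 + norm \<tau>"
      proof -
        have "norm (of_real \<alpha> + of_real \<beta> * \<tau>) \<le> norm (of_real \<alpha> :: complex) + norm (of_real \<beta> * \<tau>)" by (rule norm_triangle_ineq)
        also have "\<dots> \<le> 1 + norm \<tau>"
          unfolding norm_mult by (intro add_mono mult_left_le_one_le) (auto simp: \<alpha>_def \<beta>_def frac_lt_1 less_imp_le)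
        finally show ?thesis .
      qed
      ultimately show "y \<in> H ` cball 0 (1 + norm \<tau>)" by auto
    qed
    ultimately show ?thesis using compact_imp_bounded bounded_subset by blast
  qed
  then obtain C where C: "\<And>w. H w = C"
    using Liouville_theorem[OF ent] by (auto simp: constant_on_def)
  show "h z = L" if "z \<notin> lattice \<tau>"
    using C[of z] C[of 0] that by (simp add: H_def)
qed

text \<open>
The combination \<open>\<wp>'' - 6 \<wp>\<^sup>2\<close> has no pole, because the principal parts cancel; so it is constant
and its higher Laurent coefficients vanish. The factor \<open>(r - 6) (r + 1)\<close> is
\<open>(r - 2) (r - 3) - 12\<close>: the 12 stems from the two boundary terms \<open>i = 0\<close> and \<open>i = r\<close> of the
convolution. It vanishes for \<open>r = 6\<close>, which is why \<open>G\<^sub>6\<close> is a free parameter.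
\<close>

lemma wp_coeff_recurrence:
  assumes \<tau>: "Im \<tau> > 0" and r: "r > 6"
  shows "of_int ((int r - 6) * (int r + 1)) * wp_coeff \<tau> r =
    6 * (\<Sum>i\<in>{0<..<r}. wp_coeff \<tau> i * wp_coeff \<tau> (r - i))"
proof -
  define p where "p = wp_coeff \<tau>"
  define P where "P = (\<lambda>z. theta_coeff \<tau> 2 - theta_deriv 1 \<tau> z)"
  define h where "h = (\<lambda>z. - theta_deriv 3 \<tau> z - 6 * (P z * P z))"
  define c where "c = (\<lambda>r. of_int (int r - 3) * (of_int (int r - 2) * p r) - 6 * (\<Sum>i\<le>r. p i * p (r - i)))"
  have P: "P has_laurent_expansion laurent_series 2 p"
    unfolding P_def p_def by (rule normalized_wp_laurent[OF \<tau>])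
  have Phol: "P holomorphic_on - lattice \<tau>"
    unfolding P_def by (intro holomorphic_intros theta_deriv_holomorphic \<tau>)
  have hhol: "h holomorphic_on - lattice \<tau>"
    unfolding h_def by (intro holomorphic_intros theta_deriv_holomorphic Phol \<tau>)
  have dP: "deriv (deriv P) z = - theta_deriv 3 \<tau> z" if "z \<notin> lattice \<tau>" for z
  proof -
    have "(deriv ^^ 2) P z = (deriv ^^ 2) (\<lambda>z. theta_coeff \<tau> 2) z - (deriv ^^ 2) (theta_deriv 1 \<tau>) z"
      unfolding P_def by (rule higher_deriv_diff[of _ "- lattice \<tau>"])
        (use that in \<open>auto intro!: theta_deriv_holomorphic[of _ 1, simplified] open_Compl_lattice \<tau>\<close>)
    then show ?thesis by (simp add: numeral_2_eq_2 numeral_3_eq_3)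
  qed
  have "(\<lambda>z. deriv (deriv P) z - 6 * (P z * P z)) has_laurent_expansion
      fls_deriv (fls_deriv (laurent_series 2 p)) - fls_const 6 * (laurent_series 2 p * laurent_series 2 p)"
    by (intro has_laurent_expansion_diff has_laurent_expansion_mult has_laurent_expansion_deriv P has_laurent_expansion_const)
  also have "fls_deriv (fls_deriv (laurent_series 2 p)) - fls_const 6 * (laurent_series 2 p * laurent_series 2 p) = laurent_series 4 c"
    by (rule fls_eqI) (simp add: laurent_series_deriv laurent_series_mult fls_nth_laurent_series c_def)
  finally have "(\<lambda>z. deriv (deriv P) z - 6 * (P z * P z)) has_laurent_expansion laurent_series 4 c" .
  moreover have "\<forall>\<^sub>F z in at 0. deriv (deriv P) z - 6 * (P z * P z) = h z"
  proof -
    have "\<forall>\<^sub>F z in at 0. z \<notin> lattice \<tau>" by (rule eventually_at_not_in_lattice[OF \<tau>])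
    then show ?thesis by eventually_elim (simp add: h_def dP)
  qed
  ultimately have h: "h has_laurent_expansion laurent_series 4 c"
    by (simp cong: has_laurent_expansion_cong)
  have c0: "c r = 0" if "r < 4" for r
  proof -
    have "wp_coeff \<tau> 3 = 0" by (rule wp_coeff_small(4)) simp
    have "r = 0 \<or> r = 1 \<or> r = 2 \<or> r = 3" using that by linarith
    then show ?thesis
      using \<open>wp_coeff \<tau> 3 = 0\<close> by (elim disjE) (simp_all add: c_def p_def wp_coeff_small wp_coeff_small[unfolded numeral_2_eq_2]
          numeral_2_eq_2 numeral_3_eq_3 atMost_Suc)
  qed
  have "fls_subdegree (laurent_series 4 c) \<ge> 0"
  proof (cases "laurent_series 4 c = 0")
    case False
    then show ?thesis
      by (intro fls_subdegree_geI) (auto simp: fls_nth_laurent_series intro!: c0)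
  qed auto
  from has_laurent_expansion_imp_tendsto_0[OF h this]
  have lim: "h \<midarrow>0\<rightarrow> fls_nth (laurent_series 4 c) 0" .
  have "h z = fls_nth (laurent_series 4 c) 0" if "z \<notin> lattice \<tau>" for z
  proof (rule elliptic_no_poles_constant[OF \<tau> hhol _ _ lim that])
    fix z assume z: "z \<notin> lattice \<tau>"
    show "h (z + 1) = h z" using theta_deriv_plus_1[OF \<tau> z, of 1] theta_deriv_plus_1[OF \<tau> z, of 3]
      by (simp add: h_def P_def)
    show "h (z + \<tau>) = h z" using theta_deriv_plus_tau[OF \<tau> z, of 1] theta_deriv_plus_tau[OF \<tau> z, of 3]
      by (simp add: h_def P_def)
  qed
  then have "\<forall>\<^sub>F z in at 0. h z = fls_nth (laurent_series 4 c) 0"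
    using eventually_at_not_in_lattice[OF \<tau>, of 0] by (auto elim!: eventually_mono)
  with h have "(\<lambda>_. fls_nth (laurent_series 4 c) 0) has_laurent_expansion laurent_series 4 c"
    by (simp cong: has_laurent_expansion_cong)
  from has_laurent_expansion_unique[OF this has_laurent_expansion_const]
  have "fls_nth (laurent_series 4 c) (int r - 4) = fls_nth (fls_const (fls_nth (laurent_series 4 c) 0)) (int r - 4)" by simp
  then have "c r = 0" using r by (simp add: fls_nth_laurent_series)
  moreover have "(\<Sum>i\<le>r. p i * p (r - i)) = 2 * p r + (\<Sum>i\<in>{0<..<r}. p i * p (r - i))"
  proof -
    have "{..r} = insert 0 (insert r {0<..<r})" using r by auto
    then show ?thesis using r by (simp add: p_def wp_coeff_small)
  qed
  ultimately have "of_int (int r - 3) * (of_int (int r - 2) * p r) - 12 * p r = 6 * (\<Sum>i\<in>{0<..<r}. p i * p (r - i))"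
    by (simp add: c_def algebra_simps)
  moreover have "of_int (int r - 3) * (of_int (int r - 2) * p r) - 12 * p r = of_int ((int r - 6) * (int r + 1)) * p r"
    by (simp add: algebra_simps)
  ultimately show ?thesis by (simp add: p_def)
qed

section \<open>Polynomials in Eisenstein series and theta derivatives, filtered by weight\<close>

text \<open>
The points at which no difference \<open>z i - z j\<close> is a pole.
\<close>

definition separated :: "nat set \<Rightarrow> complex \<Rightarrow> (nat \<Rightarrow> complex) \<Rightarrow> bool" where
  "separated S \<tau> z \<longleftrightarrow> (\<forall>i\<in>S. \<forall>j\<in>S. i \<noteq> j \<longrightarrow> z i - z j \<notin> lattice \<tau>)"

lemma separated_subset: "separated T \<tau> z \<Longrightarrow> S \<subseteq> T \<Longrightarrow> separated S \<tau> z"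
  by (auto simp: separated_def)

lemma separatedD: "separated S \<tau> z \<Longrightarrow> i \<in> S \<Longrightarrow> j \<in> S \<Longrightarrow> i \<noteq> j \<Longrightarrow> z i - z j \<notin> lattice \<tau>"
  by (auto simp: separated_def)

lemma lattice_diff_commute: "w - z \<in> lattice \<tau> \<longleftrightarrow> z - w \<in> lattice \<tau>"
  using lattice_minus_iff[of "z - w" \<tau>] by simp

lemma separated_insert_upd:
  assumes "s \<notin> S"
  shows "separated (insert s S) \<tau> (z(s := w)) \<longleftrightarrow> separated S \<tau> z \<and> (\<forall>j\<in>S. w - z j \<notin> lattice \<tau>)"
  using assms lattice_diff_commute[of w _ \<tau>] by (auto simp: separated_def)

lemma separated_shift:
  assumes "separated (insert s S) \<tau> z" "c \<in> lattice \<tau>"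
  shows "separated (insert s S) \<tau> (z(s := z s + c))"
proof -
  have "z s + c - w \<in> lattice \<tau> \<longleftrightarrow> z s - w \<in> lattice \<tau>"  "w - (z s + c) \<in> lattice \<tau> \<longleftrightarrow> w - z s \<in> lattice \<tau>" for w
    using lattice_add_iff[OF assms(2), of "z s - w"] lattice_add_iff[OF lattice_minus[OF assms(2)], of "w - z s"]
    by (simp_all add: algebra_simps)
  then show ?thesis using assms(1) by (auto simp: separated_def)
qed

text \<open>
\<open>qm_poly S k F\<close>: the function \<open>F\<close> is a polynomial of weight at most \<open>k\<close> in \<open>G\<^sub>2\<close>, \<open>G\<^sub>4\<close>,
\<open>G\<^sub>6\<close> and the derivatives of \<open>\<theta>'/\<theta>\<close> at the differences of the variables in \<open>S\<close>, where the
\<open>m\<close>-th derivative has weight \<open>m + 1\<close>. The last rule identifies functions that agree wherever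
they are meaningful; it spares all later arguments the values at poles and off the upper half
plane. For empty \<open>S\<close> these are the quasimodular forms of mixed weight at most \<open>k\<close>.
\<close>

inductive qm_poly :: "nat set \<Rightarrow> nat \<Rightarrow> (complex \<Rightarrow> (nat \<Rightarrow> complex) \<Rightarrow> complex) \<Rightarrow> bool" for S where
  const: "qm_poly S 0 (\<lambda>\<tau> z. c)"
| G2: "qm_poly S 2 (\<lambda>\<tau> z. eisenstein_G 2 \<tau>)"
| G4: "qm_poly S 4 (\<lambda>\<tau> z. eisenstein_G 4 \<tau>)"
| G6: "qm_poly S 6 (\<lambda>\<tau> z. eisenstein_G 6 \<tau>)"
| theta: "i \<in> S \<Longrightarrow> j \<in> S \<Longrightarrow> i \<noteq> j \<Longrightarrow> qm_poly S (Suc m) (\<lambda>\<tau> z. theta_deriv m \<tau> (z i - z j))"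
| add: "qm_poly S k F \<Longrightarrow> qm_poly S k G \<Longrightarrow> qm_poly S k (\<lambda>\<tau> z. F \<tau> z + G \<tau> z)"
| mult: "qm_poly S k F \<Longrightarrow> qm_poly S l G \<Longrightarrow> qm_poly S (k + l) (\<lambda>\<tau> z. F \<tau> z * G \<tau> z)"
| mono: "qm_poly S k F \<Longrightarrow> k \<le> l \<Longrightarrow> qm_poly S l F"
| cong: "qm_poly S k F \<Longrightarrow> (\<And>\<tau> z. Im \<tau> > 0 \<Longrightarrow> separated S \<tau> z \<Longrightarrow> F \<tau> z = G \<tau> z) \<Longrightarrow> qm_poly S k G"

lemma qm_poly_const: "qm_poly S k (\<lambda>\<tau> z. c)"
  by (rule qm_poly.mono[OF qm_poly.const]) simp

lemma qm_poly_cmult: "qm_poly S k F \<Longrightarrow> qm_poly S k (\<lambda>\<tau> z. c * F \<tau> z)"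
  using qm_poly.mult[OF qm_poly.const] by fastforce

lemma qm_poly_diff: "qm_poly S k F \<Longrightarrow> qm_poly S k G \<Longrightarrow> qm_poly S k (\<lambda>\<tau> z. F \<tau> z - G \<tau> z)"
  using qm_poly.add[OF _ qm_poly_cmult[of S k G "- 1"], of F] by simp

lemma qm_poly_sum: "(\<And>x. x \<in> A \<Longrightarrow> qm_poly S k (F x)) \<Longrightarrow> qm_poly S k (\<lambda>\<tau> z. \<Sum>x\<in>A. F x \<tau> z)"
  by (induction A rule: infinite_finite_induct) (auto intro: qm_poly_const qm_poly.add)

lemma qm_poly_power: "qm_poly S k F \<Longrightarrow> qm_poly S (p * k) (\<lambda>\<tau> z. F \<tau> z ^ p)"
  by (induction p) (auto intro: qm_poly_const qm_poly.mult)

lemma qm_poly_prod: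
  assumes "finite A" "\<And>x. x \<in> A \<Longrightarrow> qm_poly S (k x) (F x)"
  shows "qm_poly S (\<Sum>x\<in>A. k x) (\<lambda>\<tau> z. \<Prod>x\<in>A. F x \<tau> z)"
  using assms by (induction A rule: finite_induct) (auto intro: qm_poly_const qm_poly.mult)

lemma qm_poly_subset:
  assumes "qm_poly S k F" "S \<subseteq> T"
  shows "qm_poly T k F"
  using assms
proof (induction rule: qm_poly.induct)
  case (cong k F G)
  then show ?case by (blast intro: qm_poly.cong separated_subset)
qed (auto intro: qm_poly.intros)

lemma qm_poly_independent:
  assumes "qm_poly S k F" "s \<notin> S" "Im \<tau> > 0" "separated S \<tau> z"
  shows "F \<tau> (z(s := w)) = F \<tau> z"
  using assms
proof (induction rule: qm_poly.induct)
  case (cong k F G)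
  have "separated S \<tau> (z(s := w))" using cong.prems by (auto simp: separated_def)
  then have "G \<tau> (z(s := w)) = F \<tau> (z(s := w))" using cong by metis
  also have "\<dots> = F \<tau> z" using cong by blast
  also have "\<dots> = G \<tau> z" using cong by blast
  finally show ?case .
qed auto

text \<open>
By the recurrence all Eisenstein series of weight above 6 are polynomials in \<open>G\<^sub>4\<close> and \<open>G\<^sub>6\<close>.
\<close>

lemma qm_poly_wp_coeff: "qm_poly S w (\<lambda>\<tau> z. wp_coeff \<tau> w)" 
proof (induction w rule: less_induct)
  case (less w)
  consider "w \<le> 2 \<or> odd w" | "w = 4" | "w = 6" | "w > 6" by fastforce
  then show ?case
  proof cases
    case 1
    then have "wp_coeff \<tau> w = (if w = 0 then 1 else 0)" for \<tau>
      by (auto simp: wp_coeff_def theta_coeff_def le_less numeral_2_eq_2 less_Suc_eq)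
    then show ?thesis by (simp add: qm_poly_const)
  next
    case 2
    have "wp_coeff \<tau> w = (6 * (2 * of_real pi * \<i>) ^ 4 / fact 3) * eisenstein_G 4 \<tau>" for \<tau>
      by (simp add: 2 wp_coeff_def theta_coeff_def)
    then show ?thesis unfolding 2 by (simp only:) (intro qm_poly_cmult qm_poly.G4)
  next
    case 3
    have "wp_coeff \<tau> w = (10 * (2 * of_real pi * \<i>) ^ 6 / fact 5) * eisenstein_G 6 \<tau>" for \<tau>
      by (simp add: 3 wp_coeff_def theta_coeff_def)
    then show ?thesis unfolding 3 by (simp only:) (intro qm_poly_cmult qm_poly.G6)
  next
    case 4
    define d :: complex where "d = of_int ((int w - 6) * (int w + 1))"
    have "(int w - 6) * (int w + 1) \<noteq> 0" using 4 by simp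
    then have d: "d \<noteq> 0" unfolding d_def by (subst of_int_eq_0_iff)
    have "qm_poly S w (\<lambda>\<tau> z. wp_coeff \<tau> i * wp_coeff \<tau> (w - i))" if "i \<in> {0<..<w}" for i
      using qm_poly.mult[OF less.IH[of i] less.IH[of "w - i"]] that by simp
    then have "qm_poly S w (\<lambda>\<tau> z. (6 / d) * (\<Sum>i\<in>{0<..<w}. wp_coeff \<tau> i * wp_coeff \<tau> (w - i)))"
      by (intro qm_poly_cmult qm_poly_sum)
    then show ?thesis
    proof (rule qm_poly.cong)
      fix \<tau> :: complex assume "Im \<tau> > 0"
      from wp_coeff_recurrence[OF this 4]
      have "d * wp_coeff \<tau> w = 6 * (\<Sum>i\<in>{0<..<w}. wp_coeff \<tau> i * wp_coeff \<tau> (w - i))"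
        by (simp only: d_def)
      then show "(6 / d) * (\<Sum>i\<in>{0<..<w}. wp_coeff \<tau> i * wp_coeff \<tau> (w - i)) = wp_coeff \<tau> w"
        using d by (metis nonzero_mult_div_cancel_left times_divide_eq_left)
    qed
  qed
qed

lemma qm_poly_theta_coeff: "qm_poly S w (\<lambda>\<tau> z. theta_coeff \<tau> w)"
proof -
  consider "w \<le> 1" | "w = 2" | "w > 2" by linarith
  then show ?thesis
  proof cases
    case 1
    then have "theta_coeff \<tau> w = (if w = 0 then 1 else 0)" for \<tau>
      by (auto simp: theta_coeff_def le_Suc_eq)
    then show ?thesis by (simp add: qm_poly_const)
  next
    case 2
    have "theta_coeff \<tau> w = (- 2 * (2 * of_real pi * \<i>) ^ 2) * eisenstein_G 2 \<tau>" for \<tau>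
      by (simp add: 2 theta_coeff_def)
    then show ?thesis unfolding 2 by (simp only:) (intro qm_poly_cmult qm_poly.G2)
  next
    case 3
    then have ne: "int w - 1 \<noteq> 0" by simp
    define e :: complex where "e = of_int (int w - 1)"
    have "e \<noteq> 0" unfolding e_def by (subst of_int_eq_0_iff) (rule ne)
    moreover have "wp_coeff \<tau> w = - e * theta_coeff \<tau> w" for \<tau>
      using 3 by (simp only: wp_coeff_def e_def) simp
    ultimately have "theta_coeff \<tau> w = (- 1 / e) * wp_coeff \<tau> w" for \<tau> by simp
    then show ?thesis by (simp only:) (intro qm_poly_cmult qm_poly_wp_coeff)
  qed
qed

section \<open>Laurent expansions in one of the variables\<close>

text \<open>
As a function of the variable \<open>z s\<close>, the function \<open>F\<close> has a Laurent expansion at \<open>z j\<close> whose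
coefficients are again polynomials in the remaining variables, of the weight demanded by
homogeneity, and depend on \<open>\<tau>\<close> uniformly.
\<close>

definition laurent_qm :: "nat set \<Rightarrow> nat \<Rightarrow> nat \<Rightarrow> nat \<Rightarrow> (complex \<Rightarrow> (nat \<Rightarrow> complex) \<Rightarrow> complex) \<Rightarrow> bool" where
  "laurent_qm S s j k F \<longleftrightarrow> (\<exists>c. (\<forall>r. qm_poly S r (c r)) \<and>
     (\<forall>\<tau> z. Im \<tau> > 0 \<longrightarrow> separated S \<tau> z \<longrightarrow>
        (\<lambda>u. F \<tau> (z(s := z j + u))) has_laurent_expansion laurent_series k (\<lambda>r. c r \<tau> z)))"

lemma laurent_qmI:
  assumes "\<And>r. qm_poly S r (c r)"
    "\<And>\<tau> z. Im \<tau> > 0 \<Longrightarrow> separated S \<tau> z \<Longrightarrow>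
        (\<lambda>u. F \<tau> (z(s := z j + u))) has_laurent_expansion laurent_series k (\<lambda>r. c r \<tau> z)"
  shows "laurent_qm S s j k F"
  using assms unfolding laurent_qm_def by blast

lemma eventually_not_in_lattice:
  assumes "Im \<tau> > 0"
  shows "\<forall>\<^sub>F u in at 0. d + u \<notin> lattice \<tau>"
proof -
  have "\<forall>\<^sub>F w in at d. w \<notin> lattice \<tau>" by (rule eventually_at_not_in_lattice[OF assms])
  then show ?thesis by (simp add: at_to_0[of d] eventually_filtermap add.commute)
qed

lemma eventually_separated:
  assumes "finite S" "s \<notin> S" "Im \<tau> > 0" "separated S \<tau> z"
  shows "\<forall>\<^sub>F u in at 0. separated (insert s S) \<tau> (z(s := w + u))"
proof -
  have "\<forall>\<^sub>F u in at 0. \<forall>i\<in>S. (w - z i) + u \<notin> lattice \<tau>"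
    using assms by (intro eventually_ball_finite ballI eventually_not_in_lattice)
  then show ?thesis
    by eventually_elim (use assms in \<open>auto simp: separated_insert_upd algebra_simps\<close>)
qed

lemma laurent_qm_cong:
  assumes "laurent_qm S s j k F" "finite S" "s \<notin> S"
    "\<And>\<tau> z. Im \<tau> > 0 \<Longrightarrow> separated (insert s S) \<tau> z \<Longrightarrow> F \<tau> z = G \<tau> z"
  shows "laurent_qm S s j k G"
proof -
  obtain c where c: "\<And>r. qm_poly S r (c r)" "\<And>\<tau> z. Im \<tau> > 0 \<Longrightarrow> separated S \<tau> z \<Longrightarrow>
        (\<lambda>u. F \<tau> (z(s := z j + u))) has_laurent_expansion laurent_series k (\<lambda>r. c r \<tau> z)"
    using assms(1) unfolding laurent_qm_def by blast
  show ?thesis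
  proof (rule laurent_qmI[OF c(1)])
    fix \<tau> z assume \<tau>: "Im \<tau> > 0" "separated S \<tau> z"
    have "\<forall>\<^sub>F u in at 0. F \<tau> (z(s := z j + u)) = G \<tau> (z(s := z j + u))"
      using eventually_separated[OF assms(2,3) \<tau>] by eventually_elim (rule assms(4)[OF \<tau>(1)])
    from has_laurent_expansion_cong[OF this refl] c(2)[OF \<tau>]
    show "(\<lambda>u. G \<tau> (z(s := z j + u))) has_laurent_expansion laurent_series k (\<lambda>r. c r \<tau> z)" by simp
  qed
qed

lemma laurent_qm_mono:
  assumes "laurent_qm S s j k F" "k \<le> l"
  shows "laurent_qm S s j l F"
proof -
  obtain c where c: "\<And>r. qm_poly S r (c r)" "\<And>\<tau> z. Im \<tau> > 0 \<Longrightarrow> separated S \<tau> z \<Longrightarrow>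
        (\<lambda>u. F \<tau> (z(s := z j + u))) has_laurent_expansion laurent_series k (\<lambda>r. c r \<tau> z)"
    using assms(1) unfolding laurent_qm_def by blast
  define c' where "c' = (\<lambda>r \<tau> z. if r < l - k then 0 else c (r - (l - k)) \<tau> z)"
  show ?thesis
  proof (rule laurent_qmI)
    show "qm_poly S r (c' r)" for r
    proof (cases "r < l - k")
      case True
      then show ?thesis by (simp add: c'_def qm_poly_const)
    next
      case False
      then show ?thesis using qm_poly.mono[OF c(1)[of "r - (l - k)"], of r] by (simp add: c'_def)
    qed
    show "(\<lambda>u. F \<tau> (z(s := z j + u))) has_laurent_expansion laurent_series l (\<lambda>r. c' r \<tau> z)"
      if "Im \<tau> > 0" "separated S \<tau> z" for \<tau> z
      using c(2)[OF that] laurent_series_raise[of k "\<lambda>r. c r \<tau> z" "l - k"] assms(2) by (simp add: c'_def)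
  qed
qed

lemma laurent_qm_add:
  assumes "laurent_qm S s j k F" "laurent_qm S s j k G"
  shows "laurent_qm S s j k (\<lambda>\<tau> z. F \<tau> z + G \<tau> z)"
proof -
  obtain c where c: "\<And>r. qm_poly S r (c r)" "\<And>\<tau> z. Im \<tau> > 0 \<Longrightarrow> separated S \<tau> z \<Longrightarrow>
        (\<lambda>u. F \<tau> (z(s := z j + u))) has_laurent_expansion laurent_series k (\<lambda>r. c r \<tau> z)"
    using assms(1) unfolding laurent_qm_def by blast
  obtain d where d: "\<And>r. qm_poly S r (d r)" "\<And>\<tau> z. Im \<tau> > 0 \<Longrightarrow> separated S \<tau> z \<Longrightarrow>
        (\<lambda>u. G \<tau> (z(s := z j + u))) has_laurent_expansion laurent_series k (\<lambda>r. d r \<tau> z)"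
    using assms(2) unfolding laurent_qm_def by blast
  show ?thesis
    by (rule laurent_qmI[where c = "\<lambda>r \<tau> z. c r \<tau> z + d r \<tau> z"])
       (auto intro: qm_poly.add c d has_laurent_expansion_add simp flip: laurent_series_add)
qed

lemma laurent_qm_mult:
  assumes "laurent_qm S s j k F" "laurent_qm S s j l G"
  shows "laurent_qm S s j (k + l) (\<lambda>\<tau> z. F \<tau> z * G \<tau> z)"
proof -
  obtain c where c: "\<And>r. qm_poly S r (c r)" "\<And>\<tau> z. Im \<tau> > 0 \<Longrightarrow> separated S \<tau> z \<Longrightarrow>
        (\<lambda>u. F \<tau> (z(s := z j + u))) has_laurent_expansion laurent_series k (\<lambda>r. c r \<tau> z)"
    using assms(1) unfolding laurent_qm_def by blast
  obtain d where d: "\<And>r. qm_poly S r (d r)" "\<And>\<tau> z. Im \<tau> > 0 \<Longrightarrow> separated S \<tau> z \<Longrightarrow>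
        (\<lambda>u. G \<tau> (z(s := z j + u))) has_laurent_expansion laurent_series l (\<lambda>r. d r \<tau> z)"
    using assms(2) unfolding laurent_qm_def by blast
  show ?thesis
  proof (rule laurent_qmI)
    show "qm_poly S r (\<lambda>\<tau> z. \<Sum>i\<le>r. c i \<tau> z * d (r - i) \<tau> z)" for r
    proof (rule qm_poly_sum)
      fix i assume "i \<in> {..r}"
      then show "qm_poly S r (\<lambda>\<tau> z. c i \<tau> z * d (r - i) \<tau> z)"
        using qm_poly.mult[OF c(1)[of i] d(1)[of "r - i"]] by simp
    qed
    show "(\<lambda>u. F \<tau> (z(s := z j + u)) * G \<tau> (z(s := z j + u))) has_laurent_expansion
        laurent_series (k + l) (\<lambda>r. \<Sum>i\<le>r. c i \<tau> z * d (r - i) \<tau> z)"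
      if "Im \<tau> > 0" "separated S \<tau> z" for \<tau> z
    proof -
      have "(\<lambda>u. F \<tau> (z(s := z j + u)) * G \<tau> (z(s := z j + u))) has_laurent_expansion
          laurent_series k (\<lambda>r. c r \<tau> z) * laurent_series l (\<lambda>r. d r \<tau> z)"
        by (intro has_laurent_expansion_mult c d that)
      then show ?thesis by (simp only: laurent_series_mult)
    qed
  qed
qed

lemma laurent_qm_coeff:
  assumes "qm_poly S k F" "s \<notin> S"
  shows "laurent_qm S s j k F"
proof (rule laurent_qmI)
  show "qm_poly S r (\<lambda>\<tau> z. if r = k then F \<tau> z else 0)" for r
    using assms(1) qm_poly_const[of S r 0] by (cases "r = k") auto
  fix \<tau> z assume "Im \<tau> > 0" "separated S \<tau> z"
  then have "(\<lambda>u. F \<tau> (z(s := z j + u))) = (\<lambda>u. F \<tau> z)"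
    using qm_poly_independent[OF assms] by blast
  moreover have "laurent_series k (\<lambda>r. if r = k then F \<tau> z else 0) = fls_const (F \<tau> z)"
    by (rule fls_eqI) (auto simp: fls_nth_laurent_series)
  ultimately show "(\<lambda>u. F \<tau> (z(s := z j + u))) has_laurent_expansion laurent_series k (\<lambda>r. if r = k then F \<tau> z else 0)"
    by simp
qed

text \<open>
At another point \<open>z i\<close> this is Taylor's formula: the coefficients are higher derivatives at
\<open>z j - z i\<close>. At its own pole the coefficients are Eisenstein series.
\<close>

lemma laurent_qm_theta:
  assumes "i \<in> S" "j \<in> S" "s \<notin> S"
  shows "laurent_qm S s j (Suc m) (\<lambda>\<tau> z. theta_deriv m \<tau> (z s - z i))"
proof (cases "i = j")
  case True
  show ?thesis
  proof (rule laurent_qmI)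
    show "qm_poly S r (\<lambda>\<tau> z. (\<Prod>i\<in>{1..m}. of_int (int r - int i)) * theta_coeff \<tau> r)" for r
      by (intro qm_poly_cmult qm_poly_theta_coeff)
    show "(\<lambda>u. theta_deriv m \<tau> ((z(s := z j + u)) s - (z(s := z j + u)) i)) has_laurent_expansion
       laurent_series (Suc m) (\<lambda>r. (\<Prod>i\<in>{1..m}. of_int (int r - int i)) * theta_coeff \<tau> r)"
      if "Im \<tau> > 0" for \<tau> and z :: "nat \<Rightarrow> complex"
    proof -
      have "j \<noteq> s" using assms by auto
      then show ?thesis using theta_deriv_laurent[OF that, of m] True by simp
    qed
  qed
next
  case False
  define c where "c = (\<lambda>r \<tau> (z::nat \<Rightarrow> complex). if r < Suc m then 0 else (1 / fact (r - Suc m)) * theta_deriv (r - 1) \<tau> (z j - z i))"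
  show ?thesis
  proof (rule laurent_qmI)
    show "qm_poly S r (c r)" for r
    proof (cases "r < Suc m")
      case True
      then show ?thesis by (simp add: c_def qm_poly_const)
    next
      case False
      then have "qm_poly S r (\<lambda>\<tau> z. (1 / fact (r - Suc m)) * theta_deriv (r - 1) \<tau> (z j - z i))"
        using qm_poly.theta[OF assms(2,1), of "r - 1"] \<open>i \<noteq> j\<close> by (intro qm_poly_cmult) auto
      then show ?thesis using False by (simp add: c_def)
    qed
    fix \<tau> z assume \<tau>: "Im \<tau> > 0" and z: "separated S \<tau> z"
    define f where "f = theta_deriv m \<tau>"
    have "z j - z i \<notin> lattice \<tau>" using z assms False by (auto simp: separated_def)
    then have "f analytic_on {z j - z i}"
      unfolding f_def using theta_deriv_holomorphic[OF \<tau>, of m] open_Compl_lattice[OF \<tau>]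
      by (auto simp: analytic_at)
    from has_laurent_expansion_fps[OF analytic_at_imp_has_fps_expansion[OF this]]
    have "(\<lambda>u. f (z j - z i + u)) has_laurent_expansion fps_to_fls (fps_expansion f (z j - z i))" .
    also have "fps_to_fls (fps_expansion f (z j - z i)) = laurent_series 0 (\<lambda>n. (deriv ^^ n) f (z j - z i) / fact n)"
      by (simp add: laurent_series_def fps_expansion_def)
    also have "\<dots> = laurent_series (Suc m) (\<lambda>r. c r \<tau> z)"
    proof -
      have "(\<lambda>r. if r < Suc m then 0 else (deriv ^^ (r - Suc m)) f (z j - z i) / fact (r - Suc m)) = (\<lambda>r. c r \<tau> z)"
      proof
        fix r
        have "(deriv ^^ (r - Suc m)) f = theta_deriv (r - 1) \<tau>" if "\<not> r < Suc m"
        proof -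
          have "r - 1 = (r - Suc m) + m" using that by simp
          then show ?thesis unfolding f_def by (simp only: funpow_add o_apply)
        qed
        then show "(if r < Suc m then 0 else (deriv ^^ (r - Suc m)) f (z j - z i) / fact (r - Suc m)) = c r \<tau> z"
          by (simp add: c_def)
      qed
      then show ?thesis using laurent_series_raise[of 0 "\<lambda>n. (deriv ^^ n) f (z j - z i) / fact n" "Suc m"] by simp
    qed
    finally have "(\<lambda>u. f (z j - z i + u)) has_laurent_expansion laurent_series (Suc m) (\<lambda>r. c r \<tau> z)" .
    moreover have "i \<noteq> s" "j \<noteq> s" using assms by auto
    ultimately show "(\<lambda>u. theta_deriv m \<tau> ((z(s := z j + u)) s - (z(s := z j + u)) i)) has_laurent_expansion
       laurent_series (Suc m) (\<lambda>r. c r \<tau> z)"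
      by (simp add: f_def algebra_simps)
  qed
qed

theorem qm_poly_laurent:
  assumes "qm_poly (insert s S) k F" "finite S" "s \<notin> S" "j \<in> S"
  shows "laurent_qm S s j k F"
  using assms
proof (induction rule: qm_poly.induct)
  case (theta i i' m)
  consider "i = s" "i' \<in> S" | "i' = s" "i \<in> S" | "i \<in> S" "i' \<in> S" using theta by auto
  then show ?case
  proof cases
    case 1
    then show ?thesis using laurent_qm_theta[of i' S j s m] theta by simp
  next
    case 2
    have "laurent_qm S s j (0 + Suc m) (\<lambda>\<tau> z. (- 1) ^ Suc m * theta_deriv m \<tau> (z s - z i))"
      using theta 2 by (intro laurent_qm_mult laurent_qm_theta laurent_qm_coeff qm_poly.const)
    then have "laurent_qm S s j (Suc m) (\<lambda>\<tau> z. (- 1) ^ Suc m * theta_deriv m \<tau> (z s - z i))"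
      by (simp only: add_0)
    then show ?thesis
    proof (rule laurent_qm_cong)
      fix \<tau> z assume \<tau>: "Im \<tau> > 0" and z: "separated (insert s S) \<tau> z"
      have "z s - z i \<notin> lattice \<tau>" by (rule separatedD[OF z]) (use 2 theta in auto)
      from theta_deriv_minus[OF \<tau> this, of m]
      show "(- 1) ^ Suc m * theta_deriv m \<tau> (z s - z i) = theta_deriv m \<tau> (z i - z i')" using 2 by simp
    qed (use theta in auto)
  next
    case 3
    then show ?thesis using theta by (intro laurent_qm_coeff qm_poly.theta) auto
  qed
next
  case (cong k F G)
  then show ?case by (blast intro: laurent_qm_cong)
qed (auto intro: laurent_qm_coeff qm_poly.intros laurent_qm_add laurent_qm_mult laurent_qm_mono)

section \<open>Telescoping under translation by \<open>\<tau>\<close>\<close>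

text \<open>
A Bernoulli polynomial, up to scaling and shift: the difference operator is surjective on
polynomials and lowers the degree by one.
\<close>

lemma exists_poly_difference:
  fixes c :: complex
  assumes c: "c \<noteq> 0"
  shows "\<exists>p. degree p \<le> Suc n \<and> (\<forall>x. poly p x - poly p (x - c) = x ^ n)"
proof (induction n rule: less_induct)
  case (less n)
  then have "\<forall>k\<in>{..<n}. \<exists>p. degree p \<le> Suc k \<and> (\<forall>x. poly p x - poly p (x - c) = x ^ k)" by auto
  then obtain P where P: "\<And>k. k < n \<Longrightarrow> degree (P k) \<le> Suc k"
    "\<And>k x. k < n \<Longrightarrow> poly (P k) x - poly (P k) (x - c) = x ^ k"
    by (metis bchoice lessThan_iff)
  define a where "a = (\<lambda>k. of_nat (Suc n choose k) * (- c) ^ (Suc n - k))"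
  define d where "d = of_nat (Suc n) * c"
  have d: "d \<noteq> 0" using c by (simp add: d_def del: of_nat_Suc)
  \<comment> \<open>The leading monomial, corrected by the inductive solutions for the lower powers.\<close>
  define p where "p = smult (1 / d) (monom 1 (Suc n) + (\<Sum>k<n. smult (a k) (P k)))"
  have "degree (\<Sum>k<n. smult (a k) (P k)) \<le> Suc n"
  proof (rule degree_sum_le)
    fix k assume "k \<in> {..<n}"
    then show "degree (smult (a k) (P k)) \<le> Suc n"
      using P(1)[of k] degree_smult_le[of "a k" "P k"] by simp
  qed simp
  then have "degree p \<le> Suc n" unfolding p_def
    by (intro order.trans[OF degree_smult_le] degree_add_le degree_monom_le)
  moreover have "poly p x - poly p (x - c) = x ^ n" for x
  proof -
    have "(x - c) ^ Suc n = (\<Sum>k\<le>Suc n. a k * x ^ k)"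
      using binomial_ring[of x "- c" "Suc n"] by (simp add: a_def mult_ac)
    also have "\<dots> = x ^ Suc n + (- d * x ^ n + (\<Sum>k<n. a k * x ^ k))"
    proof -
      have "a (Suc n) = 1" "a n = - d" by (simp_all add: a_def d_def)
      then show ?thesis by (simp add: lessThan_Suc_atMost[symmetric])
    qed
    finally have 1: "x ^ Suc n - (x - c) ^ Suc n + (\<Sum>k<n. a k * x ^ k) = d * x ^ n" by simp
    have "poly p x - poly p (x - c) = (1 / d) * (x ^ Suc n - (x - c) ^ Suc n + (\<Sum>k<n. a k * (poly (P k) x - poly (P k) (x - c))))"
      by (simp add: p_def poly_monom poly_sum algebra_simps sum_subtractf)
    also have "(\<Sum>k<n. a k * (poly (P k) x - poly (P k) (x - c))) = (\<Sum>k<n. a k * x ^ k)"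
      by (intro sum.cong) (simp_all add: P(2))
    finally show ?thesis using 1 d by simp
  qed
  ultimately show ?case by blast
qed

lemma qm_poly_poly:
  assumes "qm_poly S 1 F" "degree p \<le> n"
  shows "qm_poly S n (\<lambda>\<tau> z. poly p (F \<tau> z))"
proof -
  have "qm_poly S n (\<lambda>\<tau> z. coeff p i * F \<tau> z ^ i)" if "i \<le> degree p" for i
    using qm_poly_cmult[OF qm_poly_power[OF assms(1), of i], of "coeff p i"] that assms(2)
    by (auto intro: qm_poly.mono)
  then show ?thesis unfolding poly_altdef by (intro qm_poly_sum) auto
qed

text \<open>
Functions of weight at most \<open>k\<close> that are doubly periodic in \<open>z s\<close>. Differences of \<open>\<theta>'/\<theta>\<close> at
two arguments are doubly periodic, so one function \<open>\<theta>'/\<theta>\<close>, taken relative to a fixed base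
point \<open>z a\<close>, accounts for the whole failure of double periodicity.
\<close>

inductive elliptic_in :: "nat set \<Rightarrow> nat \<Rightarrow> nat \<Rightarrow> nat \<Rightarrow> (complex \<Rightarrow> (nat \<Rightarrow> complex) \<Rightarrow> complex) \<Rightarrow> bool" for S s a where
  coeff: "qm_poly S k F \<Longrightarrow> elliptic_in S s a k F"
| diff: "j \<in> S \<Longrightarrow> elliptic_in S s a 1 (\<lambda>\<tau> z. theta_deriv 0 \<tau> (z s - z j) - theta_deriv 0 \<tau> (z s - z a))"
| deriv: "j \<in> S \<Longrightarrow> elliptic_in S s a (Suc (Suc m)) (\<lambda>\<tau> z. theta_deriv (Suc m) \<tau> (z s - z j))"
| mult: "elliptic_in S s a k F \<Longrightarrow> elliptic_in S s a l G \<Longrightarrow> elliptic_in S s a (k + l) (\<lambda>\<tau> z. F \<tau> z * G \<tau> z)"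

lemma elliptic_in_imp_qm_poly:
  assumes "elliptic_in S s a k F" "s \<notin> S" "a \<in> S"
  shows "qm_poly (insert s S) k F"
  using assms
proof (induction rule: elliptic_in.induct)
  case (diff j)
  have "qm_poly (insert s S) (Suc 0) (\<lambda>\<tau> z. theta_deriv 0 \<tau> (z s - z j) - theta_deriv 0 \<tau> (z s - z a))"
    by (intro qm_poly_diff qm_poly.theta) (use diff in auto)
  then show ?case by simp
next
  case (coeff k F)
  then show ?case by (auto intro: qm_poly_subset)
next
  case (deriv j m)
  then show ?case by (intro qm_poly.theta) auto
qed (auto intro: qm_poly.intros)

lemma elliptic_in_shift:
  assumes "elliptic_in S s a k F" "s \<notin> S" "a \<in> S" "Im \<tau> > 0" "separated (insert s S) \<tau> z"
  shows "F \<tau> (z(s := z s + \<tau>)) = F \<tau> z"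
  using assms
proof (induction rule: elliptic_in.induct)
  case (coeff k F)
  show ?case by (rule qm_poly_independent[OF coeff.hyps]) (use coeff.prems in \<open>auto intro: separated_subset\<close>)
next
  case (diff j)
  have "z s - z j \<notin> lattice \<tau>" "z s - z a \<notin> lattice \<tau>"
    using diff by (auto simp: separated_def)
  then show ?case using diff theta_deriv_plus_tau[of \<tau> _ 0] by (auto simp: diff_add_eq[symmetric])
next
  case (deriv j m)
  have "z s - z j \<notin> lattice \<tau>" using deriv by (auto simp: separated_def)
  then show ?case using deriv theta_deriv_plus_tau[of \<tau> "z s - z j" "Suc m"] by (auto simp: diff_add_eq[symmetric])
qed auto

text \<open>
Polynomials in \<open>X = (\<theta>'/\<theta>)(z s - z a)\<close> over the functions doubly periodic in \<open>z s\<close>.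
\<close>

inductive poly_over_elliptic :: "nat set \<Rightarrow> nat \<Rightarrow> nat \<Rightarrow> nat \<Rightarrow> (complex \<Rightarrow> (nat \<Rightarrow> complex) \<Rightarrow> complex) \<Rightarrow> bool" for S s a where
  monom: "elliptic_in S s a k F \<Longrightarrow> poly_over_elliptic S s a (p + k) (\<lambda>\<tau> z. theta_deriv 0 \<tau> (z s - z a) ^ p * F \<tau> z)"
| add: "poly_over_elliptic S s a k F \<Longrightarrow> poly_over_elliptic S s a k G \<Longrightarrow> poly_over_elliptic S s a k (\<lambda>\<tau> z. F \<tau> z + G \<tau> z)"
| mono: "poly_over_elliptic S s a k F \<Longrightarrow> k \<le> l \<Longrightarrow> poly_over_elliptic S s a l F"
| cong: "poly_over_elliptic S s a k F \<Longrightarrow> (\<And>\<tau> z. Im \<tau> > 0 \<Longrightarrow> separated (insert s S) \<tau> z \<Longrightarrow> F \<tau> z = G \<tau> z) \<Longrightarrow> poly_over_elliptic S s a k G"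

lemma poly_over_elliptic_elliptic:
  "elliptic_in S s a k F \<Longrightarrow> poly_over_elliptic S s a k F"
  using poly_over_elliptic.monom[of S s a k F 0] by simp

lemma poly_over_elliptic_mult_monom:
  assumes "poly_over_elliptic S s a l G" "elliptic_in S s a k F"
  shows "poly_over_elliptic S s a ((p + k) + l) (\<lambda>\<tau> z. (theta_deriv 0 \<tau> (z s - z a) ^ p * F \<tau> z) * G \<tau> z)"
  using assms(1)
proof (induction rule: poly_over_elliptic.induct)
  case (monom l G q)
  have "poly_over_elliptic S s a ((p + q) + (k + l)) (\<lambda>\<tau> z. theta_deriv 0 \<tau> (z s - z a) ^ (p + q) * (F \<tau> z * G \<tau> z))"
    by (intro poly_over_elliptic.monom elliptic_in.mult assms monom)
  then show ?case by (simp add: power_add mult_ac add_ac)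
next
  case (add l G H)
  then show ?case using poly_over_elliptic.add[OF add.IH] by (simp add: ring_distribs)
next
  case (mono k F l)
  show ?case by (rule poly_over_elliptic.mono[OF mono.IH]) (use mono in auto)
next
  case (cong k F G)
  show ?case by (rule poly_over_elliptic.cong[OF cong.IH]) (use cong in auto)
qed

lemma poly_over_elliptic_mult:
  assumes "poly_over_elliptic S s a k F" "poly_over_elliptic S s a l G"
  shows "poly_over_elliptic S s a (k + l) (\<lambda>\<tau> z. F \<tau> z * G \<tau> z)"
  using assms(1)
proof (induction rule: poly_over_elliptic.induct)
  case (monom k F p)
  show ?case by (rule poly_over_elliptic_mult_monom[OF assms(2) monom])
next
  case (add l F H)
  then show ?case using poly_over_elliptic.add[OF add.IH] by (simp add: ring_distribs)
next
  case (mono k F l)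
  show ?case by (rule poly_over_elliptic.mono[OF mono.IH]) (use mono in auto)
next
  case (cong k F G)
  show ?case by (rule poly_over_elliptic.cong[OF cong.IH]) (use cong in auto)
qed

lemma poly_over_elliptic_theta:
  assumes "i \<in> S" "a \<in> S"
  shows "poly_over_elliptic S s a (Suc m) (\<lambda>\<tau> z. theta_deriv m \<tau> (z s - z i))"
proof (cases m)
  case 0
  have "poly_over_elliptic S s a (1 + 0) (\<lambda>\<tau> z. theta_deriv 0 \<tau> (z s - z a) ^ 1 * 1)"
    by (intro poly_over_elliptic.monom elliptic_in.coeff qm_poly.const)
  then have "poly_over_elliptic S s a 1 (\<lambda>\<tau> z. theta_deriv 0 \<tau> (z s - z a))" by simp
  from poly_over_elliptic.add[OF poly_over_elliptic_elliptic[OF elliptic_in.diff[OF assms(1)]] this]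
  show ?thesis by (simp add: 0)
next
  case (Suc m')
  then show ?thesis using assms by (auto intro!: poly_over_elliptic_elliptic elliptic_in.deriv simp del: funpow.simps)
qed

lemma qm_poly_imp_poly_over_elliptic:
  assumes "qm_poly (insert s S) k F" "s \<notin> S" "a \<in> S"
  shows "poly_over_elliptic S s a k F"
  using assms
proof (induction rule: qm_poly.induct)
  case (theta i i' m)
  consider "i = s" "i' \<in> S" | "i' = s" "i \<in> S" | "i \<in> S" "i' \<in> S" using theta by auto
  then show ?case
  proof cases
    case 1
    then show ?thesis using poly_over_elliptic_theta[of i' S a s m] theta by simp
  next
    case 2
    have "poly_over_elliptic S s a (0 + Suc m) (\<lambda>\<tau> z. (- 1) ^ Suc m * theta_deriv m \<tau> (z s - z i))"
      using theta 2 by (intro poly_over_elliptic_mult poly_over_elliptic_theta poly_over_elliptic_elliptic elliptic_in.coeff qm_poly.const)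
    then have "poly_over_elliptic S s a (Suc m) (\<lambda>\<tau> z. (- 1) ^ Suc m * theta_deriv m \<tau> (z s - z i))"
      by (simp only: add_0)
    then show ?thesis
    proof (rule poly_over_elliptic.cong)
      fix \<tau> z assume \<tau>: "Im \<tau> > 0" and z: "separated (insert s S) \<tau> z"
      have "z s - z i \<notin> lattice \<tau>" by (rule separatedD[OF z]) (use 2 theta in auto)
      from theta_deriv_minus[OF \<tau> this, of m]
      show "(- 1) ^ Suc m * theta_deriv m \<tau> (z s - z i) = theta_deriv m \<tau> (z i - z i')" using 2 by simp
    qed
  next
    case 3
    then show ?thesis using theta by (intro poly_over_elliptic_elliptic elliptic_in.coeff qm_poly.theta) auto
  qed
next
  case (cong k F G)
  then show ?case by (blast intro: poly_over_elliptic.cong)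
next
  case (mult k F l G)
  then show ?case by (blast intro: poly_over_elliptic_mult)
next
  case (add k F G)
  then show ?case by (blast intro: poly_over_elliptic.add)
next
  case (mono k F l)
  then show ?case by (blast intro: poly_over_elliptic.mono)
qed (auto intro: poly_over_elliptic_elliptic elliptic_in.coeff qm_poly.intros)

text \<open>
Under \<open>z s \<mapsto> z s + \<tau>\<close> the function \<open>X\<close> becomes \<open>X - 2 \<pi> \<i>\<close> while the coefficients stay
fixed. So the equation \<open>G(z) - G(z + \<tau>) = F(z)\<close> can be solved monomial by monomial with the
polynomials of \<open>exists_poly_difference\<close>, at the expense of one unit of weight, which is
regained when residues are taken.
\<close>

theorem telescoping_primitive:
  assumes F: "qm_poly (insert s S) k F" and s: "s \<notin> S" and a: "a \<in> S"
  shows "\<exists>G. qm_poly (insert s S) (Suc k) G \<and>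
    (\<forall>\<tau> z. Im \<tau> > 0 \<longrightarrow> separated (insert s S) \<tau> z \<longrightarrow> G \<tau> z - G \<tau> (z(s := z s + \<tau>)) = F \<tau> z)"
  using qm_poly_imp_poly_over_elliptic[OF F s a]
proof (induction rule: poly_over_elliptic.induct)
  case (monom k F p)
  define X where "X = (\<lambda>\<tau> z. theta_deriv 0 \<tau> (z s - z a) :: complex)"
  have X: "qm_poly (insert s S) (Suc 0) X"
    unfolding X_def by (rule qm_poly.theta) (use s a in auto)
  obtain B where B: "degree B \<le> Suc p" "\<And>x. poly B x - poly B (x - 2 * of_real pi * \<i>) = x ^ p"
    using exists_poly_difference[of "2 * of_real pi * \<i>" p] by auto
  have "qm_poly (insert s S) (Suc p + k) (\<lambda>\<tau> z. poly B (X \<tau> z) * F \<tau> z)"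
    by (intro qm_poly.mult qm_poly_poly elliptic_in_imp_qm_poly[OF monom s a] B) (use X in simp)
  then have "qm_poly (insert s S) (Suc (p + k)) (\<lambda>\<tau> z. poly B (X \<tau> z) * F \<tau> z)" by simp
  moreover have "poly B (X \<tau> z) * F \<tau> z - poly B (X \<tau> (z(s := z s + \<tau>))) * F \<tau> (z(s := z s + \<tau>)) = X \<tau> z ^ p * F \<tau> z"
    if \<tau>: "Im \<tau> > 0" and z: "separated (insert s S) \<tau> z" for \<tau> z
  proof -
    have "z s - z a \<notin> lattice \<tau>" by (rule separatedD[OF z]) (use a s in auto)
    from theta_deriv_plus_tau[OF \<tau> this, of 0]
    have "X \<tau> (z(s := z s + \<tau>)) = X \<tau> z - 2 * of_real pi * \<i>"
      using a s by (auto simp: X_def diff_add_eq[symmetric])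
    moreover have "F \<tau> (z(s := z s + \<tau>)) = F \<tau> z" by (rule elliptic_in_shift[OF monom s a \<tau> z])
    ultimately show ?thesis using B(2)[of "X \<tau> z"] by (simp flip: left_diff_distrib)
  qed
  ultimately show ?case unfolding X_def by blast
next
  case (add k F F')
  then obtain G G' where G: "qm_poly (insert s S) (Suc k) G" "qm_poly (insert s S) (Suc k) G'"
    "\<And>\<tau> z. Im \<tau> > 0 \<Longrightarrow> separated (insert s S) \<tau> z \<Longrightarrow> G \<tau> z - G \<tau> (z(s := z s + \<tau>)) = F \<tau> z"
    "\<And>\<tau> z. Im \<tau> > 0 \<Longrightarrow> separated (insert s S) \<tau> z \<Longrightarrow> G' \<tau> z - G' \<tau> (z(s := z s + \<tau>)) = F' \<tau> z"
    by blast
  show ?case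
  proof (intro exI[of _ "\<lambda>\<tau> z. G \<tau> z + G' \<tau> z"] conjI allI impI)
    show "qm_poly (insert s S) (Suc k) (\<lambda>\<tau> z. G \<tau> z + G' \<tau> z)" by (intro qm_poly.add G)
    fix \<tau> z assume \<tau>: "Im \<tau> > 0" and z: "separated (insert s S) \<tau> z"
    show "G \<tau> z + G' \<tau> z - (G \<tau> (z(s := z s + \<tau>)) + G' \<tau> (z(s := z s + \<tau>))) = F \<tau> z + F' \<tau> z"
      unfolding G(3)[OF \<tau> z, symmetric] G(4)[OF \<tau> z, symmetric] by (rule add_diff_add)
  qed
next
  case (mono k F l)
  then show ?case by (meson Suc_le_mono qm_poly.mono)
next
  case (cong k F F')
  then show ?case by metis
qed

text \<open>
Generators change at most by a constant, and constants have weight 0. The lemma reduces the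
expansion of a function at \<open>z j + \<tau>\<close> to that of another one at \<open>z j\<close>.
\<close>

lemma qm_poly_shift:
  assumes "qm_poly (insert s S) k F" "s \<notin> S"
  shows "qm_poly (insert s S) k (\<lambda>\<tau> z. F \<tau> (z(s := z s + \<tau>)))"
  using assms
proof (induction rule: qm_poly.induct)
  case (theta i i' m)
  define d where "d = (if m = 0 then (if i = s then - 2 * of_real pi * \<i> else if i' = s then 2 * of_real pi * \<i> else 0) else 0)"
  have "qm_poly (insert s S) (Suc m) (\<lambda>\<tau> z. theta_deriv m \<tau> (z i - z i') + d)"
    by (intro qm_poly.add qm_poly.theta theta qm_poly_const)
  then show ?case
  proof (rule qm_poly.cong)
    fix \<tau> z assume \<tau>: "Im \<tau> > 0" and z: "separated (insert s S) \<tau> z"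
    have n: "z i - z i' \<notin> lattice \<tau>" by (rule separatedD[OF z]) (use theta in auto)
    then have "z i - z i' - \<tau> \<notin> lattice \<tau>" using lattice_add_iff[of "- \<tau>" \<tau> "z i - z i'"] by simp
    from theta_deriv_plus_tau[OF \<tau> this, of m]
    show "theta_deriv m \<tau> (z i - z i') + d = theta_deriv m \<tau> ((z(s := z s + \<tau>)) i - (z(s := z s + \<tau>)) i')"
      using theta_deriv_plus_tau[OF \<tau> n, of m] theta by (auto simp: d_def algebra_simps)
  qed
next
  case (cong k F G)
  show ?case
  proof (rule qm_poly.cong[OF cong.IH[OF cong.prems]])
    fix \<tau> z assume \<tau>: "Im \<tau> > 0" and z: "separated (insert s S) \<tau> z"
    show "F \<tau> (z(s := z s + \<tau>)) = G \<tau> (z(s := z s + \<tau>))"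
      by (rule cong.hyps(2)[OF \<tau> separated_shift[OF z]]) simp
  qed
qed (auto intro: qm_poly.intros)

lemma qm_poly_periodic:
  assumes "qm_poly (insert s S) k F" "s \<notin> S" "Im \<tau> > 0" "separated (insert s S) \<tau> z"
  shows "F \<tau> (z(s := z s + 1)) = F \<tau> z"
  using assms
proof (induction rule: qm_poly.induct)
  case (theta i i' m)
  have n: "z i - z i' \<notin> lattice \<tau>" by (rule separatedD[OF theta(6)]) (use theta in auto)
  then have "z i - z i' - 1 \<notin> lattice \<tau>" using lattice_add_iff[of "- 1" \<tau> "z i - z i'"] by simp
  from theta_deriv_plus_1[OF theta(5) this, of m]
  show ?case using theta_deriv_plus_1[OF theta(5) n, of m] theta(3) by (auto simp: algebra_simps)
next
  case (cong k F G)
  then show ?case by (metis one_in_lattice separated_shift)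
qed auto

section \<open>Poles in one of the variables\<close>

definition pole_set :: "nat set \<Rightarrow> complex \<Rightarrow> (nat \<Rightarrow> complex) \<Rightarrow> complex set" where
  "pole_set S \<tau> z = (\<Union>j\<in>S. (\<lambda>w. w + z j) ` lattice \<tau>)"

lemma in_pole_set_iff: "w \<in> pole_set S \<tau> z \<longleftrightarrow> (\<exists>j\<in>S. w - z j \<in> lattice \<tau>)"
  by (force simp: pole_set_def image_iff)

lemma countable_pole_set: "finite S \<Longrightarrow> countable (pole_set S \<tau> z)"
  unfolding pole_set_def by (intro countable_UN countable_image countable_lattice countable_finite)

lemma not_islimpt_pole_set:
  assumes "finite S" "Im \<tau> > 0"
  shows "\<not> w islimpt pole_set S \<tau> z"
proof -
  have "\<forall>\<^sub>F u in at 0. \<forall>j\<in>S. (w - z j) + u \<notin> lattice \<tau>"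
    using assms by (intro eventually_ball_finite ballI eventually_not_in_lattice)
  then have "\<forall>\<^sub>F u in at 0. w + u \<notin> pole_set S \<tau> z"
    by eventually_elim (auto simp: in_pole_set_iff algebra_simps)
  then have "\<forall>\<^sub>F u in at w. u \<notin> pole_set S \<tau> z"
    by (simp add: at_to_0[of w] eventually_filtermap add.commute)
  then show ?thesis by (simp add: islimpt_iff_eventually)
qed

lemma qm_poly_holomorphic:
  assumes "qm_poly (insert s S) k F" "s \<notin> S" "finite S" "Im \<tau> > 0" "separated S \<tau> z"
  shows "(\<lambda>w. F \<tau> (z(s := w))) holomorphic_on - pole_set S \<tau> z"
  using assms
proof (induction rule: qm_poly.induct)
  case (theta i i' m)
  have hol: "theta_deriv m \<tau> holomorphic_on - lattice \<tau>" by (rule theta_deriv_holomorphic) fact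
  consider "i = s" "i' \<in> S" "i' \<noteq> s" | "i' = s" "i \<in> S" "i \<noteq> s" | "i \<noteq> s" "i' \<noteq> s" using theta by auto
  then show ?case
  proof cases
    case 1
    have "(theta_deriv m \<tau> \<circ> (\<lambda>w. w - z i')) holomorphic_on - pole_set S \<tau> z"
      by (rule holomorphic_on_compose_gen[OF _ hol]) (use 1 in \<open>auto simp: in_pole_set_iff intro!: holomorphic_intros\<close>)
    then show ?thesis using 1 by (simp add: o_def)
  next
    case 2
    have "(theta_deriv m \<tau> \<circ> (\<lambda>w. z i - w)) holomorphic_on - pole_set S \<tau> z"
      by (rule holomorphic_on_compose_gen[OF _ hol])
         (use 2 lattice_diff_commute in \<open>auto simp: in_pole_set_iff intro!: holomorphic_intros\<close>)
    then show ?thesis using 2 by (simp add: o_def)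
  next
    case 3
    then show ?thesis by simp
  qed
next
  case (cong k F G)
  show ?case
  proof (rule holomorphic_transform[OF cong.IH[OF cong.prems]])
    fix w assume "w \<in> - pole_set S \<tau> z"
    then have "separated (insert s S) \<tau> (z(s := w))"
      using cong.prems unfolding separated_insert_upd[OF cong.prems(1)] by (auto simp: in_pole_set_iff)
    then show "F \<tau> (z(s := w)) = G \<tau> (z(s := w))" using cong by blast
  qed
qed (auto intro!: holomorphic_intros)

section \<open>Integrals over a period and residues in a strip\<close>

abbreviation horizontal_path :: "real \<Rightarrow> real \<Rightarrow> complex" where
  "horizontal_path y \<equiv> linepath (\<i> * of_real y) (1 + \<i> * of_real y)"

lemma horizontal_integral:
  fixes f :: "complex \<Rightarrow> complex"
  shows "contour_integral (linepath (of_real x + \<i> * of_real y) (of_real x + 1 + \<i> * of_real y)) f =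
     integral {0..1} (\<lambda>t. f (of_real (x + t) + \<i> * of_real y))"
proof -
  have "linepath (of_real x + \<i> * of_real y) (of_real x + 1 + \<i> * of_real y) t = of_real (x + t) + \<i> * of_real y" for t
    by (simp add: linepath_def scaleR_conv_of_real algebra_simps)
  then show ?thesis by (simp add: contour_integral_integral)
qed

text \<open>
Integer periods reduce \<open>x\<close> to its fractional part; then the piece beyond 1 is moved back by 1.
\<close>

lemma integral_periodic:
  fixes \<phi> :: "real \<Rightarrow> complex"
  assumes cont: "continuous_on UNIV \<phi>" and per: "\<And>t. \<phi> (t + 1) = \<phi> t"
  shows "integral {0..1} (\<lambda>t. \<phi> (x + t)) = integral {0..1} \<phi>"
proof -
  have perN: "\<phi> (t + of_nat n) = \<phi> t" for n t
  proof (induction n)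
    case (Suc n)
    have "\<phi> (t + of_nat (Suc n)) = \<phi> ((t + of_nat n) + 1)" by (simp add: add_ac)
    then show ?case by (simp only: per Suc)
  qed simp
  have perI: "\<phi> (t + of_int k) = \<phi> t" for k t
  proof (cases "k \<ge> 0")
    case True
    then show ?thesis using perN[of t "nat k"] by simp
  next
    case False
    then show ?thesis using perN[of "t + of_int k" "nat (- k)"] by simp
  qed
  define r where "r = frac x"
  have r: "0 \<le> r" "r \<le> 1" by (auto simp: r_def less_imp_le frac_lt_1)
  have "\<phi> (x + t) = \<phi> (r + t)" for t
    using perI[of "r + t" "\<lfloor>x\<rfloor>"] by (simp add: r_def frac_def algebra_simps)
  then have "integral {0..1} (\<lambda>t. \<phi> (x + t)) = integral {0..1} (\<phi> \<circ> (+) r)" by (simp add: o_def)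
  also have "\<dots> = integral {r..1 + r} \<phi>" by (simp add: integral_shift_Icc_real)
  also have "\<dots> = integral {r..1} \<phi> + integral {1..1 + r} \<phi>"
    using r cont by (intro Henstock_Kurzweil_Integration.integral_combine[symmetric] integrable_continuous_real) (auto intro: continuous_on_subset)
  also have "integral {1..1 + r} \<phi> = integral {0..r} (\<phi> \<circ> (+) 1)"
    by (simp add: integral_shift_Icc_real add.commute)
  also have "\<phi> \<circ> (+) 1 = \<phi>" by (auto simp: fun_eq_iff add.commute per)
  also have "integral {r..1} \<phi> + integral {0..r} \<phi> = integral {0..1} \<phi>"
    unfolding add.commute[of "integral {r..1} \<phi>"]
    using r cont by (intro Henstock_Kurzweil_Integration.integral_combine integrable_continuous_real) (auto intro: continuous_on_subset)
  finally show ?thesis .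
qed

lemma horizontal_integral_periodic:
  assumes "continuous_on {w. Im w = y} f" "\<And>w. Im w = y \<Longrightarrow> f (w + 1) = f w"
  shows "contour_integral (linepath (of_real x + \<i> * of_real y) (of_real x + 1 + \<i> * of_real y)) f =
     contour_integral (horizontal_path y) f"
proof -
  define \<phi> where "\<phi> = (\<lambda>t. f (of_real t + \<i> * of_real y))"
  have "continuous_on UNIV \<phi>"
    unfolding \<phi>_def by (rule continuous_on_compose2[OF assms(1)]) (auto intro!: continuous_intros)
  moreover have "\<phi> (t + 1) = \<phi> t" for t
    using assms(2)[of "of_real t + \<i> * of_real y"] by (simp add: \<phi>_def add_ac)
  ultimately have "integral {0..1} (\<lambda>t. \<phi> (x + t)) = integral {0..1} (\<lambda>t. \<phi> (0 + t))"
    by (simp add: integral_periodic)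
  then show ?thesis
    using horizontal_integral[of x y f] horizontal_integral[of 0 y f] by (simp add: \<phi>_def)
qed

lemma contour_integral_linepath_translate:
  "contour_integral (linepath (a + c) (b + c)) f = contour_integral (linepath a b) (\<lambda>w. f (w + c))"
proof -
  have "linepath (a + c) (b + c) t = linepath a b t + c" for t
    by (simp add: linepath_def scaleR_conv_of_real algebra_simps)
  then show ?thesis by (simp add: contour_integral_integral)
qed

text \<open>
The domain for the residue theorem is the plane without the poles outside the rectangle. It is
open because the poles are discrete, and connected because they are countable.
\<close>

lemma rectangle_residues:
  fixes g :: "complex \<Rightarrow> complex"
  assumes disc: "\<And>w. \<not> w islimpt L" and cntL: "countable L"
    and hol: "g holomorphic_on - L"
    and ab: "Re a < Re b" "Im a < Im b"
    and Lbox: "L \<inter> cbox a b \<subseteq> box a b"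
  shows "contour_integral (rectpath a b) g = 2 * of_real pi * \<i> * (\<Sum>p\<in>L \<inter> box a b. residue g p)"
proof -
  define pts where "pts = L \<inter> box a b"
  have clL: "closed A" if "A \<subseteq> L" for A
    using disc islimpt_subset[OF _ that] by (auto simp: closed_limpt)
  have fin: "finite pts"
  proof (rule ccontr)
    assume "infinite pts"
    moreover have "compact pts"
      unfolding compact_eq_bounded_closed using clL[of pts] bounded_subset[OF bounded_box[of a b], of pts]
      by (auto simp: pts_def)
    ultimately obtain x where "x islimpt pts"
      using Heine_Borel_imp_Bolzano_Weierstrass[of pts pts] by auto
    then show False using disc islimpt_subset[of x pts L] by (auto simp: pts_def)
  qed
  \<comment> \<open>Only the poles inside the rectangle are left as singularities.\<close>
  define S where "S = - (L - pts)"
  have "open S" unfolding S_def by (rule open_Compl[OF clL]) auto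
  have "connected S"
    using connected_open_diff_countable[of "UNIV :: complex set" "L - pts"] countable_subset[OF _ cntL, of "L - pts"]
    by (auto simp: S_def Compl_eq_Diff_UNIV)
  have le: "Re a \<le> Re b" "Im a \<le> Im b" using ab by auto
  have pathL: "path_image (rectpath a b) \<inter> L = {}"
    using Lbox path_image_rectpath_inter_box[OF le] path_image_rectpath_subset_cbox[OF le] by blast
  have "contour_integral (rectpath a b) g = 2 * pi * \<i> * (\<Sum>p\<in>pts. winding_number (rectpath a b) p * residue g p)"
  proof (rule Residue_theorem[OF \<open>open S\<close> \<open>connected S\<close> fin])
    show "g holomorphic_on S - pts" by (rule holomorphic_on_subset[OF hol]) (auto simp: S_def pts_def)
    show "path_image (rectpath a b) \<subseteq> S - pts" using pathL by (auto simp: S_def pts_def)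
    show "\<forall>z. z \<notin> S \<longrightarrow> winding_number (rectpath a b) z = 0"
    proof (intro allI impI)
      fix z assume "z \<notin> S"
      then have "z \<notin> cbox a b" using Lbox by (auto simp: S_def pts_def)
      then show "winding_number (rectpath a b) z = 0" by (rule winding_number_rectpath_outside[OF le])
    qed
  qed auto
  also have "(\<Sum>p\<in>pts. winding_number (rectpath a b) p * residue g p) = (\<Sum>p\<in>pts. residue g p)"
    by (intro sum.cong) (auto simp: pts_def winding_number_rectpath)
  finally show ?thesis by (simp add: pts_def)
qed

text \<open>
The residue theorem for a rectangle of width 1 between the heights \<open>y\<close> and \<open>y'\<close>: the vertical
sides cancel by periodicity. As poles may lie on any prescribed vertical line, the rectangle
is first moved to an abscissa \<open>c\<close> that avoids the countably many real parts of poles, and the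
representatives \<open>Q\<close> of the poles modulo 1 are translated into it.
\<close>

theorem strip_residues:
  fixes g :: "complex \<Rightarrow> complex"
  assumes disc: "\<And>w. \<not> w islimpt L" and cntL: "countable L"
    and hol: "g holomorphic_on - L"
    and L1: "\<And>w. w + 1 \<in> L \<longleftrightarrow> w \<in> L" and per: "\<And>w. w \<notin> L \<Longrightarrow> g (w + 1) = g w"
    and Q: "finite Q" "\<And>p. p \<in> Q \<Longrightarrow> p \<in> L \<and> y < Im p \<and> Im p < y'"
    and Qinj: "\<And>p p'. p \<in> Q \<Longrightarrow> p' \<in> Q \<Longrightarrow> p - p' \<in> \<int> \<Longrightarrow> p = p'"
    and Qall: "\<And>w. w \<in> L \<Longrightarrow> y \<le> Im w \<Longrightarrow> Im w \<le> y' \<Longrightarrow> \<exists>p\<in>Q. w - p \<in> \<int>"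
    and yy': "y < y'"
  shows "contour_integral (horizontal_path y) g
    - contour_integral (horizontal_path y') g = 2 * of_real pi * \<i> * (\<Sum>p\<in>Q. residue g p)"
proof -
  have LN: "w + of_nat n \<in> L \<longleftrightarrow> w \<in> L" "w \<notin> L \<Longrightarrow> g (w + of_nat n) = g w" for w n
  proof (induction n)
    case (Suc n)
    have e: "w + of_nat (Suc n) = (w + of_nat n) + 1" by (simp add: add_ac)
    { case 1 show ?case unfolding e L1 by (rule Suc.IH) }
    { case 2 then show ?case unfolding e using Suc.IH by (simp add: per) }
  qed auto
  have LI: "w + of_int n \<in> L \<longleftrightarrow> w \<in> L" "w \<notin> L \<Longrightarrow> g (w + of_int n) = g w" for w n
  proof -
    show 1: "w + of_int n \<in> L \<longleftrightarrow> w \<in> L" for w n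
      using LN(1)[of w "nat n"] LN(1)[of "w + of_int n" "nat (- n)"] by (cases "n \<ge> 0") auto
    show "g (w + of_int n) = g w" if "w \<notin> L"
      using LN(2)[of w "nat n"] LN(2)[of "w + of_int n" "nat (- n)"] that 1[of w n] by (cases "n \<ge> 0") auto
  qed
  have "countable ((\<lambda>(p, n). Re p + of_int n) ` (Q \<times> (UNIV :: int set)))"
    using Q(1) by (intro countable_image countable_SIGMA) (auto simp: countable_finite)
  \<comment> \<open>An abscissa at which neither vertical side meets a pole.\<close>
  then obtain c where c: "c \<notin> (\<lambda>(p, n). Re p + of_int n) ` (Q \<times> (UNIV :: int set))"
    using uncountable_UNIV_real by (metis UNIV_eq_I)
  have c': "Re p + of_int n \<noteq> c" if "p \<in> Q" for p n
    using c that by force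
  define a where "a = Complex c y"
  define b where "b = Complex (c + 1) y'"
  have ab: "Re a < Re b" "Im a < Im b" using yy' by (auto simp: a_def b_def)
  have Lbox: "L \<inter> cbox a b \<subseteq> box a b"
  proof
    fix w assume w: "w \<in> L \<inter> cbox a b"
    then have w': "c \<le> Re w" "Re w \<le> c + 1" "y \<le> Im w" "Im w \<le> y'"
      by (auto simp: in_cbox_complex_iff a_def b_def)
    with w obtain p n where p: "p \<in> Q" "w - p = of_int n" using Qall[of w] by (auto elim: Ints_cases)
    then have w_eq: "w = p + of_int n" by (simp add: algebra_simps)
    have "Re w \<noteq> c" using c'[OF p(1), of n] by (simp add: w_eq)
    moreover have "Re w \<noteq> c + 1" using c'[OF p(1), of "n - 1"] by (auto simp: w_eq)
    moreover have "y < Im w" "Im w < y'" using Q(2)[OF p(1)] by (auto simp: w_eq)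
    ultimately show "w \<in> box a b" using w' by (auto simp: in_box_complex_iff a_def b_def)
  qed
  define sh where "sh = (\<lambda>p. p + of_int (- \<lfloor>Re p - c\<rfloor>) :: complex)"
  have resh: "residue g (sh p) = residue g p" if "p \<in> Q" for p
  proof -
    define n where "n = - \<lfloor>Re p - c\<rfloor>"
    have "\<forall>\<^sub>F w in at p. w \<notin> L" using disc[of p] by (simp add: islimpt_iff_eventually)
    then have "\<forall>\<^sub>F u in at 0. p + u \<notin> L" by (simp add: at_to_0[of p] eventually_filtermap add.commute)
    then have "\<forall>\<^sub>F u in at 0. g (p + of_int n + u) = g (p + u)"
    proof eventually_elim
      case (elim u)
      then show ?case using LI(2)[OF elim, of n] by (simp add: add_ac)
    qed
    then have "residue (\<lambda>u. g (p + of_int n + u)) 0 = residue (\<lambda>u. g (p + u)) 0"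
      by (intro residue_cong) auto
    then show ?thesis unfolding sh_def n_def[symmetric] by (simp add: residue_shift_0[of g])
  qed
  have bij: "bij_betw sh Q (L \<inter> box a b)"
    unfolding bij_betw_def
  proof
    show "inj_on sh Q"
    proof (rule inj_onI)
      fix p p' assume p: "p \<in> Q" "p' \<in> Q" "sh p = sh p'"
      then have "p - p' = of_int (\<lfloor>Re p - c\<rfloor> - \<lfloor>Re p' - c\<rfloor>)" by (simp add: sh_def algebra_simps)
      then have "p - p' \<in> \<int>" by (metis Ints_of_int)
      then show "p = p'" using p Qinj by blast
    qed
    show "sh ` Q = L \<inter> box a b"
    proof (intro equalityI subsetI)
      fix w assume "w \<in> sh ` Q"
      then obtain p where p: "p \<in> Q" "w = sh p" by auto
      have "Re w = c + frac (Re p - c)" by (simp add: p sh_def frac_def)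
      then have "c \<le> Re w" "Re w \<le> c + 1" by (simp_all add: less_imp_le frac_lt_1)
      moreover have "Im w = Im p" by (simp add: p sh_def)
      moreover have "w \<in> L" unfolding p sh_def LI(1) using Q(2)[OF p(1)] by simp
      ultimately have "w \<in> L \<inter> cbox a b" using Q(2)[OF p(1)] by (auto simp: in_cbox_complex_iff a_def b_def)
      then show "w \<in> L \<inter> box a b" using Lbox by blast
    next
      fix w assume w: "w \<in> L \<inter> box a b"
      then have w': "c < Re w" "Re w < c + 1" "y < Im w" "Im w < y'"
        by (auto simp: in_box_complex_iff a_def b_def)
      with w obtain p n where p: "p \<in> Q" "w - p = of_int n" using Qall[of w] by (auto elim!: Ints_cases)
      then have w_eq: "w = p + of_int n" by (simp add: algebra_simps)
      have "\<lfloor>Re p - c\<rfloor> = - n" using w' by (intro floor_unique) (auto simp: w_eq)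
      then have "w = sh p" by (simp add: sh_def w_eq)
      then show "w \<in> sh ` Q" using p by blast
    qed
  qed
  have res: "contour_integral (rectpath a b) g = 2 * of_real pi * \<i> * (\<Sum>p\<in>Q. residue g p)"
    unfolding rectangle_residues[OF disc cntL hol ab Lbox] sum.reindex_bij_betw[OF bij, symmetric]
    by (simp add: resh)
  define a2 a4 where "a2 = Complex (Re b) (Im a)" and "a4 = Complex (Re a) (Im b)"
  have le: "Re a \<le> Re b" "Im a \<le> Im b" using ab by auto
  have pathL: "path_image (rectpath a b) \<inter> L = {}"
    using Lbox path_image_rectpath_inter_box[OF le] path_image_rectpath_subset_cbox[OF le] by blast
  have contL: "continuous_on (- L) g" using hol by (rule holomorphic_on_imp_continuous_on)
  have "path_image (rectpath a b) = closed_segment a a2 \<union> closed_segment a2 b \<union> closed_segment b a4 \<union> closed_segment a4 a"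
    by (simp add: rectpath_def Let_def path_image_join a2_def a4_def Un_assoc)
  then have cont: "continuous_on (closed_segment a a2) g" "continuous_on (closed_segment a2 b) g"
    "continuous_on (closed_segment b a4) g" "continuous_on (closed_segment a4 a) g"
    using pathL by (auto intro!: continuous_on_subset[OF contL])
  have rect: "contour_integral (rectpath a b) g = contour_integral (linepath a a2) g + (contour_integral (linepath a2 b) g
      + (contour_integral (linepath b a4) g + contour_integral (linepath a4 a) g))"
    unfolding rectpath_def Let_def a2_def[symmetric] a4_def[symmetric]
    using cont by (simp add: contour_integrable_continuous_linepath)
  have "contour_integral (linepath a2 b) g = contour_integral (linepath (a + 1) (a4 + 1)) g"
  proof -
    have "a2 = a + 1" "b = a4 + 1" by (simp_all add: a2_def a4_def a_def b_def complex_eq_iff)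
    then show ?thesis by (simp only:)
  qed
  also have "\<dots> = contour_integral (linepath a a4) (\<lambda>w. g (w + 1))" by (rule contour_integral_linepath_translate)
  also have "\<dots> = contour_integral (linepath a a4) g"
  proof (rule contour_integral_cong)
    fix w assume "w \<in> path_image (linepath a a4)"
    then have "w \<in> path_image (rectpath a b)"
      using \<open>path_image (rectpath a b) = _\<close> by (auto simp: closed_segment_commute)
    then show "g (w + 1) = g w" using pathL by (intro per) auto
  qed simp
  also have "\<dots> = - contour_integral (linepath a4 a) g"
    using cont(4) by (intro contour_integral_reverse_linepath) (simp add: closed_segment_commute)
  finally have vert: "contour_integral (linepath a2 b) g = - contour_integral (linepath a4 a) g" .
  have top: "contour_integral (linepath b a4) g = - contour_integral (linepath a4 b) g"
    using cont(3) by (intro contour_integral_reverse_linepath)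
  have hline: "contour_integral (linepath (Complex c v) (Complex (c + 1) v)) g =
      contour_integral (horizontal_path v) g" if v: "v = y \<or> v = y'" for v
  proof -
    have nL: "w \<notin> L" if "Im w = v" for w
    proof
      assume "w \<in> L"
      moreover have "y \<le> Im w" "Im w \<le> y'" using v that yy' by auto
      ultimately obtain p where "p \<in> Q" "w - p \<in> \<int>" using Qall[of w] by blast
      then have "Im w = Im p" by (auto elim!: Ints_cases simp: complex_eq_iff)
      then show False using Q(2)[OF \<open>p \<in> Q\<close>] v that by auto
    qed
    have "continuous_on {w. Im w = v} g" by (rule continuous_on_subset[OF contL]) (auto simp: nL)
    from horizontal_integral_periodic[OF this, of c] nL per
    show ?thesis by (simp add: Complex_eq add_ac)
  qed
  have "contour_integral (linepath a a2) g - contour_integral (linepath a4 b) g = contour_integral (rectpath a b) g"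
    unfolding rect vert top by simp
  then show ?thesis
    unfolding res using hline[of y] hline[of y'] by (simp add: a_def b_def a2_def a4_def)
qed

section \<open>The ring of quasimodular forms\<close>

definition eisenstein_monomial :: "nat \<times> nat \<times> nat \<Rightarrow> complex \<Rightarrow> complex" where
  "eisenstein_monomial x \<tau> =
     (case x of (a, b, d) \<Rightarrow> eisenstein_G 2 \<tau> ^ a * eisenstein_G 4 \<tau> ^ b * eisenstein_G 6 \<tau> ^ d)"

definition monomials_of_weight :: "nat \<Rightarrow> (nat \<times> nat \<times> nat) set" where
  "monomials_of_weight k = {(a, b, d). 2 * a + 4 * b + 6 * d = k}"

lemma finite_monomials_of_weight: "finite (monomials_of_weight k)"
proof (rule finite_subset)
  show "monomials_of_weight k \<subseteq> {..k} \<times> {..k} \<times> {..k}" by (auto simp: monomials_of_weight_def)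
qed auto

lemma quasimodular_form_iff:
  "quasimodular_form k f \<longleftrightarrow>
     (\<exists>c. \<forall>\<tau>. Im \<tau> > 0 \<longrightarrow> f \<tau> = (\<Sum>x\<in>monomials_of_weight k. c x * eisenstein_monomial x \<tau>))"
proof
  assume "quasimodular_form k f"
  then obtain c where c: "\<forall>\<tau>. Im \<tau> > 0 \<longrightarrow> f \<tau> = (\<Sum>(a, b, d) | 2 * a + 4 * b + 6 * d = k.
          c a b d * eisenstein_G 2 \<tau> ^ a * eisenstein_G 4 \<tau> ^ b * eisenstein_G 6 \<tau> ^ d)"
    unfolding quasimodular_form_def by (elim exE)
  show "\<exists>c. \<forall>\<tau>. Im \<tau> > 0 \<longrightarrow> f \<tau> = (\<Sum>x\<in>monomials_of_weight k. c x * eisenstein_monomial x \<tau>)"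
    by (rule exI[of _ "\<lambda>(a, b, d). c a b d"])
       (simp add: c eisenstein_monomial_def monomials_of_weight_def case_prod_unfold mult.assoc)
next
  assume "\<exists>c. \<forall>\<tau>. Im \<tau> > 0 \<longrightarrow> f \<tau> = (\<Sum>x\<in>monomials_of_weight k. c x * eisenstein_monomial x \<tau>)"
  then obtain c where c: "\<forall>\<tau>. Im \<tau> > 0 \<longrightarrow> f \<tau> = (\<Sum>x\<in>monomials_of_weight k. c x * eisenstein_monomial x \<tau>)"
    by (elim exE)
  show "quasimodular_form k f"
    unfolding quasimodular_form_def
    by (rule exI[of _ "\<lambda>a b d. c (a, b, d)"])
       (simp add: c eisenstein_monomial_def monomials_of_weight_def case_prod_unfold mult.assoc)
qed

lemma quasimodular_formI:
  "(\<And>\<tau>. Im \<tau> > 0 \<Longrightarrow> f \<tau> = (\<Sum>x\<in>monomials_of_weight k. c x * eisenstein_monomial x \<tau>)) \<Longrightarrow> quasimodular_form k f"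
  unfolding quasimodular_form_iff by blast

lemma quasimodular_formE:
  assumes "quasimodular_form k f"
  obtains c where "\<And>\<tau>. Im \<tau> > 0 \<Longrightarrow> f \<tau> = (\<Sum>x\<in>monomials_of_weight k. c x * eisenstein_monomial x \<tau>)"
  using assms unfolding quasimodular_form_iff by blast

lemma quasimodular_form_cong:
  assumes "quasimodular_form k f" "\<And>\<tau>. Im \<tau> > 0 \<Longrightarrow> f \<tau> = g \<tau>"
  shows "quasimodular_form k g"
proof -
  obtain c where "\<And>\<tau>. Im \<tau> > 0 \<Longrightarrow> f \<tau> = (\<Sum>x\<in>monomials_of_weight k. c x * eisenstein_monomial x \<tau>)"
    using quasimodular_formE[OF assms(1)] by blast
  then show ?thesis using assms(2) by (intro quasimodular_formI[where c = c]) simp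
qed

lemma quasimodular_form_monomial:
  assumes "x \<in> monomials_of_weight k"
  shows "quasimodular_form k (eisenstein_monomial x)"
proof (rule quasimodular_formI)
  fix \<tau>
  show "eisenstein_monomial x \<tau> = (\<Sum>x'\<in>monomials_of_weight k. (if x' = x then 1 else 0) * eisenstein_monomial x' \<tau>)"
    using assms finite_monomials_of_weight[of k] by (simp add: if_distrib[of "\<lambda>u. u * _"] sum.delta' cong: if_cong)
qed

lemma quasimodular_form_add:
  assumes "quasimodular_form k f" "quasimodular_form k g"
  shows "quasimodular_form k (\<lambda>\<tau>. f \<tau> + g \<tau>)"
proof -
  obtain c where c: "\<And>\<tau>. Im \<tau> > 0 \<Longrightarrow> f \<tau> = (\<Sum>x\<in>monomials_of_weight k. c x * eisenstein_monomial x \<tau>)"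
    using quasimodular_formE[OF assms(1)] by blast
  obtain d where d: "\<And>\<tau>. Im \<tau> > 0 \<Longrightarrow> g \<tau> = (\<Sum>x\<in>monomials_of_weight k. d x * eisenstein_monomial x \<tau>)"
    using quasimodular_formE[OF assms(2)] by blast
  show ?thesis
    by (rule quasimodular_formI[where c = "\<lambda>x. c x + d x"]) (simp add: c d sum.distrib ring_distribs)
qed

lemma quasimodular_form_cmult:
  assumes "quasimodular_form k f"
  shows "quasimodular_form k (\<lambda>\<tau>. u * f \<tau>)"
proof -
  obtain c where "\<And>\<tau>. Im \<tau> > 0 \<Longrightarrow> f \<tau> = (\<Sum>x\<in>monomials_of_weight k. c x * eisenstein_monomial x \<tau>)"
    using quasimodular_formE[OF assms] by blast
  then show ?thesis
    by (intro quasimodular_formI[where c = "\<lambda>x. u * c x"]) (simp add: sum_distrib_left mult.assoc)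
qed

lemma quasimodular_form_0: "quasimodular_form k (\<lambda>\<tau>. 0)"
  by (rule quasimodular_formI[where c = "\<lambda>_. 0"]) simp

lemma quasimodular_form_sum:
  "(\<And>x. x \<in> A \<Longrightarrow> quasimodular_form k (f x)) \<Longrightarrow> quasimodular_form k (\<lambda>\<tau>. \<Sum>x\<in>A. f x \<tau>)"
  by (induction A rule: infinite_finite_induct) (auto intro: quasimodular_form_0 quasimodular_form_add)

lemma quasimodular_form_mult:
  assumes "quasimodular_form k f" "quasimodular_form l g"
  shows "quasimodular_form (k + l) (\<lambda>\<tau>. f \<tau> * g \<tau>)"
proof -
  obtain c where c: "\<And>\<tau>. Im \<tau> > 0 \<Longrightarrow> f \<tau> = (\<Sum>x\<in>monomials_of_weight k. c x * eisenstein_monomial x \<tau>)"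
    using quasimodular_formE[OF assms(1)] by blast
  obtain d where d: "\<And>\<tau>. Im \<tau> > 0 \<Longrightarrow> g \<tau> = (\<Sum>x\<in>monomials_of_weight l. d x * eisenstein_monomial x \<tau>)"
    using quasimodular_formE[OF assms(2)] by blast
  have "quasimodular_form (k + l) (\<lambda>\<tau>. \<Sum>x\<in>monomials_of_weight k. \<Sum>x'\<in>monomials_of_weight l.
      (c x * d x') * (eisenstein_monomial x \<tau> * eisenstein_monomial x' \<tau>))"
  proof (intro quasimodular_form_sum quasimodular_form_cmult)
    fix x x' assume xx': "x \<in> monomials_of_weight k" "x' \<in> monomials_of_weight l"
    obtain a b e a' b' e' where x: "x = (a, b, e)" "x' = (a', b', e')" by (metis surj_pair)
    have "(a + a', b + b', e + e') \<in> monomials_of_weight (k + l)"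
      using xx' by (auto simp: monomials_of_weight_def x)
    from quasimodular_form_monomial[OF this]
    show "quasimodular_form (k + l) (\<lambda>\<tau>. eisenstein_monomial x \<tau> * eisenstein_monomial x' \<tau>)"
      by (rule quasimodular_form_cong) (simp add: eisenstein_monomial_def x power_add mult_ac)
  qed
  then show ?thesis
    by (rule quasimodular_form_cong) (simp add: c d sum_product mult_ac)
qed

lemma quasimodular_form_mixed_cong:
  assumes "quasimodular_form_mixed k f" "\<And>\<tau>. Im \<tau> > 0 \<Longrightarrow> f \<tau> = g \<tau>"
  shows "quasimodular_form_mixed k g"
  using assms unfolding quasimodular_form_mixed_def by metis

lemma quasimodular_form_imp_mixed:
  assumes "quasimodular_form k f" "k \<le> K"
  shows "quasimodular_form_mixed K f"
  unfolding quasimodular_form_mixed_def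
proof (intro exI[of _ "\<lambda>k' \<tau>. if k' = k then f \<tau> else 0"] conjI allI impI)
  show "quasimodular_form k' (\<lambda>\<tau>. if k' = k then f \<tau> else 0)" for k'
    using assms(1) quasimodular_form_0[of k'] by (cases "k' = k") auto
qed (use assms(2) in auto)

lemma quasimodular_form_mixed_add:
  assumes "quasimodular_form_mixed K f" "quasimodular_form_mixed K g"
  shows "quasimodular_form_mixed K (\<lambda>\<tau>. f \<tau> + g \<tau>)"
proof -
  obtain F G where "\<And>k. k \<le> K \<Longrightarrow> quasimodular_form k (F k)" "\<And>\<tau>. Im \<tau> > 0 \<Longrightarrow> f \<tau> = (\<Sum>k\<le>K. F k \<tau>)"
    "\<And>k. k \<le> K \<Longrightarrow> quasimodular_form k (G k)" "\<And>\<tau>. Im \<tau> > 0 \<Longrightarrow> g \<tau> = (\<Sum>k\<le>K. G k \<tau>)"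
    using assms unfolding quasimodular_form_mixed_def by metis
  then show ?thesis unfolding quasimodular_form_mixed_def
    by (intro exI[of _ "\<lambda>k \<tau>. F k \<tau> + G k \<tau>"]) (auto simp: sum.distrib intro: quasimodular_form_add)
qed

lemma quasimodular_form_mixed_sum:
  "(\<And>x. x \<in> A \<Longrightarrow> quasimodular_form_mixed k (f x)) \<Longrightarrow> quasimodular_form_mixed k (\<lambda>\<tau>. \<Sum>x\<in>A. f x \<tau>)"
  by (induction A rule: infinite_finite_induct)
     (auto intro: quasimodular_form_imp_mixed[OF quasimodular_form_0 le0] quasimodular_form_mixed_add)

lemma quasimodular_form_mixed_mono:
  assumes "quasimodular_form_mixed k f" "k \<le> l"
  shows "quasimodular_form_mixed l f"
proof -
  obtain F where F: "\<And>i. i \<le> k \<Longrightarrow> quasimodular_form i (F i)" "\<And>\<tau>. Im \<tau> > 0 \<Longrightarrow> f \<tau> = (\<Sum>i\<le>k. F i \<tau>)"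
    using assms unfolding quasimodular_form_mixed_def by metis
  have "quasimodular_form_mixed l (\<lambda>\<tau>. \<Sum>i\<le>k. F i \<tau>)"
    by (intro quasimodular_form_mixed_sum quasimodular_form_imp_mixed[OF F(1)]) (use assms(2) in auto)
  then show ?thesis by (rule quasimodular_form_mixed_cong) (simp add: F(2))
qed

lemma quasimodular_form_mixed_mult:
  assumes "quasimodular_form_mixed K f" "quasimodular_form_mixed L g"
  shows "quasimodular_form_mixed (K + L) (\<lambda>\<tau>. f \<tau> * g \<tau>)"
proof -
  obtain F G where FG: "\<And>k. k \<le> K \<Longrightarrow> quasimodular_form k (F k)" "\<And>\<tau>. Im \<tau> > 0 \<Longrightarrow> f \<tau> = (\<Sum>k\<le>K. F k \<tau>)"
    "\<And>k. k \<le> L \<Longrightarrow> quasimodular_form k (G k)" "\<And>\<tau>. Im \<tau> > 0 \<Longrightarrow> g \<tau> = (\<Sum>k\<le>L. G k \<tau>)"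
    using assms unfolding quasimodular_form_mixed_def by metis
  have "quasimodular_form_mixed (K + L) (\<lambda>\<tau>. \<Sum>k\<le>K. \<Sum>l\<le>L. F k \<tau> * G l \<tau>)"
  proof (intro quasimodular_form_mixed_sum)
    fix k l assume "k \<in> {..K}" "l \<in> {..L}"
    then show "quasimodular_form_mixed (K + L) (\<lambda>\<tau>. F k \<tau> * G l \<tau>)"
      by (intro quasimodular_form_imp_mixed[OF quasimodular_form_mult[OF FG(1)[of k] FG(3)[of l]]]) auto
  qed
  then show ?thesis by (rule quasimodular_form_mixed_cong) (simp add: FG sum_product)
qed

lemma qm_poly_empty_imp_quasimodular:
  assumes "qm_poly {} k F"
  shows "quasimodular_form_mixed k (\<lambda>\<tau>. F \<tau> z)"
  using assms
proof (induction rule: qm_poly.induct)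
  case (const c)
  have "quasimodular_form 0 (\<lambda>\<tau>. c * eisenstein_monomial (0, 0, 0) \<tau>)"
    by (intro quasimodular_form_cmult quasimodular_form_monomial) (simp add: monomials_of_weight_def)
  then show ?case by (auto simp: eisenstein_monomial_def dest: quasimodular_form_imp_mixed[OF _ order.refl])
next
  case G2
  have "quasimodular_form 2 (eisenstein_monomial (1, 0, 0))"
    by (rule quasimodular_form_monomial) (simp add: monomials_of_weight_def)
  from quasimodular_form_imp_mixed[OF this order.refl] show ?case
    by (rule quasimodular_form_mixed_cong) (simp add: eisenstein_monomial_def)
next
  case G4
  have "quasimodular_form 4 (eisenstein_monomial (0, 1, 0))"
    by (rule quasimodular_form_monomial) (simp add: monomials_of_weight_def)
  from quasimodular_form_imp_mixed[OF this order.refl] show ?case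
    by (rule quasimodular_form_mixed_cong) (simp add: eisenstein_monomial_def)
next
  case G6
  have "quasimodular_form 6 (eisenstein_monomial (0, 0, 1))"
    by (rule quasimodular_form_monomial) (simp add: monomials_of_weight_def)
  from quasimodular_form_imp_mixed[OF this order.refl] show ?case
    by (rule quasimodular_form_mixed_cong) (simp add: eisenstein_monomial_def)
next
  case (cong k F G)
  show ?case by (rule quasimodular_form_mixed_cong[OF cong.IH]) (auto intro!: cong.hyps simp: separated_def)
qed (auto intro: quasimodular_form_mixed_add quasimodular_form_mixed_mult quasimodular_form_mixed_mono)

text \<open>
With one variable there are no differences, so nothing depends on it.
\<close>

lemma qm_poly_singleton:
  assumes "qm_poly {s} k F"
  shows "qm_poly {} k F"
  using assms
proof (induction rule: qm_poly.induct)
  case (cong k F G)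
  show ?case by (rule qm_poly.cong[OF cong.IH]) (auto intro!: cong.hyps simp: separated_def)
qed (auto intro: qm_poly.intros)

section \<open>Integrating out the variables\<close>

lemma Im_Ints_eq_0: "w \<in> \<int> \<Longrightarrow> Im w = 0"
  by (auto elim!: Ints_cases)

lemma lattice_Im_small:
  assumes "w \<in> lattice \<tau>" "\<bar>Im w\<bar> < Im \<tau>"
  shows "w \<in> \<int>"
proof -
  obtain a b where w: "w = of_int a + of_int b * \<tau>" using assms(1) by (auto simp: lattice_def)
  have \<tau>: "Im \<tau> > 0" using assms(2) by linarith
  have "\<bar>of_int b\<bar> * Im \<tau> < 1 * Im \<tau>" using assms(2) \<tau> by (simp add: w abs_mult)
  then have "\<bar>real_of_int b\<bar> < 1" using \<tau> by (simp only: mult_less_cancel_right_pos)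
  then have "b = 0" by linarith
  then show ?thesis by (simp add: w)
qed

text \<open>
The heart of the proof: integrating out one variable does not lead out of the class and does not
raise the weight. Write \<open>F(w) = G(w) - G(w + \<tau>)\<close> by \<open>telescoping_primitive\<close>. Then the
integral of \<open>F\<close> over a period is the difference of the integrals of \<open>G\<close> along the lower and
the upper edge of a strip of height \<open>Im \<tau>\<close>, and hence \<open>2 \<pi> \<i>\<close> times a sum of residues of
\<open>G\<close>. The strip contains one pole for each \<open>j \<in> S\<close>: it is \<open>z j\<close> if \<open>z j\<close> lies above the path
and \<open>z j + \<tau>\<close> if it lies below. The function \<open>G\<close> has weight \<open>k + 1\<close> and its residues have
weight \<open>k\<close>. Of the heights, the result depends only on the set \<open>U\<close> of the variables above the
path; so one function \<open>F'\<close> serves for all \<open>\<tau>\<close>.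
\<close>

lemma constant_term_one_variable:
  assumes F: "qm_poly (insert s S) k F" and s: "s \<notin> S" and S: "finite S"
  shows "\<exists>F'. qm_poly S k F' \<and> (\<forall>\<tau> z y. Im \<tau> > 0 \<longrightarrow>
     (\<forall>i\<in>S. \<forall>j\<in>S. i \<noteq> j \<longrightarrow> Im (z i) \<noteq> Im (z j) \<and> \<bar>Im (z i) - Im (z j)\<bar> < Im \<tau>) \<longrightarrow>
     (\<forall>j\<in>S. if j \<in> U then y < Im (z j) \<and> Im (z j) < y + Im \<tau> else y - Im \<tau> < Im (z j) \<and> Im (z j) < y) \<longrightarrow>
     contour_integral (horizontal_path y) (\<lambda>w. F \<tau> (z(s := w))) = F' \<tau> z)"
proof (cases "S = {}")
  case True
  have F0: "qm_poly {} k F" using F qm_poly_singleton by (simp add: True)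
  have "F \<tau> (z(s := w)) = F \<tau> z" if "Im \<tau> > 0" for \<tau> z w
    by (rule qm_poly_independent[OF F0]) (use that in \<open>auto simp: separated_def\<close>)
  then show ?thesis using F0 by (intro exI[of _ F]) (simp add: True)
next
  case False
  then obtain a where a: "a \<in> S" by auto
  obtain G where G: "qm_poly (insert s S) (Suc k) G"
    "\<And>\<tau> z. Im \<tau> > 0 \<Longrightarrow> separated (insert s S) \<tau> z \<Longrightarrow> G \<tau> z - G \<tau> (z(s := z s + \<tau>)) = F \<tau> z"
    using telescoping_primitive[OF F s a] by blast
  \<comment> \<open>The function whose expansion at \<open>z j\<close> is that of \<open>G\<close> at the representative in the strip.\<close>
  define H where "H = (\<lambda>j. if j \<in> U then G else (\<lambda>\<tau> z. G \<tau> (z(s := z s + \<tau>))))"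
  have "qm_poly (insert s S) (Suc k) (H j)" for j
    using G(1) qm_poly_shift[OF G(1) s] by (simp add: H_def)
  then have "\<forall>j\<in>S. laurent_qm S s j (Suc k) (H j)"
    using qm_poly_laurent S s by blast
  then have "\<exists>C. \<forall>j\<in>S. (\<forall>r. qm_poly S r (C j r)) \<and> (\<forall>\<tau> z. Im \<tau> > 0 \<longrightarrow> separated S \<tau> z \<longrightarrow>
        (\<lambda>u. H j \<tau> (z(s := z j + u))) has_laurent_expansion laurent_series (Suc k) (\<lambda>r. C j r \<tau> z))"
    unfolding laurent_qm_def by (rule bchoice)
  then obtain C where C: "\<And>j r. j \<in> S \<Longrightarrow> qm_poly S r (C j r)"
    "\<And>j \<tau> z. j \<in> S \<Longrightarrow> Im \<tau> > 0 \<Longrightarrow> separated S \<tau> z \<Longrightarrow>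
        (\<lambda>u. H j \<tau> (z(s := z j + u))) has_laurent_expansion laurent_series (Suc k) (\<lambda>r. C j r \<tau> z)"
    by blast
  show ?thesis
  proof (intro exI conjI allI impI)
    \<comment> \<open>The residue is the coefficient of index \<open>k\<close>, since \<open>u ^ (k - (k + 1))\<close> is \<open>1 / u\<close>.\<close>
    show "qm_poly S k (\<lambda>\<tau> z. (2 * of_real pi * \<i>) * (\<Sum>j\<in>S. C j k \<tau> z))"
      by (intro qm_poly_cmult qm_poly_sum C)
    fix \<tau> :: complex and z :: "nat \<Rightarrow> complex" and y :: real
    assume \<tau>: "Im \<tau> > 0"
      and sep: "\<forall>i\<in>S. \<forall>j\<in>S. i \<noteq> j \<longrightarrow> Im (z i) \<noteq> Im (z j) \<and> \<bar>Im (z i) - Im (z j)\<bar> < Im \<tau>"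
      and Uy: "\<forall>j\<in>S. if j \<in> U then y < Im (z j) \<and> Im (z j) < y + Im \<tau> else y - Im \<tau> < Im (z j) \<and> Im (z j) < y"
    have nl: "z i - z j \<notin> lattice \<tau>" if "i \<in> S" "j \<in> S" "i \<noteq> j" for i j
    proof
      assume "z i - z j \<in> lattice \<tau>"
      then have "z i - z j \<in> \<int>" using sep that by (intro lattice_Im_small[of _ \<tau>]) auto
      then have "Im (z i - z j) = 0" by (rule Im_Ints_eq_0)
      then show False using sep that by auto
    qed
    then have z: "separated S \<tau> z" by (auto simp: separated_def)
    define L where "L = pole_set S \<tau> z"
    define g where "g = (\<lambda>w. G \<tau> (z(s := w)))"
    define p where "p = (\<lambda>j. if j \<in> U then z j else z j + \<tau>)"
    define y' where "y' = y + Im \<tau>"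
    have p: "y < Im (p j) \<and> Im (p j) < y'" if "j \<in> S" for j
      using Uy that by (auto simp: p_def y'_def split: if_splits)
    have pz: "p j - z j \<in> lattice \<tau>" for j by (simp add: p_def)
    have sepw: "separated (insert s S) \<tau> (z(s := w))" if "w \<notin> L" for w
      using that z by (auto simp: separated_insert_upd[OF s] L_def in_pole_set_iff)
    have Lmod: "w + c \<in> L \<longleftrightarrow> w \<in> L" if c: "c \<in> lattice \<tau>" for w c
    proof -
      have "w + c - z j \<in> lattice \<tau> \<longleftrightarrow> w - z j \<in> lattice \<tau>" for j
        using lattice_add_iff[OF c, of "w - z j"] by (simp add: algebra_simps)
      then show ?thesis by (simp add: L_def in_pole_set_iff)
    qed
    have hol: "g holomorphic_on - L"
      unfolding g_def L_def by (rule qm_poly_holomorphic[OF G(1) s S \<tau> z])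
    have pint: "w - p j \<in> \<int>" if "w - z j \<in> lattice \<tau>" "j \<in> S" "y \<le> Im w" "Im w \<le> y'" for w j
    proof (rule lattice_Im_small)
      show "w - p j \<in> lattice \<tau>" using lattice_diff[OF that(1) pz[of j]] by simp
      show "\<bar>Im (w - p j)\<bar> < Im \<tau>" using p[OF that(2)] that(3,4) by (auto simp: y'_def)
    qed
    have inj: "inj_on p S"
    proof (rule inj_onI, rule ccontr)
      fix i j assume ij: "i \<in> S" "j \<in> S" "p i = p j" "i \<noteq> j"
      then have "z i - z j \<in> lattice \<tau>" using lattice_diff[OF pz[of j] pz[of i]] by simp
      with nl ij show False by blast
    qed
    have main: "contour_integral (horizontal_path y) g
      - contour_integral (horizontal_path y') g = 2 * of_real pi * \<i> * (\<Sum>q\<in>p ` S. residue g q)"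
    proof (rule strip_residues[where L = L])
      show "\<not> w islimpt L" for w unfolding L_def by (rule not_islimpt_pole_set[OF S \<tau>])
      show "countable L" unfolding L_def by (rule countable_pole_set[OF S])
      show "g holomorphic_on - L" by (rule hol)
      show "w + 1 \<in> L \<longleftrightarrow> w \<in> L" for w by (rule Lmod) simp
      show "g (w + 1) = g w" if "w \<notin> L" for w
        using qm_poly_periodic[OF G(1) s \<tau> sepw[OF that]] by (simp add: g_def)
      show "finite (p ` S)" using S by simp
      show "q \<in> L \<and> y < Im q \<and> Im q < y'" if "q \<in> p ` S" for q
        using that p pz by (auto simp: L_def in_pole_set_iff)
      show "q = q'" if q: "q \<in> p ` S" "q' \<in> p ` S" "q - q' \<in> \<int>" for q q'
      proof -
        obtain i j where ij: "i \<in> S" "j \<in> S" "q = p i" "q' = p j"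
          using q(1,2) by blast
        have "q - q' \<in> lattice \<tau>" using q(3) by (auto elim: Ints_cases)
        then have "(q - q') - (p i - z i) + (p j - z j) \<in> lattice \<tau>" using pz lattice_add lattice_diff by blast
        then have "z i - z j \<in> lattice \<tau>" by (simp add: ij)
        then show ?thesis using nl ij by blast
      qed
      show "\<exists>q\<in>p ` S. w - q \<in> \<int>" if "w \<in> L" "y \<le> Im w" "Im w \<le> y'" for w
        using that pint by (auto simp: L_def in_pole_set_iff)
      show "y < y'" using \<tau> by (simp add: y'_def)
    qed
    have noL: "w \<notin> L" if "Im w = y \<or> Im w = y'" for w
    proof
      assume "w \<in> L"
      then obtain j where j: "j \<in> S" "w - z j \<in> lattice \<tau>" by (auto simp: L_def in_pole_set_iff)
      then have "w - p j \<in> \<int>" using pint that \<tau> by (auto simp: y'_def)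
      then have "Im w = Im (p j)" by (auto elim!: Ints_cases simp: complex_eq_iff)
      then show False using p[OF j(1)] that by auto
    qed
    have res: "residue g (p j) = C j k \<tau> z" if j: "j \<in> S" for j
    proof -
      have "(\<lambda>u. g (p j + u)) = (\<lambda>u. H j \<tau> (z(s := z j + u)))"
        by (auto simp: g_def p_def H_def fun_eq_iff add_ac)
      then have "(\<lambda>u. g (p j + u)) has_laurent_expansion laurent_series (Suc k) (\<lambda>r. C j r \<tau> z)"
        using C(2)[OF j \<tau> z] by simp
      from has_laurent_expansion_residue[OF this] show ?thesis
        by (simp add: fls_nth_laurent_series)
    qed
    have cont: "continuous_on {w. Im w = y'} g" "continuous_on {w. Im w = y} g"
      by (rule continuous_on_subset[OF holomorphic_on_imp_continuous_on[OF hol]]; use noL in auto)+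
    have "contour_integral (horizontal_path y') g =
      contour_integral (linepath (of_real (Re \<tau>) + \<i> * of_real y') (of_real (Re \<tau>) + 1 + \<i> * of_real y')) g"
    proof (rule horizontal_integral_periodic[symmetric, OF cont(1)])
      fix w assume "Im w = y'"
      then show "g (w + 1) = g w"
        using qm_poly_periodic[OF G(1) s \<tau> sepw[of w]] noL by (simp add: g_def)
    qed
    \<comment> \<open>Moved horizontally by \<open>Re \<tau>\<close>, the upper edge is the lower one translated by \<open>\<tau>\<close>.\<close>
    also have "of_real (Re \<tau>) + \<i> * of_real y' = \<i> * of_real y + \<tau>"
      by (simp add: complex_eq_iff y'_def)
    also have "of_real (Re \<tau>) + 1 + \<i> * of_real y' = 1 + \<i> * of_real y + \<tau>"
      by (simp add: complex_eq_iff y'_def)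
    also have "contour_integral (linepath (\<i> * of_real y + \<tau>) (1 + \<i> * of_real y + \<tau>)) g =
      contour_integral (horizontal_path y) (\<lambda>w. g (w + \<tau>))"
      by (rule contour_integral_linepath_translate)
    finally have top: "contour_integral (horizontal_path y') g = \<dots>" .
    have seg: "closed_segment (\<i> * of_real y) (1 + \<i> * of_real y) \<subseteq> {w. Im w = y}"
      by (auto simp: closed_segment_def algebra_simps)
    have i1: "g contour_integrable_on horizontal_path y"
      by (intro contour_integrable_continuous_linepath continuous_on_subset[OF cont(2) seg])
    have i2: "(\<lambda>w. g (w + \<tau>)) contour_integrable_on horizontal_path y"
      by (intro contour_integrable_continuous_linepath continuous_on_compose2[OF cont(1)])
         (use seg in \<open>auto intro!: continuous_intros simp: y'_def\<close>)
    have "contour_integral (horizontal_path y) (\<lambda>w. F \<tau> (z(s := w))) =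
      contour_integral (horizontal_path y) (\<lambda>w. g w - g (w + \<tau>))"
    proof (rule contour_integral_cong)
      fix w assume "w \<in> path_image (horizontal_path y)"
      then have "Im w = y" using seg by auto
      then have "w \<notin> L" using noL by blast
      from G(2)[OF \<tau> sepw[OF this]] show "F \<tau> (z(s := w)) = g w - g (w + \<tau>)" by (simp add: g_def)
    qed simp
    also have "\<dots> = contour_integral (horizontal_path y) g
        - contour_integral (horizontal_path y) (\<lambda>w. g (w + \<tau>))"
      by (rule contour_integral_diff[OF i1 i2])
    also have "\<dots> = 2 * of_real pi * \<i> * (\<Sum>q\<in>p ` S. residue g q)" using main unfolding top .
    also have "(\<Sum>q\<in>p ` S. residue g q) = (\<Sum>j\<in>S. C j k \<tau> z)"
      by (simp add: sum.reindex[OF inj] res)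
    finally show "contour_integral (horizontal_path y) (\<lambda>w. F \<tau> (z(s := w))) =
        (2 * of_real pi * \<i>) * (\<Sum>j\<in>S. C j k \<tau> z)" .
  qed
qed

lemma higher_deriv_weierstrass_p:
  assumes \<tau>: "Im \<tau> > 0" and w: "w \<notin> lattice \<tau>"
  shows "(deriv ^^ m) (weierstrass_p \<tau>) w =
    (if m = 0 then 8 * of_real pi ^ 2 * eisenstein_G 2 \<tau> else 0) - theta_deriv (Suc m) \<tau> w"
proof -
  define c where "c = 8 * of_real pi ^ 2 * eisenstein_G 2 \<tau>"
  have hol: "deriv (theta_logderiv \<tau>) holomorphic_on - lattice \<tau>"
    by (intro holomorphic_deriv theta_logderiv_holomorphic open_Compl_lattice \<tau>)
  have hol': "(\<lambda>w. c - deriv (theta_logderiv \<tau>) w) holomorphic_on - lattice \<tau>"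
    by (intro holomorphic_intros hol)
  have eq: "c - deriv (theta_logderiv \<tau>) v = weierstrass_p \<tau> v" if "v \<in> - lattice \<tau>" for v
    using weierstrass_p_eq_deriv_theta_logderiv[OF \<tau>, of v] that by (simp add: c_def)
  have "(deriv ^^ m) (weierstrass_p \<tau>) w = (deriv ^^ m) (\<lambda>w. c - deriv (theta_logderiv \<tau>) w) w"
    by (rule higher_deriv_transform_within_open[OF holomorphic_transform[OF hol' eq] hol' open_Compl_lattice[OF \<tau>]])
       (use w eq in auto)
  also have "\<dots> = (deriv ^^ m) (\<lambda>w. c) w - (deriv ^^ m) (deriv (theta_logderiv \<tau>)) w"
    by (rule higher_deriv_diff[OF _ hol open_Compl_lattice[OF \<tau>]]) (use w in auto)
  also have "(deriv ^^ m) (deriv (theta_logderiv \<tau>)) = theta_deriv (Suc m) \<tau>"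
    by (simp only: funpow_Suc_right o_apply)
  finally show ?thesis by (auto simp: c_def)
qed

theorem theorem1p1:
  fixes n l :: nat
    and m i j :: "nat \<Rightarrow> nat"
    and \<pi> :: "nat \<Rightarrow> nat"
    and y :: "complex \<Rightarrow> nat \<Rightarrow> real"
    and P :: "complex \<Rightarrow> (nat \<Rightarrow> complex) \<Rightarrow> complex"
  assumes "n \<ge> 1"
    and "\<And>k. k \<in> {1..l} \<Longrightarrow> i k \<in> {1..n} \<and> j k \<in> {1..n} \<and> i k \<noteq> j k"
    and "\<And>\<tau> z. P \<tau> z = (\<Prod>k=1..l. (deriv ^^ m k) (weierstrass_p \<tau>) (z (i k) - z (j k)))"
    and "\<pi> permutes {1..n}"
    and "\<And>\<tau>. Im \<tau> > 0 \<Longrightarrow> admissible_heights n \<pi> \<tau> (y \<tau>)"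
  shows "quasimodular_form_mixed (\<Sum>k=1..l. 2 + m k) (\<lambda>\<tau>. constant_term (y \<tau>) n (P \<tau>))"
proof -
  define K where "K = (\<Sum>k=1..l. 2 + m k)"
  have anti: "y \<tau> (\<pi> b) < y \<tau> (\<pi> a)" if "Im \<tau> > 0" "1 \<le> a" "a < b" "b \<le> n" for \<tau> a b
    using that(3,4)
  proof (induction b)
    case (Suc b)
    have step: "y \<tau> (\<pi> (Suc b)) < y \<tau> (\<pi> b)"
      using assms(5)[OF that(1)] Suc.prems that(2) by (auto simp: admissible_heights_def)
    show ?case
    proof (cases "a = b")
      case True
      then show ?thesis using step by simp
    next
      case False
      then show ?thesis using Suc step by simp
    qed
  qed simp
  have bounds: "0 \<le> y \<tau> v" "y \<tau> v < Im \<tau>" if "Im \<tau> > 0" "v \<in> {1..n}" for \<tau> v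
  proof -
    have "v \<in> \<pi> ` {1..n}" using permutes_image[OF assms(4)] that(2) by simp
    then obtain a where a: "v = \<pi> a" "a \<in> {1..n}" by blast
    have "y \<tau> (\<pi> n) \<le> y \<tau> v" using anti[OF that(1), of a n] a by (cases "a = n") auto
    moreover have "y \<tau> v \<le> y \<tau> (\<pi> 1)" using anti[OF that(1), of 1 a] a by (cases "a = 1") auto
    ultimately show "0 \<le> y \<tau> v" "y \<tau> v < Im \<tau>"
      using assms(5)[OF that(1)] by (auto simp: admissible_heights_def)
  qed
  have order: "if inv \<pi> u < inv \<pi> v then y \<tau> v < y \<tau> u else y \<tau> u < y \<tau> v"
    if "Im \<tau> > 0" "u \<in> {1..n}" "v \<in> {1..n}" "u \<noteq> v" for \<tau> u v
  proof -
    have inv: "inv \<pi> u \<in> {1..n}" "inv \<pi> v \<in> {1..n}"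
      using permutes_in_image[OF permutes_inv[OF assms(4)]] that by auto
    have e: "\<pi> (inv \<pi> u) = u" "\<pi> (inv \<pi> v) = v" using permutes_inverses(1)[OF assms(4)] by auto
    then have "inv \<pi> u \<noteq> inv \<pi> v" using that(4) by metis
    then show ?thesis
      using anti[OF that(1), of "inv \<pi> u" "inv \<pi> v"] anti[OF that(1), of "inv \<pi> v" "inv \<pi> u"] inv e by auto
  qed
  have gaps: "y \<tau> u \<noteq> y \<tau> v \<and> \<bar>y \<tau> u - y \<tau> v\<bar> < Im \<tau>"
    if "Im \<tau> > 0" "u \<in> {1..n}" "v \<in> {1..n}" "u \<noteq> v" for \<tau> u v
    using order[OF that] bounds[OF that(1,2)] bounds[OF that(1,3)] by (auto split: if_splits)
  \<comment> \<open>After \<open>t\<close> integrations the integrand lies in the class for the remaining variables.\<close>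
  have "\<exists>F. qm_poly {Suc t..n} K F \<and> (\<forall>\<tau> z. Im \<tau> > 0 \<longrightarrow> (\<forall>v\<in>{Suc t..n}. Im (z v) = y \<tau> v) \<longrightarrow>
      iterated_int (y \<tau>) t (P \<tau>) z = F \<tau> z)" if "t \<le> n" for t
    using that
  proof (induction t)
    case 0
    define f where "f = (\<lambda>k \<tau> (z :: nat \<Rightarrow> complex). (if m k = 0 then 8 * of_real pi ^ 2 * eisenstein_G 2 \<tau> else 0)
       - theta_deriv (Suc (m k)) \<tau> (z (i k) - z (j k)))"
    have f: "qm_poly {1..n} (2 + m k) (f k)" if "k \<in> {1..l}" for k
    proof -
      have "qm_poly {1..n} 2 (\<lambda>\<tau> z. if m k = 0 then 8 * of_real pi ^ 2 * eisenstein_G 2 \<tau> else 0)"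
        by (cases "m k = 0") (auto intro: qm_poly_const qm_poly_cmult qm_poly.G2)
      then have "qm_poly {1..n} (2 + m k) (\<lambda>\<tau> z. if m k = 0 then 8 * of_real pi ^ 2 * eisenstein_G 2 \<tau> else 0)"
        by (rule qm_poly.mono) simp
      moreover have "qm_poly {1..n} (Suc (Suc (m k))) (\<lambda>\<tau> z. theta_deriv (Suc (m k)) \<tau> (z (i k) - z (j k)))"
        using assms(2)[OF that] by (intro qm_poly.theta) auto
      ultimately show ?thesis unfolding f_def by (intro qm_poly_diff) simp_all
    qed
    have "qm_poly {1..n} K (\<lambda>\<tau> z. \<Prod>k=1..l. f k \<tau> z)"
      unfolding K_def by (intro qm_poly_prod f) auto
    moreover have "iterated_int (y \<tau>) 0 (P \<tau>) z = (\<Prod>k=1..l. f k \<tau> z)"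
      if \<tau>: "Im \<tau> > 0" and z: "\<forall>v\<in>{1..n}. Im (z v) = y \<tau> v" for \<tau> z
    proof -
      have "(deriv ^^ m k) (weierstrass_p \<tau>) (z (i k) - z (j k)) = f k \<tau> z" if k: "k \<in> {1..l}" for k
        unfolding f_def
      proof (rule higher_deriv_weierstrass_p[OF \<tau>])
        show "z (i k) - z (j k) \<notin> lattice \<tau>"
        proof
          assume *: "z (i k) - z (j k) \<in> lattice \<tau>"
          have g: "y \<tau> (i k) \<noteq> y \<tau> (j k) \<and> \<bar>y \<tau> (i k) - y \<tau> (j k)\<bar> < Im \<tau>"
            by (rule gaps[OF \<tau>]) (use assms(2)[OF k] in auto)
          have im: "Im (z (i k) - z (j k)) = y \<tau> (i k) - y \<tau> (j k)" using z assms(2)[OF k] by simp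
          have "z (i k) - z (j k) \<in> \<int>" by (rule lattice_Im_small[OF *]) (use g im in simp)
          then have "Im (z (i k) - z (j k)) = 0" by (rule Im_Ints_eq_0)
          then show False using g im by simp
        qed
      qed
      then show ?thesis by (simp add: assms(3))
    qed
    ultimately show ?case by (intro exI[of _ "\<lambda>\<tau> z. \<Prod>k=1..l. f k \<tau> z"]) simp
  next
    case (Suc t)
    then obtain F where F: "qm_poly {Suc t..n} K F" "\<And>\<tau> z. Im \<tau> > 0 \<Longrightarrow> (\<forall>v\<in>{Suc t..n}. Im (z v) = y \<tau> v) \<Longrightarrow>
      iterated_int (y \<tau>) t (P \<tau>) z = F \<tau> z" by auto
    define s where "s = Suc t"
    define S where "S = {Suc s..n}"
    have ins: "{Suc t..n} = insert s S" using Suc.prems by (auto simp: s_def S_def)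
    \<comment> \<open>Small positions in the order \<open>\<pi>\<close> mean large heights.\<close>
    define U where "U = {v\<in>S. inv \<pi> v < inv \<pi> s}"
    obtain F' where F': "qm_poly S K F'" "\<And>\<tau> z h. Im \<tau> > 0 \<Longrightarrow>
       (\<forall>i\<in>S. \<forall>j\<in>S. i \<noteq> j \<longrightarrow> Im (z i) \<noteq> Im (z j) \<and> \<bar>Im (z i) - Im (z j)\<bar> < Im \<tau>) \<Longrightarrow>
       (\<forall>j\<in>S. if j \<in> U then h < Im (z j) \<and> Im (z j) < h + Im \<tau> else h - Im \<tau> < Im (z j) \<and> Im (z j) < h) \<Longrightarrow>
       contour_integral (horizontal_path h) (\<lambda>w. F \<tau> (z(s := w))) = F' \<tau> z"
      using constant_term_one_variable[of s S K F U] F(1) unfolding ins by (auto simp: S_def)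
    have "iterated_int (y \<tau>) (Suc t) (P \<tau>) z = F' \<tau> z"
      if \<tau>: "Im \<tau> > 0" and z: "\<forall>v\<in>S. Im (z v) = y \<tau> v" for \<tau> z
    proof -
      have sub: "s \<in> {1..n}" "\<And>v. v \<in> S \<Longrightarrow> v \<in> {1..n} \<and> v \<noteq> s"
        using Suc.prems by (auto simp: s_def S_def)
      have "iterated_int (y \<tau>) (Suc t) (P \<tau>) z =
        contour_integral (horizontal_path (y \<tau> s)) (\<lambda>w. iterated_int (y \<tau>) t (P \<tau>) (z(s := w)))"
        by (simp add: s_def)
      also have "\<dots> = contour_integral (horizontal_path (y \<tau> s)) (\<lambda>w. F \<tau> (z(s := w)))"
      proof (rule contour_integral_cong)
        fix w assume "w \<in> path_image (horizontal_path (y \<tau> s))"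
        then have "Im w = y \<tau> s" by (auto simp: closed_segment_def algebra_simps)
        then show "iterated_int (y \<tau>) t (P \<tau>) (z(s := w)) = F \<tau> (z(s := w))"
          using z by (intro F(2) \<tau>) (auto simp: ins)
      qed simp
      also have "\<dots> = F' \<tau> z"
      proof (rule F'(2)[OF \<tau>])
        show "\<forall>i\<in>S. \<forall>j\<in>S. i \<noteq> j \<longrightarrow> Im (z i) \<noteq> Im (z j) \<and> \<bar>Im (z i) - Im (z j)\<bar> < Im \<tau>"
          using gaps[OF \<tau>] sub z by auto
        show "\<forall>j\<in>S. if j \<in> U then y \<tau> s < Im (z j) \<and> Im (z j) < y \<tau> s + Im \<tau>
            else y \<tau> s - Im \<tau> < Im (z j) \<and> Im (z j) < y \<tau> s"
        proof
          fix v assume v: "v \<in> S"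
          have "v \<in> {1..n}" "v \<noteq> s" using sub(2)[OF v] by auto
          then show "if v \<in> U then y \<tau> s < Im (z v) \<and> Im (z v) < y \<tau> s + Im \<tau>
            else y \<tau> s - Im \<tau> < Im (z v) \<and> Im (z v) < y \<tau> s"
            using order[OF \<tau> \<open>v \<in> {1..n}\<close> sub(1)] gaps[OF \<tau> \<open>v \<in> {1..n}\<close> sub(1)] z v
            by (auto simp: U_def split: if_splits)
        qed
      qed
      finally show ?thesis .
    qed
    then show ?case using F'(1) unfolding S_def s_def by blast
  qed
  from this[of n] obtain F where F: "qm_poly {Suc n..n} K F"
    "\<And>\<tau> z. Im \<tau> > 0 \<Longrightarrow> iterated_int (y \<tau>) n (P \<tau>) z = F \<tau> z" by auto
  have "quasimodular_form_mixed K (\<lambda>\<tau>. F \<tau> (\<lambda>_. 0))"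
    by (rule qm_poly_empty_imp_quasimodular) (use F(1) in simp)
  then have "quasimodular_form_mixed K (\<lambda>\<tau>. constant_term (y \<tau>) n (P \<tau>))"
    by (rule quasimodular_form_mixed_cong) (simp add: constant_term_def F(2))
  then show ?thesis by (simp add: K_def)
qed

end
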